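(* For any fixed positive integer $k\geq 2$, $$N(x,y)\ll \min\left\{\frac{x\log y}{y},\ \min_{2\leq j\leq k}\frac{x(\log x)^{2^j-j-1}}{y^j}\right\}.$$
   Context: For a positive integer $n$, $\omega^*(n)=\#\{d\mid n: d=p-1,\ p \text{ is a prime}\}$ is the number of positive divisors of $n$ of the form $p-1$ with $p$ prime. For $1\leq y\leq x$, $N(x,y)=\#\{n\leq x: \omega^*(n)\geq y\}$, where $n$ runs over positive integers. The notation $F\ll G$ means that there exists a constant $C>0$ such that $|F|\leq CG$; the implied constant depends at most on $k$.
   Formalization: The range 1 ≤ y ≤ x is replaced by 2 ≤ y ≤ x: at y = 1 the bound x log y / y is 0 while N(x,1) = ⌊x⌋ > 0, and for 1 < y < 2 N(x,y) is at least about x/2 while the bound tends to 0 as y tends to 1. *)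

theory Defs
  imports Complex_Main "HOL-Computational_Algebra.Primes"
begin

(* Only meaningful for n > 0; every d below is then automatically positive. *)
definition omega_star :: "nat \<Rightarrow> nat" where
  "omega_star n = card {d. d dvd n \<and> (\<exists>p. prime p \<and> d = p - 1)}"

definition N :: "real \<Rightarrow> real \<Rightarrow> nat" where
  "N x y = card {n::nat. 0 < n \<and> real n \<le> x \<and> real (omega_star n) \<ge> y}"

end

theory Submission
  imports Defs "HOL-Analysis.Analysis" "HOL-Number_Theory.Number_Theory"
begin

text \<open>
  Write a prime counted by \<open>\<omega>\<^sup>*(n)\<close> as \<open>p = q d + 1\<close> with \<open>q\<close> the largest prime factor of \<open>p - 1\<close>.
  For fixed distinct \<open>d\<^sub>1, \<dots>, d\<^sub>j\<close>, an upper bound sieve in the variable \<open>q \<sim> 2^i\<close> controls how often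
  \<open>q\<close> and all \<open>q d\<^sub>l + 1\<close> are prime: a proportion \<open>O(i^(-j-1))\<close>, up to a singular series which is bounded
  on average. Summing \<open>1 / lcm(d\<^sub>1, \<dots>, d\<^sub>j)\<close> over \<open>2^i\<close>-smooth \<open>d\<^sub>l\<close> costs \<open>i^(2^j-1)\<close>, and summing over
  \<open>2^i \<le> x\<close> gives the \<open>j\<close>-th moment \<open>O(x (ln x)^(2^j-j-1))\<close>, hence the bounds with \<open>y^j\<close>.

  For the bound \<open>x ln y / y\<close>, primes up to \<open>exp (y^24)\<close> contribute \<open>O(x ln y)\<close> to the first moment of
  \<open>\<omega>\<^sup>*\<close>. Only \<open>O(x / y)\<close> integers \<open>n \<le> x\<close> have a divisor \<open>p - 1\<close> with a larger \<open>p\<close>: given \<open>m = n / q\<close>, the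
  number of admissible \<open>q\<close> is at most the geometric mean of the number of all primes \<open>q\<close> and of the
  sieve bound summed over \<open>d\<close> dividing \<open>m\<close>, and \<open>sqrt 2 - 3 / 2 < - 1 / 12\<close>.
\<close>

section \<open>Estimates of Chebyshev and Mertens type\<close>

text \<open>Two obstacles shape the moments. An \<open>n\<close> may have many prime factors
  \<open>q\<close>, and the j-th power of a sum over \<open>q\<close> couples them. Weighting
  \<open>q\<close> by (3/2)^r, where r counts the prime factors of \<open>n\<close> not below
  \<open>q\<close>, removes the coupling. A base \<gamma> > 1 makes the inverse weights
  geometrically summable, while the weights have mean value of order (ln x / ln q)^(\<gamma> - 1),
  which sums over the blocks \<open>i\<close> without loss when \<gamma> < 2; hence 3/2. The second
  obstacle is a prime \<open>p\<close> modulo which two of the \<open>d\<close> coincide: there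
  fewer residue classes can be removed, and the loss depends on the \<open>d\<close>. Two divisors
  that are congruent modulo \<open>p\<close> and prime to \<open>p\<close> leave, after division by
  their gcd, a factor at least \<open>p\<close>. This saves a power of \<open>p\<close>, and the sum
  over \<open>p\<close> converges. For x ln y / y, a fixed power of \<open>y\<close> inside the
  exponential is harmless because Mertens' theorem takes two logarithms. The exponent 24 is 2 * 12:
  blocks from I on lose I^(-1/12), the cutoff is exp (I^2), and I is about y^12.\<close>

abbreviation primes_le :: "nat \<Rightarrow> nat set" where
  "primes_le n \<equiv> {p. prime p \<and> p \<le> n}"

abbreviation Euler_prod :: "nat set \<Rightarrow> real" where
  "Euler_prod A \<equiv> \<Prod>p\<in>A. 1 / (1 - 1 / real p)"

lemma finite_primes_le [simp]: "finite (primes_le n)"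
  by (rule finite_subset[of _ "{..n}"]) auto

lemma primes_le_2: "primes_le 2 = {2}"
proof -
  have "p = 2" if "prime p" "p \<le> 2" for p :: nat
    using prime_ge_2_nat[OF that(1)] that(2) by simp
  then show ?thesis by auto
qed

lemma prod_coprime_dvd_nat:
  fixes f :: "nat \<Rightarrow> nat"
  assumes "finite A" "\<And>p. p \<in> A \<Longrightarrow> f p dvd m"
    "\<And>p q. p \<in> A \<Longrightarrow> q \<in> A \<Longrightarrow> p \<noteq> q \<Longrightarrow> coprime (f p) (f q)"
  shows "prod f A dvd m"
  using assms
proof (induction A rule: finite_induct)
  case (insert p A)
  have "coprime (f p) (prod f A)"
    by (rule prod_coprime_right) (use insert in auto)
  moreover have "prod f A dvd m" using insert by auto
  ultimately show ?case using insert by (auto intro: divides_mult)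
qed auto

text \<open>Erdos's induction. For n = 2m + 1 the primes in (m + 1, n] divide the binomial
  coefficient n over m, which is at most 4^m because its value occurs twice in a row of sum 2^n. An
  even n > 2 adds no prime.\<close>

lemma prod_primes_le_bound: "(\<Prod>p\<in>primes_le n. p) \<le> 4 ^ n"
proof (induction n rule: less_induct)
  case (less n)
  consider "n = 0" | "n = 1" | "n = 2" | "n > 2" "even n" | "n > 2" "odd n" by fastforce
  then show ?case
  proof cases
    case 1
    then have e: "primes_le n = {}" by (auto dest: prime_gt_0_nat)
    show ?thesis unfolding e by simp
  next
    case 2
    then have e: "primes_le n = {}" by (auto dest: prime_ge_2_nat)
    show ?thesis unfolding e by simp
  next
    case 3
    then have e: "primes_le n = {2}" by (simp add: primes_le_2)
    show ?thesis unfolding e using 3 by simp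
  next
    case 4
    have "p \<le> n - 1" if "prime p" "p \<le> n" for p
      using that 4 prime_odd_nat[of p] by (cases "p = n") auto
    then have "primes_le n = primes_le (n - 1)" by (intro Collect_cong) (metis diff_le_self le_trans)
    then have "(\<Prod>p\<in>primes_le n. p) \<le> 4 ^ (n - 1)" using less[of "n - 1"] 4 by simp
    also have "\<dots> \<le> 4 ^ n" by (rule power_increasing) auto
    finally show ?thesis .
  next
    case 5
    then obtain m where m: "n = 2 * m + 1" by (auto elim: oddE)
    let ?B = "{p. prime p \<and> m + 1 < p \<and> p \<le> n}"
    have fin: "finite ?B" by (rule finite_subset[of _ "{..n}"]) auto
    have eq: "primes_le n = primes_le (m + 1) \<union> ?B" using m by auto
    have "(\<Prod>p\<in>primes_le n. p) = (\<Prod>p\<in>primes_le (m + 1). p) * \<Prod>?B"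
      unfolding eq by (rule prod.union_disjoint) (use fin in auto)
    also have "\<dots> \<le> 4 ^ (m + 1) * 4 ^ m"
    proof (rule mult_mono)
      show "(\<Prod>p\<in>primes_le (m + 1). p) \<le> 4 ^ (m + 1)" using less[of "m + 1"] m 5 by simp
      have "\<Prod>?B dvd (n choose m)"
      proof (rule prod_coprime_dvd_nat[OF fin])
        show "p dvd (n choose m)" if "p \<in> ?B" for p
        proof -
          have "p dvd fact n" using that by (simp add: prime_dvd_fact_iff)
          also have "(fact n :: nat) = fact m * fact (n - m) * (n choose m)"
            using binomial_fact_lemma[of m n] m by simp
          finally have "p dvd fact m \<or> p dvd fact (n - m) \<or> p dvd (n choose m)"
            using that prime_dvd_mult_iff[of p] by blast
          moreover have "\<not> p dvd fact m" "\<not> p dvd fact (n - m)"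
            using that m by (simp_all add: prime_dvd_fact_iff del: fact_Suc)
          ultimately show ?thesis by blast
        qed
        show "coprime p q" if "p \<in> ?B" "q \<in> ?B" "p \<noteq> q" for p q
          using that by (auto intro: primes_coprime)
      qed
      then have "\<Prod>?B \<le> (n choose m)" by (rule dvd_imp_le) (use m in auto)
      also have "\<dots> \<le> 4 ^ m"
      proof -
        have "(n choose m) = (n choose (m + 1))"
          using binomial_symmetric[of m n] m by simp
        moreover have "(\<Sum>k\<in>{m, m + 1}. n choose k) \<le> (\<Sum>k\<le>n. n choose k)"
          by (rule sum_mono2) (use m in auto)
        ultimately have "2 * (n choose m) \<le> 2 ^ n"
          by (simp add: choose_row_sum)
        then show ?thesis using m by (simp add: power_mult)
      qed
      finally show "\<Prod>?B \<le> 4 ^ m" .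
    qed auto
    also have "\<dots> = 4 ^ n" using m by (simp add: power_add[symmetric] mult_2)
    finally show ?thesis .
  qed
qed

lemma Chebyshev_theta_bound: "(\<Sum>p\<in>primes_le n. ln (real p)) \<le> real n * ln 4"
proof -
  have "(\<Sum>p\<in>primes_le n. ln (real p)) = ln (real (\<Prod>p\<in>primes_le n. p))"
    by (subst of_nat_prod, subst ln_prod) (auto dest: prime_gt_0_nat)
  also have "\<dots> \<le> ln (4 ^ n)"
  proof -
    have "real (\<Prod>p\<in>primes_le n. p) \<le> real (4 ^ n)"
      using prod_primes_le_bound[of n] by (rule of_nat_mono)
    moreover have "real (\<Prod>p\<in>primes_le n. p) > 0"
      by (subst of_nat_0_less_iff, rule prod_pos) (auto dest: prime_gt_0_nat)
    ultimately show ?thesis by simp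
  qed
  also have "\<dots> = real n * ln 4" by (simp add: ln_realpow)
  finally show ?thesis .
qed

lemma power_dvd_fact_mult: "p ^ k dvd (fact (p * k) :: nat)" if "p > 0"
proof (induction k)
  case (Suc k)
  have "fact (p * k) * (p * Suc k) dvd (fact (p * Suc k) :: nat)"
  proof -
    have "(fact (p * Suc k) :: nat) = p * Suc k * fact (p * Suc k - 1)"
      using that by (simp add: fact_reduce)
    moreover have "(fact (p * k) :: nat) dvd fact (p * Suc k - 1)"
      using that by (intro fact_dvd) auto
    ultimately show ?thesis by (metis mult.commute mult_dvd_mono dvd_refl)
  qed
  moreover have "p ^ Suc k dvd fact (p * k) * (p * Suc k)"
    using mult_dvd_mono[OF Suc, of p "p * Suc k"] by (simp add: mult.commute)
  ultimately show ?case by (rule dvd_trans[rotated])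
qed auto

text \<open>Of the exponent of \<open>p\<close> in n! only the leading term n div p is kept, which
  loses nothing of importance in an upper bound. Logarithms are compared with n! \<le> n^n, and the
  rounding error is the Chebyshev sum, at most n ln 4.\<close>

lemma Mertens_first_upper:
  assumes "n \<ge> 1"
  shows "(\<Sum>p\<in>primes_le n. ln (real p) / real p) \<le> ln (real n) + ln 4"
proof -
  let ?P = "primes_le n"
  have "(\<Prod>p\<in>?P. p ^ (n div p)) dvd (fact n :: nat)"
  proof (rule prod_coprime_dvd_nat)
    show "p ^ (n div p) dvd (fact n :: nat)" if "p \<in> ?P" for p
    proof -
      have "p ^ (n div p) dvd (fact (p * (n div p)) :: nat)"
        by (rule power_dvd_fact_mult) (use that in \<open>auto dest: prime_gt_0_nat\<close>)
      also have "\<dots> dvd fact n" by (rule fact_dvd) simp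
      finally show ?thesis .
    qed
    show "coprime (p ^ (n div p)) (q ^ (n div q))" if "p \<in> ?P" "q \<in> ?P" "p \<noteq> q" for p q
      using that by (auto intro: primes_coprime)
  qed auto
  then have "(\<Prod>p\<in>?P. p ^ (n div p)) \<le> (fact n :: nat)"
    by (rule dvd_imp_le) auto
  also have "\<dots> \<le> n ^ n" using fact_le_power[of n, where ?'a = nat] by (simp only: of_nat_id)
  finally have "real (\<Prod>p\<in>?P. p ^ (n div p)) \<le> real (n ^ n)" by (rule of_nat_mono)
  moreover have "real (\<Prod>p\<in>?P. p ^ (n div p)) > 0"
    by (subst of_nat_0_less_iff, rule prod_pos) (auto dest: prime_gt_0_nat)
  ultimately have "ln (real (\<Prod>p\<in>?P. p ^ (n div p))) \<le> ln (real (n ^ n))"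
    by (intro ln_mono)
  also have "ln (real (n ^ n)) = real n * ln (real n)"
    using assms by (simp add: ln_realpow)
  also have "ln (real (\<Prod>p\<in>?P. p ^ (n div p))) = (\<Sum>p\<in>?P. real (n div p) * ln (real p))"
    by (subst of_nat_prod, subst ln_prod) (auto dest: prime_gt_0_nat simp: ln_realpow)
  finally have 1: "(\<Sum>p\<in>?P. real (n div p) * ln (real p)) \<le> real n * ln (real n)" .
  have "(\<Sum>p\<in>?P. (real n / real p - 1) * ln (real p)) \<le> (\<Sum>p\<in>?P. real (n div p) * ln (real p))"
  proof (rule sum_mono)
    fix p assume p: "p \<in> ?P"
    have "real n / real p - 1 \<le> real (n div p)"
      using floor_correct[of "real n / real p"] by (simp add: floor_divide_of_nat_eq)
    moreover have "ln (real p) \<ge> 0" using p by (auto dest: prime_gt_0_nat)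
    ultimately show "(real n / real p - 1) * ln (real p) \<le> real (n div p) * ln (real p)"
      by (rule mult_right_mono)
  qed
  also have "(\<Sum>p\<in>?P. (real n / real p - 1) * ln (real p)) =
      real n * (\<Sum>p\<in>?P. ln (real p) / real p) - (\<Sum>p\<in>?P. ln (real p))"
    by (simp add: algebra_simps sum_subtractf sum_distrib_left)
  finally have "real n * (\<Sum>p\<in>?P. ln (real p) / real p) \<le> real n * (ln (real n) + ln 4)"
    using 1 Chebyshev_theta_bound[of n] by (simp add: algebra_simps)
  then show ?thesis using assms by simp
qed

lemma sum_primes_le_Suc:
  "(\<Sum>p\<in>primes_le (Suc n). f p) = (\<Sum>p\<in>primes_le n. f p) + (if prime (Suc n) then f (Suc n) else 0)"
proof -
  have "primes_le (Suc n) = primes_le n \<union> (if prime (Suc n) then {Suc n} else {})"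
    by (auto simp: le_Suc_eq)
  then show ?thesis by (simp add: add.commute)
qed

text \<open>Partial summation from Mertens' first bound, organised as an induction on the difference
  between the sum and a(n) / ln n. Each step uses 1 - u / v \<le> ln v - ln u for consecutive
  logarithms u < v. The 3 is 1 + ln 4 / ln 2.\<close>

lemma Mertens_second_upper:
  assumes "n \<ge> 2"
  shows "(\<Sum>p\<in>primes_le n. 1 / real p) \<le> ln (ln (real n)) + (3 - ln (ln 2))"
proof -
  define a where "a = (\<lambda>n. \<Sum>p\<in>primes_le n. ln (real p) / real p)"
  have "(\<Sum>p\<in>primes_le n. 1 / real p) - a n / ln n
      \<le> ln (ln n) - ln (ln 2) + ln 4 * (1 / ln 2 - 1 / ln n)"
    using assms
  proof (induction n rule: dec_induct)
    case base
    show ?case by (simp add: a_def primes_le_2)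
  next
    case (step n)
    define u v where "u = ln (real n)" and "v = ln (real (Suc n))"
    have uv: "0 < u" "u < v" using step by (auto simp: u_def v_def)
    have "(\<Sum>p\<in>primes_le (Suc n). 1 / real p) - a (Suc n) / v
        = (\<Sum>p\<in>primes_le n. 1 / real p) - a n / v"
      using uv unfolding a_def sum_primes_le_Suc v_def[symmetric]
      by (cases "prime (Suc n)") (simp_all add: add_divide_distrib)
    also have "\<dots> = ((\<Sum>p\<in>primes_le n. 1 / real p) - a n / u) + a n * (1 / u - 1 / v)"
      by (simp add: algebra_simps)
    also have "\<dots> \<le> (ln u - ln (ln 2) + ln 4 * (1 / ln 2 - 1 / u)) + (ln v - ln u + ln 4 * (1 / u - 1 / v))"
    proof (rule add_mono)
      show "(\<Sum>p\<in>primes_le n. 1 / real p) - a n / u \<le> ln u - ln (ln 2) + ln 4 * (1 / ln 2 - 1 / u)"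
        using step.IH by (simp add: u_def)
      have "a n * (1 / u - 1 / v) \<le> (u + ln 4) * (1 / u - 1 / v)"
        unfolding a_def u_def[symmetric]
      proof (rule mult_right_mono)
        show "(\<Sum>p\<in>primes_le n. ln (real p) / real p) \<le> u + ln 4"
          using Mertens_first_upper[of n] step by (simp add: u_def)
        have "1 / v \<le> 1 / u" using uv by (intro divide_left_mono) auto
        then show "0 \<le> 1 / u - 1 / v" by simp
      qed
      also have "\<dots> = (1 - u / v) + ln 4 * (1 / u - 1 / v)" using uv by (simp add: field_simps)
      also have "1 - u / v \<le> ln v - ln u"
        using ln_le_minus_one[of "u / v"] uv by (simp add: ln_div)
      finally show "a n * (1 / u - 1 / v) \<le> ln v - ln u + ln 4 * (1 / u - 1 / v)" by simp
    qed
    also have "\<dots> = ln v - ln (ln 2) + ln 4 * (1 / ln 2 - 1 / v)" by (simp add: algebra_simps)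
    finally show ?case by (simp add: u_def v_def)
  qed
  moreover have "a n / ln n \<le> 1 + ln 4 / ln n"
    using Mertens_first_upper[of n] assms by (simp add: a_def field_simps)
  moreover have "ln 4 = 2 * ln (2::real)"
    using ln_realpow[of 2 2] by simp
  ultimately show ?thesis by (simp add: algebra_simps)
qed

text \<open>Splitting off the exact power of \<open>p\<close> embeds \<open>S\<close> into pairs of
  an exponent and a cofactor free of \<open>p\<close>; the finite geometric sum over exponents is
  below its limit, and the cofactors are covered by induction.\<close>

lemma Euler_product_upper:
  fixes f :: "nat \<Rightarrow> real"
  assumes "finite P" "finite S"
    and "\<And>p. p \<in> P \<Longrightarrow> prime p" "\<And>p. p \<in> P \<Longrightarrow> f p < 1"
    and "\<And>m. f m \<ge> 0" "f 1 = 1" "\<And>a b. f (a * b) = f a * f b"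
    and "\<And>m. m \<in> S \<Longrightarrow> m > 0 \<and> prime_factors m \<subseteq> P"
  shows "(\<Sum>m\<in>S. f m) \<le> (\<Prod>p\<in>P. 1 / (1 - f p))"
  using assms
proof (induction P arbitrary: S rule: finite_induct)
  case empty
  have "S \<subseteq> {1}" using empty.prems(7) by (force simp: prime_factorization_empty_iff)
  then have "(\<Sum>m\<in>S. f m) \<le> (\<Sum>m\<in>{1}. f m)" by (intro sum_mono2) (use empty in auto)
  then show ?case using empty by simp
next
  case (insert p P)
  have p: "prime p" "f p < 1" using insert by auto
  define g where "g = (\<lambda>m. (multiplicity p m, m div p ^ multiplicity p m))"
  define S' where "S' = (\<lambda>m. m div p ^ multiplicity p m) ` S"
  have dec: "m = p ^ multiplicity p m * (m div p ^ multiplicity p m)" for m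
    by (simp add: multiplicity_dvd)
  define K where "K = Max (insert 0 (multiplicity p ` S))"
  have K: "multiplicity p m \<le> K" if "m \<in> S" for m
    unfolding K_def using that insert by (intro Max_ge) auto
  have fpow: "f (p ^ k) = f p ^ k" for k
    by (induction k) (use insert.prems in auto)
  have S': "m > 0 \<and> prime_factors m \<subseteq> P" if "m \<in> S'" for m
  proof -
    obtain n where n: "n \<in> S" "m = n div p ^ multiplicity p n" using \<open>m \<in> S'\<close> S'_def by auto
    have n0: "n > 0" "prime_factors n \<subseteq> insert p P" using insert.prems(7)[OF n(1)] by auto
    have "p ^ multiplicity p n * m = n" using dec[of n] n by simp
    then have m0: "m > 0" and mdvd: "m dvd n" using n0 by (auto intro: gr0I, metis dvd_triv_right)
    have "\<not> p dvd m" unfolding n(2)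
      by (rule multiplicity_decompose) (use n0 p in auto)
    moreover have "prime_factors m \<subseteq> prime_factors n"
      using n0 mdvd by (intro dvd_prime_factors) auto
    ultimately show ?thesis using n0 m0 by (auto simp: prime_factors_dvd)
  qed
  have "(\<Sum>m\<in>S. f m) = (\<Sum>m\<in>S. (\<lambda>(k, m'). f p ^ k * f m') (g m))"
    unfolding g_def by (rule sum.cong) (simp_all only: prod.case fpow[symmetric] insert.prems(6)[symmetric] dec[symmetric])
  also have "\<dots> = (\<Sum>x\<in>g ` S. (\<lambda>(k, m'). f p ^ k * f m') x)"
  proof (subst sum.reindex)
    show "inj_on g S"
    proof (rule inj_onI)
      fix m n assume "g m = g n"
      then have "fst (g m) = fst (g n)" "snd (g m) = snd (g n)" by simp_all
      then have 1: "multiplicity p m = multiplicity p n"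
        and 2: "m div p ^ multiplicity p m = n div p ^ multiplicity p n"
        by (simp_all only: g_def fst_conv snd_conv)
      have "m = p ^ multiplicity p m * (m div p ^ multiplicity p m)" by (rule dec)
      also have "\<dots> = p ^ multiplicity p n * (n div p ^ multiplicity p n)" unfolding 2 by (simp only: 1)
      also have "\<dots> = n" by (rule dec[symmetric])
      finally show "m = n" .
    qed
  qed auto
  also have "\<dots> \<le> (\<Sum>x\<in>{..K} \<times> S'. (\<lambda>(k, m'). f p ^ k * f m') x)"
    by (rule sum_mono2) (use insert.prems K in \<open>auto simp: g_def S'_def\<close>)
  also have "\<dots> = (\<Sum>k\<le>K. f p ^ k) * (\<Sum>m\<in>S'. f m)"
    by (simp add: sum.cartesian_product[symmetric] sum_product)
  also have "\<dots> \<le> 1 / (1 - f p) * (\<Prod>p\<in>P. 1 / (1 - f p))"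
  proof (rule mult_mono)
    have "(\<Sum>k\<le>K. f p ^ k) = (1 - f p ^ Suc K) / (1 - f p)"
      using sum_gp_basic[of "f p" K] p by (simp add: field_simps)
    also have "\<dots> \<le> 1 / (1 - f p)"
      using p insert.prems(4)[of p] by (intro divide_right_mono) auto
    finally show "(\<Sum>k\<le>K. f p ^ k) \<le> 1 / (1 - f p)" .
    show "(\<Sum>m\<in>S'. f m) \<le> (\<Prod>p\<in>P. 1 / (1 - f p))"
      by (rule insert.IH) (use insert.prems S' in \<open>auto simp: S'_def\<close>)
    show "0 \<le> 1 / (1 - f p)" using p by simp
    show "0 \<le> (\<Sum>m\<in>S'. f m)" by (rule sum_nonneg) (use insert.prems in auto)
  qed
  finally show ?case using insert by simp
qed

section \<open>Euler products over primes, and Rankin's bound for smooth numbers\<close>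

lemma sum_powr_bounded:
  fixes s :: real
  assumes "s > 1"
  obtains C where "C > 0" "\<And>A::nat set. finite A \<Longrightarrow> (\<Sum>k\<in>A. real k powr - s) \<le> C"
proof -
  have s: "summable (\<lambda>k. real k powr - s)" using assms by (simp add: summable_real_powr_iff)
  have "(\<Sum>k\<in>A. real k powr - s) \<le> (\<Sum>k. real k powr - s) + 1" if "finite A" for A
    using sum_le_suminf[OF s that] by simp
  moreover have "(\<Sum>k. real k powr - s) \<ge> 0"
    by (rule suminf_nonneg[OF s]) simp
  then have "(\<Sum>k. real k powr - s) + 1 > 0" by linarith
  ultimately show ?thesis using that by blast
qed

text \<open>The range up to 3/4 leaves room for p = 2 in Rankin's weights, whose value there can
  reach 2^(-1/2).\<close>

lemma inverse_one_minus_le_exp: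
  fixes t :: real
  assumes "0 \<le> t" "t \<le> 3 / 4"
  shows "1 / (1 - t) \<le> exp (t + 4 * t ^ 2)"
proof -
  have "1 / (1 - t) = 1 + (t + t ^ 2 / (1 - t))" using assms by (simp add: field_simps power2_eq_square)
  also have "\<dots> \<le> exp (t + t ^ 2 / (1 - t))" by (rule exp_ge_add_one_self)
  also have "t ^ 2 / (1 - t) \<le> t ^ 2 * 4"
    using mult_left_mono[of "1 / (1 - t)" 4 "t ^ 2"] assms by (simp add: field_simps)
  finally show ?thesis by (simp add: mult.commute)
qed

text \<open>Every m \<le> n has all its prime factors among the primes up to n, so the Euler product
  dominates the harmonic sum.\<close>

lemma ln_le_prod_primes:
  assumes "n \<ge> 1"
  shows "ln (real n) \<le> Euler_prod (primes_le n)"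
proof -
  have "ln (real n) \<le> ln (real n + 1)" using assms by simp
  also have "\<dots> \<le> harm n" by (rule ln_le_harm)
  also have "harm n = (\<Sum>m\<in>{1..n}. 1 / real m)" by (simp add: harm_def inverse_eq_divide)
  also have "\<dots> \<le> Euler_prod (primes_le n)"
    by (rule Euler_product_upper)
       (auto simp: prime_gt_Suc_0_nat divide_less_eq in_prime_factors_iff intro: order.trans[OF dvd_imp_le])
  finally show ?thesis .
qed

lemma Euler_factor_ge_1: "1 \<le> 1 / (1 - 1 / real p)" if "prime p"
  using prime_gt_1_nat[OF that] by (simp add: field_simps)

lemma exp_minus_one_le: "exp u - 1 \<le> 2 * u" if "0 \<le> u" "u \<le> 1" for u :: real
proof -
  have "exp u \<le> 1 + u + u ^ 2" by (rule exp_bound) (use that in auto)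
  also have "u ^ 2 \<le> u" using that by (simp add: power2_eq_square mult_left_le)
  finally show ?thesis by simp
qed

lemma prod_Euler_factors_le_exp:
  obtains C where "C > 0" "\<And>A. finite A \<Longrightarrow> (\<And>p. p \<in> A \<Longrightarrow> prime p) \<Longrightarrow>
    Euler_prod A \<le> C * exp (\<Sum>p\<in>A. 1 / real p)"
proof -
  obtain C where C: "C > 0" "\<And>A::nat set. finite A \<Longrightarrow> (\<Sum>k\<in>A. real k powr - 2) \<le> C"
    using sum_powr_bounded[of 2] by auto
  have "Euler_prod A \<le> exp (4 * C) * exp (\<Sum>p\<in>A. 1 / real p)"
    if A: "finite A" "\<And>p. p \<in> A \<Longrightarrow> prime p" for A :: "nat set"
  proof -
    have "Euler_prod A \<le> (\<Prod>p\<in>A. exp (1 / real p + 4 * (1 / real p) ^ 2))"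
    proof (rule prod_mono, intro conjI)
      fix p assume "p \<in> A"
      then have "real p \<ge> 2" using A(2) prime_ge_2_nat by fastforce
      then have "1 / real p \<le> 1 / 2" by (simp add: field_simps)
      then show "1 / (1 - 1 / real p) \<le> exp (1 / real p + 4 * (1 / real p) ^ 2)"
        "0 \<le> 1 / (1 - 1 / real p)"
        by (auto intro!: inverse_one_minus_le_exp)
    qed
    also have "\<dots> = exp ((\<Sum>p\<in>A. 1 / real p) + 4 * (\<Sum>p\<in>A. real p powr - 2))"
    proof -
      have "real p powr - 2 = (1 / real p) ^ 2" for p
        by (simp add: powr_minus inverse_eq_divide power_one_over)
      then show ?thesis using A(1) by (simp add: exp_sum[symmetric] sum.distrib sum_distrib_left)
    qed
    also have "\<dots> \<le> exp ((\<Sum>p\<in>A. 1 / real p) + 4 * C)"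
      using C(2)[OF A(1)] by simp
    finally show ?thesis by (simp add: exp_add mult.commute)
  qed
  then show ?thesis using that[of "exp (4 * C)"] by auto
qed

text \<open>Read off from the Euler product instead of partial summation: the product is at least ln
  n and at most a constant times the exponential of the sum of 1/p.\<close>

lemma Mertens_second_lower:
  obtains C where "\<And>n. n \<ge> 2 \<Longrightarrow> ln (ln (real n)) - C \<le> (\<Sum>p\<in>primes_le n. 1 / real p)"
proof -
  obtain C where C: "C > 0" "\<And>A. finite A \<Longrightarrow> (\<And>p. p \<in> A \<Longrightarrow> prime p) \<Longrightarrow>
    Euler_prod A \<le> C * exp (\<Sum>p\<in>A. 1 / real p)"
    using prod_Euler_factors_le_exp by blast
  have "ln (ln (real n)) - ln C \<le> (\<Sum>p\<in>primes_le n. 1 / real p)" if "n \<ge> 2" for n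
  proof -
    have "Euler_prod (primes_le n) \<le> C * exp (\<Sum>p\<in>primes_le n. 1 / real p)"
      by (rule C(2)) auto
    then have "ln (real n) \<le> C * exp (\<Sum>p\<in>primes_le n. 1 / real p)"
      using ln_le_prod_primes[of n] that by linarith
    moreover have "0 < ln (real n)" using that by simp
    ultimately have "ln (ln (real n)) \<le> ln (C * exp (\<Sum>p\<in>primes_le n. 1 / real p))"
      by (intro ln_mono) auto
    then show ?thesis using C(1) by (simp add: ln_mult)
  qed
  then show ?thesis using that by blast
qed

lemma Mertens_third_upper:
  obtains C where "C > 0" "\<And>n. n \<ge> 2 \<Longrightarrow> Euler_prod (primes_le n) \<le> C * ln (real n)"
proof -
  obtain C where C: "C > 0" "\<And>A. finite A \<Longrightarrow> (\<And>p. p \<in> A \<Longrightarrow> prime p) \<Longrightarrow>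
    Euler_prod A \<le> C * exp (\<Sum>p\<in>A. 1 / real p)"
    using prod_Euler_factors_le_exp by blast
  have main: "Euler_prod (primes_le n) \<le> C * exp (3 - ln (ln 2)) * ln (real n)" if "n \<ge> 2" for n
  proof -
    have "Euler_prod (primes_le n) \<le> C * exp (\<Sum>p\<in>primes_le n. 1 / real p)"
      by (rule C(2)) auto
    also have "\<dots> \<le> C * exp (ln (ln (real n)) + (3 - ln (ln 2)))"
      using Mertens_second_upper[OF that] C(1) by (intro mult_left_mono) auto
    also have "\<dots> = C * exp (3 - ln (ln 2)) * ln (real n)"
      using that by (subst exp_add) (simp add: mult.commute)
    finally show ?thesis .
  qed
  have "C * exp (3 - ln (ln 2)) > 0" using C(1) by simp
  then show ?thesis by (rule that[OF _ main])
qed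

lemma sum_primes_between:
  obtains C where "C > 0" "\<And>m n. 2 \<le> m \<Longrightarrow> m \<le> n \<Longrightarrow>
    (\<Sum>p | prime p \<and> m < p \<and> p \<le> n. 1 / real p) \<le> ln (ln (real n) / ln (real m)) + C"
proof -
  obtain C where C: "\<And>n. n \<ge> 2 \<Longrightarrow> ln (ln (real n)) - C \<le> (\<Sum>p\<in>primes_le n. 1 / real p)"
    using Mertens_second_lower by blast
  have "(\<Sum>p | prime p \<and> m < p \<and> p \<le> n. 1 / real p) \<le> ln (ln (real n) / ln (real m)) + (\<bar>C\<bar> + \<bar>3 - ln (ln 2)\<bar> + 1)"
    if "2 \<le> m" "m \<le> n" for m n :: nat
  proof -
    have eq: "primes_le n = primes_le m \<union> {p. prime p \<and> m < p \<and> p \<le> n}" using that by auto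
    have "(\<Sum>p\<in>primes_le n. 1 / real p) = (\<Sum>p\<in>primes_le m. 1 / real p) + (\<Sum>p | prime p \<and> m < p \<and> p \<le> n. 1 / real p)"
      unfolding eq by (rule sum.union_disjoint) (auto intro: finite_subset[of _ "{..n}"])
    moreover have "ln (ln (real n) / ln (real m)) = ln (ln (real n)) - ln (ln (real m))"
      using that by (intro ln_divide_pos) auto
    ultimately show ?thesis using C[OF that(1)] Mertens_second_upper[of n] that by linarith
  qed
  then show ?thesis using that[of "\<bar>C\<bar> + \<bar>3 - ln (ln 2)\<bar> + 1"] by auto
qed

text \<open>Since p^(1 / ln y) \<le> e for p \<le> y, the shift of the exponent changes 1/p only by
  O(ln p / (p ln y)), and Mertens' first bound makes the total change O(1). So the sum is of the
  same order ln y as the unshifted one. From y \<ge> 8 > e^2 follows ln y \<ge> 2, which keeps the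
  exponent at most -1/2 and all Euler factors bounded.\<close>

lemma smooth_sum_Rankin:
  obtains C where "C > 0" "\<And>y S. y \<ge> (8::nat) \<Longrightarrow> finite S \<Longrightarrow> (\<And>m. m \<in> S \<Longrightarrow> m > 0 \<and> prime_factors m \<subseteq> primes_le y) \<Longrightarrow>
    (\<Sum>m\<in>S. real m powr (- 1 + 1 / ln (real y))) \<le> C * ln (real y)"
proof -
  obtain C where C: "C > 0" "\<And>A::nat set. finite A \<Longrightarrow> (\<Sum>k\<in>A. real k powr - 2) \<le> C"
    using sum_powr_bounded[of 2] by auto
  define C' where "C' = (3 - ln (ln 2)) + 2 * (1 + ln 4) + 36 * C"
  have "(\<Sum>m\<in>S. real m powr (- 1 + 1 / ln (real y))) \<le> exp C' * ln (real y)"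
    if y: "y \<ge> (8::nat)" and S: "finite S" "\<And>m. m \<in> S \<Longrightarrow> m > 0 \<and> prime_factors m \<subseteq> primes_le y" for y S
  proof -
    define L where "L = ln (real y)"
    have "exp (1::real) * exp 1 \<le> (272 / 100) * (272 / 100)" using e_less_272 by (intro mult_mono) auto
    then have "exp (2::real) \<le> 8" by (simp add: exp_add[symmetric])
    then have L2: "L \<ge> 2" unfolding L_def using y by (subst ln_ge_iff) auto
    define t where "t = (\<lambda>p::nat. real p powr (- 1 + 1 / L))"
    have t: "0 \<le> t p" "t p \<le> 3 / 4" "t p \<le> 1 / real p + 2 / L * (ln (real p) / real p)" "t p ^ 2 \<le> 9 * real p powr - 2"
      if p: "p \<in> primes_le y" for p
    proof -
      have p2: "2 \<le> p" "p \<le> y" using p by (auto dest: prime_ge_2_nat)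
      show "0 \<le> t p" by (simp add: t_def)
      have "t p \<le> real p powr (- (1 / 2))" unfolding t_def
        by (rule powr_mono) (use L2 p2 in \<open>auto simp: field_simps\<close>)
      also have "\<dots> \<le> 2 powr (- (1 / 2))" by (rule powr_mono2') (use p2 in auto)
      also have "\<dots> \<le> 3 / 4"
      proof -
        have "4 / 3 \<le> sqrt 2" by (rule real_le_rsqrt) (simp add: power2_eq_square)
        then show ?thesis by (simp add: powr_minus powr_half_sqrt field_simps)
      qed
      finally show "t p \<le> 3 / 4" .
      define u where "u = ln (real p) / L"
      have u: "0 \<le> u" "u \<le> 1" using p2 L2 by (auto simp: u_def L_def)
      have tp: "t p = exp u / real p"
        unfolding t_def powr_add powr_minus using p2 by (simp add: powr_def u_def field_simps)
      have "exp u \<le> 1 + 2 * u" using exp_minus_one_le[OF u] by simp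
      then have "exp u / real p \<le> (1 + 2 * u) / real p" by (rule divide_right_mono) simp
      then show "t p \<le> 1 / real p + 2 / L * (ln (real p) / real p)"
        unfolding tp by (simp add: u_def add_divide_distrib)
      have "exp u \<le> 3" using u \<open>exp u \<le> 1 + 2 * u\<close> by simp
      then have "exp u ^ 2 \<le> 3 ^ 2" by (intro power_mono) auto
      then show "t p ^ 2 \<le> 9 * real p powr - 2"
        unfolding tp using p2 by (simp add: power_divide powr_minus powr_numeral divide_simps)
    qed
    have "(\<Sum>m\<in>S. t m) \<le> (\<Prod>p\<in>primes_le y. 1 / (1 - t p))"
    proof (rule Euler_product_upper)
      show "t p < 1" if "p \<in> primes_le y" for p using t(2)[OF that] by simp
    qed (use S in \<open>auto simp: t_def powr_mult\<close>)
    also have "\<dots> \<le> (\<Prod>p\<in>primes_le y. exp (t p + 4 * t p ^ 2))"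
    proof (rule prod_mono, intro conjI)
      fix p assume "p \<in> primes_le y"
      note t = t[OF this]
      show "1 / (1 - t p) \<le> exp (t p + 4 * t p ^ 2)" by (rule inverse_one_minus_le_exp[OF t(1,2)])
      show "0 \<le> 1 / (1 - t p)" using t by simp
    qed
    also have "\<dots> = exp (\<Sum>p\<in>primes_le y. t p + 4 * t p ^ 2)" by (simp add: exp_sum)
    also have "(\<Sum>p\<in>primes_le y. t p + 4 * t p ^ 2) \<le>
       (\<Sum>p\<in>primes_le y. (1 / real p + 2 / L * (ln (real p) / real p)) + 36 * real p powr - 2)"
    proof (rule sum_mono)
      fix p assume "p \<in> primes_le y"
      from t(3,4)[OF this] show "t p + 4 * t p ^ 2 \<le> (1 / real p + 2 / L * (ln (real p) / real p)) + 36 * real p powr - 2"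
        by linarith
    qed
    also have "\<dots> = (\<Sum>p\<in>primes_le y. 1 / real p) + 2 / L * (\<Sum>p\<in>primes_le y. ln (real p) / real p)
        + 36 * (\<Sum>p\<in>primes_le y. real p powr - 2)"
      by (simp add: sum.distrib sum_distrib_left)
    also have "\<dots> \<le> (ln L + (3 - ln (ln 2))) + 2 * (1 + ln 4) + 36 * C"
    proof (intro add_mono)
      show "(\<Sum>p\<in>primes_le y. 1 / real p) \<le> ln L + (3 - ln (ln 2))"
        using Mertens_second_upper[of y] y by (simp add: L_def)
      have "2 / L * (\<Sum>p\<in>primes_le y. ln (real p) / real p) \<le> 2 / L * (L + ln 4)"
        by (rule mult_left_mono) (use Mertens_first_upper[of y] y L2 in \<open>auto simp: L_def\<close>)
      also have "\<dots> = 2 * (1 + ln 4 / L)" using L2 by (simp add: field_simps)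
      also have "ln 4 / L \<le> ln 4" using L2 by (simp add: divide_le_eq mult_le_cancel_left1)
      finally show "2 / L * (\<Sum>p\<in>primes_le y. ln (real p) / real p) \<le> 2 * (1 + ln 4)" by simp
      show "36 * (\<Sum>p\<in>primes_le y. real p powr - 2) \<le> 36 * C" using C(2)[of "primes_le y"] by simp
    qed
    finally have "(\<Sum>m\<in>S. t m) \<le> exp (C' + ln L)" by (simp add: C'_def algebra_simps)
    also have "\<dots> = exp C' * L" using L2 by (simp add: exp_add)
    finally show ?thesis by (simp add: t_def L_def)
  qed
  then show ?thesis using that[of "exp C'"] by auto
qed

section \<open>An upper bound sieve\<close>

text \<open>The Chinese remainder theorem: the residue pair is injective by coprimality and
  therefore surjective by counting.\<close>

lemma sum_periodic_prod:
  fixes a F :: "nat \<Rightarrow> real"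
  assumes "coprime p M" "p > 0" "M > 0"
    and a: "\<And>n. a (n mod p) = a n" and F: "\<And>n. F (n mod M) = F n"
  shows "(\<Sum>n<p * M. a n * F n) = (\<Sum>r<p. a r) * (\<Sum>s<M. F s)"
proof -
  define g where "g = (\<lambda>n. (n mod p, n mod M))"
  have inj: "inj_on g {..<p * M}"
  proof (rule inj_onI)
    fix x y assume xy: "x \<in> {..<p * M}" "y \<in> {..<p * M}" "g x = g y"
    then have "[x = y] (mod p)" "[x = y] (mod M)" by (auto simp: g_def cong_def)
    then have "[x = y] (mod p * M)" using assms(1) by (rule coprime_cong_mult_nat)
    then show "x = y" using xy by (simp add: cong_def)
  qed
  have "g ` {..<p * M} = {..<p} \<times> {..<M}"
  proof (rule card_subset_eq)
    show "g ` {..<p * M} \<subseteq> {..<p} \<times> {..<M}" using assms by (auto simp: g_def)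
    show "card (g ` {..<p * M}) = card ({..<p} \<times> {..<M})"
      using inj by (simp add: card_image card_cartesian_product)
  qed simp
  then have "(\<Sum>x\<in>{..<p} \<times> {..<M}. a (fst x) * F (snd x)) = (\<Sum>n<p * M. a (fst (g n)) * F (snd (g n)))"
    using inj by (metis (no_types, lifting) sum.reindex_cong)
  also have "\<dots> = (\<Sum>n<p * M. a n * F n)" by (simp add: g_def a F)
  finally show ?thesis
    by (simp add: sum_product sum.cartesian_product case_prod_beta)
qed

lemma sum_prod_periodic:
  fixes a :: "nat \<Rightarrow> nat \<Rightarrow> real"
  assumes "finite U" "\<And>p. p \<in> U \<Longrightarrow> prime p" "\<And>p n. p \<in> U \<Longrightarrow> a p (n mod p) = a p n"
  shows "(\<Sum>n<\<Prod>U. \<Prod>p\<in>U. a p n) = (\<Prod>p\<in>U. \<Sum>r<p. a p r)"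
  using assms
proof (induction U rule: finite_induct)
  case (insert p U)
  have "(\<Sum>n<p * \<Prod>U. a p n * (\<Prod>q\<in>U. a q n)) = (\<Sum>r<p. a p r) * (\<Sum>n<\<Prod>U. \<Prod>q\<in>U. a q n)"
  proof (rule sum_periodic_prod)
    show "coprime p (\<Prod>U)"
      by (rule prod_coprime_right) (use insert in \<open>auto intro!: primes_coprime\<close>)
    show "p > 0" using insert by (auto dest: prime_gt_0_nat)
    show "\<Prod>U > 0" by (rule prod_pos) (use insert in \<open>auto dest: prime_gt_0_nat\<close>)
    show "a p (n mod p) = a p n" for n using insert by auto
    show "(\<Prod>q\<in>U. a q (n mod \<Prod>U)) = (\<Prod>q\<in>U. a q n)" for n
    proof (rule prod.cong)
      fix q assume q: "q \<in> U"
      then have "q dvd \<Prod>U" using insert by (intro dvd_prodI) auto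
      then have "(n mod \<Prod>U) mod q = n mod q" by (rule mod_mod_cancel)
      then show "a q (n mod \<Prod>U) = a q n" using insert.prems(2) q by (metis insertCI)
    qed simp
  qed
  also have "(\<Sum>n<\<Prod>U. \<Prod>q\<in>U. a q n) = (\<Prod>q\<in>U. \<Sum>r<q. a q r)" using insert by auto
  finally show ?case using insert by simp
qed auto

lemma sum_periodic_shift:
  fixes f :: "nat \<Rightarrow> real"
  assumes "\<And>n. f (n mod M) = f n" "M > 0"
  shows "(\<Sum>n\<in>{a..<a + M}. f n) = (\<Sum>n<M. f n)"
proof (induction a)
  case 0
  then show ?case by (simp add: atLeast0LessThan)
next
  case (Suc a)
  have "(\<Sum>n\<in>{Suc a..<Suc a + M}. f n) + f a = (\<Sum>n\<in>{a..<Suc a + M}. f n)"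
    by (subst (2) sum.atLeast_Suc_lessThan) auto
  also have "\<dots> = (\<Sum>n\<in>{a..<a + M}. f n) + f (a + M)" by simp
  also have "f (a + M) = f a" using assms(1)[of "a + M"] assms(1)[of a] by simp
  finally show ?case using Suc by simp
qed

text \<open>Whole periods contribute the mean value, and the incomplete one has fewer than M terms,
  each at most 1. Nonnegativity of the sum over a period allows T div M to be replaced by T /
  M.\<close>

lemma sum_periodic_interval_le:
  fixes f :: "nat \<Rightarrow> real"
  assumes per: "\<And>n. f (n mod M) = f n" and M: "M > 0" and f1: "\<And>n. \<bar>f n\<bar> \<le> 1"
    and s: "(\<Sum>n<M. f n) \<ge> 0"
  shows "(\<Sum>n\<in>{a..<a + T}. f n) \<le> real T * ((\<Sum>n<M. f n) / real M) + real M"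
proof -
  define s where "s = (\<Sum>n<M. f n)"
  have blocks: "(\<Sum>n\<in>{a..<a + k * M}. f n) = real k * s" for k
  proof (induction k)
    case (Suc k)
    have "(\<Sum>n\<in>{a..<a + Suc k * M}. f n) = (\<Sum>n\<in>{a..<a + k * M}. f n) + (\<Sum>n\<in>{a + k * M..<a + k * M + M}. f n)"
      by (subst sum.atLeastLessThan_concat) (auto simp: algebra_simps)
    then show ?case using Suc sum_periodic_shift[where f = f and M = M, OF per M, of "a + k * M"] by (simp add: s_def algebra_simps)
  qed simp
  define k where "k = T div M"
  have T: "T = k * M + T mod M" by (simp add: k_def)
  have "(\<Sum>n\<in>{a..<a + T}. f n) = (\<Sum>n\<in>{a..<a + k * M}. f n) + (\<Sum>n\<in>{a + k * M..<a + T}. f n)"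
    by (subst sum.atLeastLessThan_concat) (use T in auto)
  also have "(\<Sum>n\<in>{a + k * M..<a + T}. f n) \<le> (\<Sum>n\<in>{a + k * M..<a + T}. 1)"
    by (rule sum_mono) (use f1 in \<open>auto simp: abs_le_iff\<close>)
  also have "\<dots> = real (T mod M)"
  proof -
    have "(a + T) - (a + k * M) = T mod M" using T by simp
    then show ?thesis by simp
  qed
  also have "\<dots> \<le> real M" using M by (simp add: less_imp_le)
  also have "(\<Sum>n\<in>{a..<a + k * M}. f n) = real k * s" by (rule blocks)
  also have "real k * s \<le> real T / real M * s"
  proof (rule mult_right_mono)
    have "real k * real M \<le> real T" using T by (metis le_add1 of_nat_mono of_nat_mult)
    then show "real k \<le> real T / real M" using M by (simp add: field_simps)
  qed (use s in \<open>simp add: s_def\<close>)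
  finally show ?thesis by (simp add: s_def)
qed

text \<open>The functions \<open>\<Phi> A\<close> below are orthogonal with respect to uniform measure on residues,
  and a suitable combination of them is constant on the sifted set: this is the
  diagonalised form of Selberg's upper bound sieve.\<close>
theorem Selberg_sieve:
  fixes B :: "nat \<Rightarrow> nat \<Rightarrow> bool" and P :: "nat set" and k z a T :: nat
  defines "G \<equiv> (\<Sum>A | A \<subseteq> P \<and> \<Prod>A \<le> z. \<Prod>p\<in>A. real k / (real p - real k))"
  assumes fin: "finite P" and pr: "\<And>p. p \<in> P \<Longrightarrow> prime p" and z: "z \<ge> 1" and k: "k \<ge> 1"
    and B: "\<And>p n. p \<in> P \<Longrightarrow> B p (n mod p) = B p n"
    and cardB: "\<And>p. p \<in> P \<Longrightarrow> card {r. r < p \<and> B p r} = k"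
    and kp: "\<And>p. p \<in> P \<Longrightarrow> 2 * k \<le> p"
  shows "G \<ge> 1" "real (card {n \<in> {a..<a + T}. \<forall>p\<in>P. \<not> B p n}) \<le> real T / G + real z ^ 4"
proof -
  define D where "D = {A. A \<subseteq> P \<and> \<Prod>A \<le> z}"
  define h where "h = (\<lambda>p. real k / (real p - real k))"
  have finD: "finite D" unfolding D_def using fin by simp
  \<comment> \<open>Here 2k \<le> p gives \<open>h p\<close> \<le> 1, which later keeps all
    functions bounded by 1, as the estimate for incomplete periods demands.\<close>
  have h: "0 < h p" "h p \<le> 1" if "p \<in> P" for p
    using kp[OF that] k by (auto simp: h_def divide_le_eq)
  have G: "G = (\<Sum>A\<in>D. \<Prod>p\<in>A. h p)" by (simp add: G_def D_def h_def)
  have hA: "(\<Prod>p\<in>A. h p) > 0" if "A \<in> D" for A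
    by (rule prod_pos) (use that h in \<open>auto simp: D_def\<close>)
  have "(\<Sum>A\<in>{{}}. \<Prod>p\<in>A. h p) \<le> G"
    unfolding G by (rule sum_mono2) (use finD z hA in \<open>auto simp: D_def less_imp_le\<close>)
  then show G1: "G \<ge> 1" by simp
  \<comment> \<open>\<open>h p\<close> is the value that gives \<phi> mean zero: k residues carry 1
    and p - k carry -h. Its mean square is then again \<open>h p\<close>. The sign in
    \<open>\<Phi>\<close> makes every \<open>\<Phi> A\<close> equal to the positive product of the
    \<open>h p\<close> on the sifted set, so \<open>F\<close> is constantly \<open>G\<close>
    there.\<close>
  define \<phi> where "\<phi> = (\<lambda>p n. if B p n then 1 else - h p)"
  define \<Phi> where "\<Phi> = (\<lambda>A n. (-1) ^ card A * (\<Prod>p\<in>A. \<phi> p n))"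
  define F where "F = (\<lambda>n. \<Sum>A\<in>D. \<Phi> A n)"
  have \<phi>_per: "\<phi> p (n mod p) = \<phi> p n" if "p \<in> P" for p n using B[OF that] by (simp add: \<phi>_def)
  have \<phi>_le: "\<bar>\<phi> p n\<bar> \<le> 1" if "p \<in> P" for p n using h[OF that] by (simp add: \<phi>_def)
  have \<phi>_sum: "(\<Sum>r<p. \<phi> p r) = 0" "(\<Sum>r<p. \<phi> p r ^ 2) = real p * h p" if p: "p \<in> P" for p
  proof -
    have 1: "{..<p} = {r. r < p \<and> B p r} \<union> {r. r < p \<and> \<not> B p r}" by auto
    have "card {..<p} = card {r. r < p \<and> B p r} + card {r. r < p \<and> \<not> B p r}"
      by (subst 1, rule card_Un_disjoint) auto
    then have 2: "real (card {r. r < p \<and> \<not> B p r}) = real p - real k"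
      using cardB[OF p] by simp
    have pk: "real p - real k > 0" using kp[OF p] k by simp
    have sp: "(\<Sum>r<p. g r) = (\<Sum>r | r < p \<and> B p r. g r) + (\<Sum>r | r < p \<and> \<not> B p r. g r)"
      for g :: "nat \<Rightarrow> real"
      by (subst 1, rule sum.union_disjoint) auto
    show "(\<Sum>r<p. \<phi> p r) = 0"
      using pk by (subst sp) (simp add: \<phi>_def cardB[OF p] 2 h_def)
    show "(\<Sum>r<p. \<phi> p r ^ 2) = real p * h p"
    proof -
      have hk: "(real p - real k) * h p = real k" using pk by (simp add: h_def)
      have "(\<Sum>r<p. \<phi> p r ^ 2) = real k + (real p - real k) * h p * h p"
        by (subst sp) (simp add: \<phi>_def cardB[OF p] 2 power2_eq_square)
      also have "\<dots> = (real p - real k) * h p + real k * h p" by (simp only: hk)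
      also have "\<dots> = real p * h p" by (simp add: algebra_simps)
      finally show ?thesis .
    qed
  qed
  have prod_pos': "\<Prod>A > 0" if "A \<subseteq> P" for A
    by (rule prod_pos) (use that pr in \<open>auto dest: prime_gt_0_nat\<close>)
  \<comment> \<open>Orthogonality: if A and A' differ, some prime lies in exactly one of them and
    its factor has mean zero. The incomplete period costs at most the product over the union, which
    is at most the product over A times that over A'.\<close>
  have corr: "(\<Sum>n\<in>{a..<a + T}. \<Phi> A n * \<Phi> A' n) \<le> real T * (if A = A' then \<Prod>p\<in>A. h p else 0) + real (\<Prod>A) * real (\<Prod>A')"
    if A: "A \<in> D" "A' \<in> D" for A A'
  proof -
    define U where "U = A \<union> A'"
    have UP: "U \<subseteq> P" "finite U" "finite A" "finite A'" "A \<subseteq> P" "A' \<subseteq> P"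
      using A fin finite_subset unfolding U_def D_def by blast+
    define \<epsilon> :: real where "\<epsilon> = (-1) ^ card A * (-1) ^ card A'"
    define c where "c = (\<lambda>p n. (if p \<in> A then \<phi> p n else 1) * (if p \<in> A' then \<phi> p n else 1))"
    have "(\<Prod>p\<in>A. \<phi> p n) = (\<Prod>p\<in>U. if p \<in> A then \<phi> p n else 1)" for n
      using UP by (simp add: prod.If_cases U_def Int_absorb1)
    moreover have "(\<Prod>p\<in>A'. \<phi> p n) = (\<Prod>p\<in>U. if p \<in> A' then \<phi> p n else 1)" for n
      using UP by (simp add: prod.If_cases U_def Int_absorb1)
    ultimately have f_eq: "\<Phi> A n * \<Phi> A' n = \<epsilon> * (\<Prod>p\<in>U. c p n)" for n
      by (simp add: \<Phi>_def \<epsilon>_def c_def prod.distrib)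
    have c_per: "c p (n mod p) = c p n" if "p \<in> U" for p n
      using \<phi>_per that UP by (auto simp: c_def)
    have s: "(\<Sum>n<\<Prod>U. \<epsilon> * (\<Prod>p\<in>U. c p n)) = (if A = A' then real (\<Prod>U) * (\<Prod>p\<in>A. h p) else 0)"
    proof -
      have "(\<Sum>n<\<Prod>U. \<epsilon> * (\<Prod>p\<in>U. c p n)) = \<epsilon> * (\<Prod>p\<in>U. \<Sum>r<p. c p r)"
        unfolding sum_distrib_left[symmetric]
        by (subst sum_prod_periodic) (use UP pr c_per in auto)
      also have "\<dots> = (if A = A' then real (\<Prod>U) * (\<Prod>p\<in>A. h p) else 0)"
      proof (cases "A = A'")
        case True
        have "(\<Prod>p\<in>U. \<Sum>r<p. c p r) = (\<Prod>p\<in>A. real p * h p)"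
          by (rule prod.cong) (use UP True \<phi>_sum(2) in \<open>auto simp: U_def c_def power2_eq_square\<close>)
        moreover have "\<epsilon> = 1" using True by (simp add: \<epsilon>_def)
        ultimately show ?thesis using True by (simp add: prod.distrib U_def)
      next
        case False
        then obtain q where q: "q \<in> U" "(q \<in> A) \<noteq> (q \<in> A')" by (auto simp: U_def)
        then have "(\<Sum>r<q. c q r) = 0" using \<phi>_sum(1)[of q] UP by (auto simp: c_def)
        then have "(\<Prod>p\<in>U. \<Sum>r<p. c p r) = 0" using q UP(2) by (meson prod_zero)
        then show ?thesis using False by simp
      qed
      finally show ?thesis .
    qed
    have hpos: "(\<Prod>p\<in>A. h p) > 0" using hA A by auto
    have "(\<Sum>n\<in>{a..<a + T}. \<Phi> A n * \<Phi> A' n) = (\<Sum>n\<in>{a..<a + T}. \<epsilon> * (\<Prod>p\<in>U. c p n))"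
      by (simp add: f_eq)
    also have "\<dots> \<le> real T * ((\<Sum>n<\<Prod>U. \<epsilon> * (\<Prod>p\<in>U. c p n)) / real (\<Prod>U)) + real (\<Prod>U)"
    proof (rule sum_periodic_interval_le)
      show "\<epsilon> * (\<Prod>p\<in>U. c p (n mod \<Prod>U)) = \<epsilon> * (\<Prod>p\<in>U. c p n)" for n
      proof -
        have "c p (n mod \<Prod>U) = c p n" if "p \<in> U" for p
        proof -
          have "p dvd \<Prod>U" using that UP by (intro dvd_prodI) auto
          then have "(n mod \<Prod>U) mod p = n mod p" by (rule mod_mod_cancel)
          then show ?thesis using c_per[OF that, of "n mod \<Prod>U"] c_per[OF that, of n] by simp
        qed
        then show ?thesis by simp
      qed
      show "\<Prod>U > 0" using prod_pos' UP by blast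
      show "\<bar>\<epsilon> * (\<Prod>p\<in>U. c p n)\<bar> \<le> 1" for n
      proof -
        have "(\<Prod>p\<in>U. \<bar>c p n\<bar>) \<le> 1"
        proof (rule prod_le_1)
          fix p assume "p \<in> U"
          then have "\<bar>\<phi> p n\<bar> \<le> 1" using UP by (intro \<phi>_le) auto
          then have "\<bar>c p n\<bar> \<le> 1" unfolding c_def abs_mult by (intro mult_le_one) auto
          then show "0 \<le> \<bar>c p n\<bar> \<and> \<bar>c p n\<bar> \<le> 1" by simp
        qed
        then show ?thesis by (simp add: abs_mult \<epsilon>_def power_abs abs_prod)
      qed
      show "0 \<le> (\<Sum>n<\<Prod>U. \<epsilon> * (\<Prod>p\<in>U. c p n))" unfolding s using hpos
        by (cases "A = A'") (simp_all del: of_nat_prod add: less_imp_le)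
    qed
    also have "(\<Sum>n<\<Prod>U. \<epsilon> * (\<Prod>p\<in>U. c p n)) / real (\<Prod>U) = (if A = A' then \<Prod>p\<in>A. h p else 0)"
      unfolding s using prod_pos'[OF UP(1)] by (simp del: of_nat_prod)
    also have "real (\<Prod>U) \<le> real (\<Prod>A) * real (\<Prod>A')"
    proof -
      have "\<Prod>U * \<Prod>(A \<inter> A') = \<Prod>A * \<Prod>A'"
        unfolding U_def using UP by (intro prod.union_inter) auto
      moreover have "\<Prod>(A \<inter> A') > 0" by (rule prod_pos') (use UP in blast)
      moreover from this have "1 \<le> \<Prod>(A \<inter> A')" by linarith
      ultimately have "\<Prod>U * 1 \<le> \<Prod>A * \<Prod>A'" by (metis mult_le_mono2)
      then show ?thesis unfolding of_nat_mult[symmetric] mult_1_right by (rule of_nat_mono)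
    qed
    finally show ?thesis by simp
  qed
  define S where "S = {n \<in> {a..<a + T}. \<forall>p\<in>P. \<not> B p n}"
  have FS: "F n = G" if "n \<in> S" for n
  proof -
    have "\<Phi> A n = (\<Prod>p\<in>A. h p)" if A: "A \<in> D" for A
    proof -
      have "(\<Prod>p\<in>A. \<phi> p n) = (\<Prod>p\<in>A. (-1) * h p)"
        by (rule prod.cong) (use \<open>n \<in> S\<close> A in \<open>auto simp: S_def \<phi>_def D_def\<close>)
      then show ?thesis by (simp add: \<Phi>_def prod_uminus)
    qed
    then show ?thesis by (simp add: F_def G)
  qed
  \<comment> \<open>The sifted set is detected by the second moment of \<open>F\<close>: it
    contributes G^2 per element, while the diagonal terms add up to only T * G.\<close>
  have "real (card S) * G ^ 2 = (\<Sum>n\<in>S. F n ^ 2)" using FS by simp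
  also have "\<dots> \<le> (\<Sum>n\<in>{a..<a + T}. F n ^ 2)"
    by (rule sum_mono2) (auto simp: S_def)
  also have "\<dots> = (\<Sum>n\<in>{a..<a + T}. \<Sum>A\<in>D. \<Sum>A'\<in>D. \<Phi> A n * \<Phi> A' n)"
    by (simp add: F_def power2_eq_square sum_product)
  also have "\<dots> = (\<Sum>A\<in>D. \<Sum>A'\<in>D. \<Sum>n\<in>{a..<a + T}. \<Phi> A n * \<Phi> A' n)"
    by (subst sum.swap, rule sum.cong, simp, subst sum.swap, simp)
  also have "\<dots> \<le> (\<Sum>A\<in>D. \<Sum>A'\<in>D. real T * (if A = A' then \<Prod>p\<in>A. h p else 0) + real (\<Prod>A) * real (\<Prod>A'))"
    by (intro sum_mono corr)
  also have "\<dots> = real T * G + (\<Sum>A\<in>D. real (\<Prod>A)) ^ 2"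
    using finD by (simp add: sum.distrib sum_distrib_left[symmetric] G power2_eq_square sum_product del: of_nat_prod)
  also have "(\<Sum>A\<in>D. real (\<Prod>A)) ^ 2 \<le> (real z ^ 2) ^ 2"
  proof (rule power_mono)
    have "(\<Sum>A\<in>D. real (\<Prod>A)) \<le> (\<Sum>A\<in>D. real z)"
      by (rule sum_mono) (auto simp: D_def simp del: of_nat_prod)
    also have "\<dots> = real (card D) * real z" by simp
    \<comment> \<open>Sets of primes are determined by their products, by unique factorisation, so
      \<open>D\<close> has at most z members, each of product at most z. Squaring z * z gives the
      error z^4.\<close>
    also have "card D \<le> card {1..z}"
    proof (rule card_inj_on_le[of Prod])
      show "inj_on Prod D"
      proof (rule inj_onI)
        fix A A' assume A: "A \<in> D" "A' \<in> D" "\<Prod>A = \<Prod>A'"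
        have pf: "A = prime_factors (\<Prod>A)" if "A \<in> D" for A
        proof -
          have "finite A" "0 \<notin> A" using that fin pr[of 0] finite_subset by (auto simp: D_def)
          then have "prime_factors (\<Prod>A) = (\<Union>p\<in>A. prime_factors p)"
            using prime_factors_prod[of A "\<lambda>p. p"] by auto
          also have "\<dots> = (\<Union>p\<in>A. {p})"
            by (rule SUP_cong) (use that pr in \<open>auto simp: D_def prime_factorization_prime\<close>)
          finally show ?thesis by simp
        qed
        have "A = prime_factors (\<Prod>A)" by (rule pf[OF A(1)])
        also have "\<dots> = prime_factors (\<Prod>A')" by (simp only: A(3))
        also have "\<dots> = A'" by (rule pf[OF A(2), symmetric])
        finally show "A = A'" .
      qed
      show "Prod ` D \<subseteq> {1..z}"
        using prod_pos' by (auto simp: D_def Suc_le_eq)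
    qed simp
    finally show "(\<Sum>A\<in>D. real (\<Prod>A)) \<le> real z ^ 2"
      by (simp add: power2_eq_square mult_right_mono)
  qed (intro sum_nonneg, simp del: of_nat_prod)
  finally have "real (card S) * G ^ 2 \<le> real T * G + real z ^ 4" by simp
  then have "real (card S) \<le> (real T * G + real z ^ 4) / G ^ 2"
    using G1 by (simp add: field_simps)
  also have "\<dots> = real T / G + real z ^ 4 / G ^ 2"
    using G1 by (simp add: add_divide_distrib power2_eq_square)
  also have "real z ^ 4 / G ^ 2 \<le> real z ^ 4"
    using G1 by (simp add: divide_le_eq mult_le_cancel_left1 one_le_power)
  finally show "real (card {n \<in> {a..<a + T}. \<forall>p\<in>P. \<not> B p n}) \<le> real T / G + real z ^ 4"
    by (simp add: S_def)
qed

section \<open>Size of the main term of the sieve\<close>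

lemma sum_subsets_prod:
  fixes h :: "'a \<Rightarrow> real"
  assumes "finite P"
  shows "(\<Sum>A | A \<subseteq> P. \<Prod>p\<in>A. h p) = (\<Prod>p\<in>P. 1 + h p)"
  using prod_add[of P h "\<lambda>_. 1"] assms by (simp add: Pow_def add.commute)

text \<open>Rankin's trick: subsets of product above z are weighted by (product / z)^\<sigma> with
  \<sigma> = 1 / ln w. Inserting p^\<sigma> enlarges the full product by at most exp (12 k), where
  12 = 4 * 3 and the 3 bounds \<sigma> times Mertens' sum up to w. The hypothesis on ln z makes
  z^(-\<sigma>) at most exp (- 12 k) / 2, so at least half of the full product comes from products
  up to z.\<close>

lemma sieve_density_lower:
  fixes k :: nat
  assumes "finite P" and pr: "\<And>p. p \<in> P \<Longrightarrow> prime p \<and> 2 * k \<le> p \<and> p \<le> w" and k: "k \<ge> 1"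
    and w: "w \<ge> 2" and z: "z \<ge> 1" "ln (real z) \<ge> (12 * real k + ln 2) * ln (real w)"
  shows "(\<Prod>p\<in>P. 1 + real k / (real p - real k)) \<le> 2 * (\<Sum>A | A \<subseteq> P \<and> \<Prod>A \<le> z. \<Prod>p\<in>A. real k / (real p - real k))"
proof -
  define h where "h = (\<lambda>p. real k / (real p - real k))"
  define \<sigma> where "\<sigma> = 1 / ln (real w)"
  have lw: "ln (real w) > 0" using w by simp
  then have \<sigma>: "\<sigma> > 0" by (simp add: \<sigma>_def)
  have h: "0 < h p" "h p \<le> 2 * real k / real p" if "p \<in> P" for p
  proof -
    have "2 * real k \<le> real p" using pr[OF that] by (metis of_nat_le_iff of_nat_mult of_nat_numeral)
    then show "0 < h p" "h p \<le> 2 * real k / real p" using k by (auto simp: h_def field_simps)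
  qed
  define g where "g = (\<lambda>p. h p * real p powr \<sigma>)"
  define R where "R = (\<Prod>p\<in>P. 1 + h p)"
  have prpos: "\<Prod>A > 0" if "A \<subseteq> P" for A
    by (rule prod_pos) (use that pr in \<open>auto dest: prime_gt_0_nat\<close>)
  have hpos: "(\<Prod>p\<in>A. h p) > 0" if "A \<subseteq> P" for A
    by (rule prod_pos) (use that h in auto)
  have gA: "(\<Prod>p\<in>A. g p) = (\<Prod>p\<in>A. h p) * real (\<Prod>A) powr \<sigma>" if "A \<subseteq> P" for A
    using that by (simp add: g_def prod.distrib prod_powr_distrib)
  have "(\<Sum>A | A \<subseteq> P \<and> \<not> \<Prod>A \<le> z. \<Prod>p\<in>A. h p) \<le> (\<Sum>A | A \<subseteq> P \<and> \<not> \<Prod>A \<le> z. real z powr - \<sigma> * (\<Prod>p\<in>A. g p))"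
  proof (rule sum_mono)
    fix A assume "A \<in> {A. A \<subseteq> P \<and> \<not> \<Prod>A \<le> z}"
    then have A: "A \<subseteq> P" "z \<le> \<Prod>A" by auto
    have "real z powr \<sigma> \<le> real (\<Prod>A) powr \<sigma>"
      by (rule powr_mono2) (use A \<sigma> in \<open>auto simp del: of_nat_prod\<close>)
    then have "1 \<le> real z powr - \<sigma> * real (\<Prod>A) powr \<sigma>"
      using z by (simp add: powr_minus field_simps del: of_nat_prod)
    then have "(\<Prod>p\<in>A. h p) * 1 \<le> (\<Prod>p\<in>A. h p) * (real z powr - \<sigma> * real (\<Prod>A) powr \<sigma>)"
      using hpos[OF A(1)] by (intro mult_left_mono) auto
    then show "(\<Prod>p\<in>A. h p) \<le> real z powr - \<sigma> * (\<Prod>p\<in>A. g p)"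
      by (simp add: gA[OF A(1)] mult_ac del: of_nat_prod)
  qed
  also have "\<dots> \<le> (\<Sum>A | A \<subseteq> P. real z powr - \<sigma> * (\<Prod>p\<in>A. g p))"
    by (rule sum_mono2) (use assms(1) hpos gA in \<open>auto simp: less_imp_le simp del: of_nat_prod\<close>)
  also have "\<dots> = real z powr - \<sigma> * (\<Prod>p\<in>P. 1 + g p)"
    by (simp add: sum_distrib_left[symmetric] sum_subsets_prod[OF assms(1)])
  also have "\<dots> \<le> exp (- (12 * real k + ln 2)) * (R * exp (12 * real k))"
  proof (rule mult_mono)
    have "real z powr - \<sigma> = exp (- (\<sigma> * ln (real z)))" using z by (simp add: powr_def)
    also have "\<dots> \<le> exp (- (12 * real k + ln 2))"
      using z lw by (simp add: \<sigma>_def field_simps)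
    finally show "real z powr - \<sigma> \<le> exp (- (12 * real k + ln 2))" .
    have "(\<Prod>p\<in>P. 1 + g p) \<le> (\<Prod>p\<in>P. (1 + h p) * exp (4 * real k * \<sigma> * (ln (real p) / real p)))"
    proof (rule prod_mono, intro conjI)
      fix p assume p: "p \<in> P"
      have p2: "2 \<le> p" "p \<le> w" using pr[OF p] by (auto dest: prime_ge_2_nat)
      show "0 \<le> 1 + g p" using h[OF p] by (simp add: g_def)
      define u where "u = \<sigma> * ln (real p)"
      have u: "0 \<le> u" "u \<le> 1" using p2 lw by (auto simp: u_def \<sigma>_def field_simps)
      have "g p = h p * exp u" using p2 by (simp add: g_def u_def powr_def)
      then have "1 + g p \<le> (1 + h p) * (1 + h p * (exp u - 1))"
        using h[OF p] u by (simp add: algebra_simps)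
      also have "\<dots> \<le> (1 + h p) * exp (h p * (exp u - 1))"
        using h[OF p] by (intro mult_left_mono exp_ge_add_one_self) auto
      also have "h p * (exp u - 1) \<le> (2 * real k / real p) * (2 * u)"
        using h[OF p] exp_minus_one_le[OF u] u by (intro mult_mono) auto
      also have "\<dots> = 4 * real k * \<sigma> * (ln (real p) / real p)" by (simp add: u_def)
      finally show "1 + g p \<le> (1 + h p) * exp (4 * real k * \<sigma> * (ln (real p) / real p))"
        using h[OF p] by simp
    qed
    also have "\<dots> = R * exp (4 * real k * \<sigma> * (\<Sum>p\<in>P. ln (real p) / real p))"
      by (simp add: prod.distrib R_def exp_sum[OF assms(1)] sum_distrib_left)
    also have "\<dots> \<le> R * exp (12 * real k)"
    proof -
      have "(\<Sum>p\<in>P. ln (real p) / real p) \<le> (\<Sum>p\<in>primes_le w. ln (real p) / real p)"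
        by (rule sum_mono2) (use pr in \<open>auto dest: prime_gt_0_nat\<close>)
      also have "\<dots> \<le> ln (real w) + ln 4" using Mertens_first_upper[of w] w by simp
      also have "ln 4 \<le> 2 * ln (real w)"
      proof -
        have "ln (4::real) = 2 * ln 2" using ln_realpow[of 2 2] by simp
        then show ?thesis using w by simp
      qed
      finally have "\<sigma> * (\<Sum>p\<in>P. ln (real p) / real p) \<le> 3"
        using lw by (simp add: \<sigma>_def field_simps)
      then have "4 * real k * (\<sigma> * (\<Sum>p\<in>P. ln (real p) / real p)) \<le> 4 * real k * 3"
        by (intro mult_left_mono) auto
      moreover have "R > 0" unfolding R_def by (rule prod_pos) (use h in \<open>auto simp: add_pos_pos\<close>)
      ultimately show ?thesis by (simp add: mult_ac)
    qed
    finally show "(\<Prod>p\<in>P. 1 + g p) \<le> R * exp (12 * real k)" .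
    show "0 \<le> (\<Prod>p\<in>P. 1 + g p)" by (rule prod_nonneg) (use h in \<open>auto simp: g_def add_nonneg_nonneg less_imp_le\<close>)
  qed auto
  also have "\<dots> = R / 2"
  proof -
    have "exp (- (12 * real k + ln 2)) * exp (12 * real k) = exp (- ln 2)"
      unfolding mult_exp_exp by simp
    also have "\<dots> = 1 / 2" by (simp add: exp_minus)
    finally show ?thesis by simp
  qed
  finally have tail: "(\<Sum>A | A \<subseteq> P \<and> \<not> \<Prod>A \<le> z. \<Prod>p\<in>A. h p) \<le> R / 2" .
  have "{A. A \<subseteq> P} = {A. A \<subseteq> P \<and> \<Prod>A \<le> z} \<union> {A. A \<subseteq> P \<and> \<not> \<Prod>A \<le> z}" by auto
  then have "R = (\<Sum>A\<in>{A. A \<subseteq> P \<and> \<Prod>A \<le> z} \<union> {A. A \<subseteq> P \<and> \<not> \<Prod>A \<le> z}. \<Prod>p\<in>A. h p)"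
    using sum_subsets_prod[OF assms(1), of h] by (simp only: R_def)
  also have "\<dots> = (\<Sum>A | A \<subseteq> P \<and> \<Prod>A \<le> z. \<Prod>p\<in>A. h p) + (\<Sum>A | A \<subseteq> P \<and> \<not> \<Prod>A \<le> z. \<Prod>p\<in>A. h p)"
    by (rule sum.union_disjoint) (use assms(1) in auto)
  finally show ?thesis using tail by (simp add: R_def h_def)
qed

text \<open>If q and all q d + 1 are to be prime, q must avoid the classes 0 and -1/d modulo p.
  These are the primes at which fewer than card D + 1 distinct classes arise: some -1/d does not
  exist, or two of them agree. They make up the singular series.\<close>

definition exceptional :: "nat set \<Rightarrow> nat set" where
  "exceptional D = {p. prime p \<and> ((\<exists>d\<in>D. p dvd d) \<or> (\<exists>d\<in>D. \<exists>d'\<in>D. d \<noteq> d' \<and> [d = d'] (mod p)))}"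

lemma card_sieved_residues:
  assumes p: "prime p" "p \<notin> exceptional D" and "finite D"
  shows "card {r. r < p \<and> (p dvd r \<or> (\<exists>d\<in>D. p dvd r * d + 1))} = card D + 1"
proof -
  have p1: "p > 1" using p(1) by (rule prime_gt_1_nat)
  have cop: "coprime d p" if "d \<in> D" for d
  proof -
    have "\<not> p dvd d" using p that unfolding exceptional_def by blast
    then show ?thesis by (subst coprime_commute) (rule prime_imp_coprime[OF p(1)])
  qed
  have dist: "d = d'" if "d \<in> D" "d' \<in> D" "[d = d'] (mod p)" for d d'
    using p that unfolding exceptional_def by blast
  define E where "E = (\<lambda>d. {r. r < p \<and> p dvd r * d + 1})"
  have cE: "card (E d) = 1" if d: "d \<in> D" for d
  proof -
    obtain x where x: "[d * x = 1] (mod p)" using cong_solve_coprime_nat[OF cop[OF d]] by auto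
    \<comment> \<open>\<open>x\<close> inverts \<open>d\<close> modulo \<open>p\<close> and p - 1
      stands for -1, so \<open>r\<close> is the class -1/d.\<close>
    define r where "r = (x * (p - 1)) mod p"
    have "[r * d + 1 = x * (p - 1) * d + 1] (mod p)" unfolding r_def
      by (rule cong_add[OF cong_mult[OF _ cong_refl] cong_refl]) (rule cong_mod_leftI, rule cong_refl)
    also have "x * (p - 1) * d + 1 = (d * x) * (p - 1) + 1" by (simp only: mult_ac)
    also have "[(d * x) * (p - 1) + 1 = 1 * (p - 1) + 1] (mod p)"
      by (rule cong_add[OF cong_mult[OF x cong_refl] cong_refl])
    also have "1 * (p - 1) + 1 = p" using p1 by simp
    finally have "[r * d + 1 = p] (mod p)" .
    moreover have "[p = 0] (mod p)" by (simp add: cong_def)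
    ultimately have "[r * d + 1 = 0] (mod p)" by (rule cong_trans)
    then have "p dvd r * d + 1" unfolding cong_0_iff .
    moreover have "r < p" using p1 by (simp add: r_def)
    ultimately have r: "r \<in> E d" unfolding E_def by blast
    have "s = r" if s: "s \<in> E d" for s
    proof -
      have "[s * d + 1 = 0] (mod p)" "[r * d + 1 = 0] (mod p)" "s < p" "r < p"
        using s r by (simp_all only: E_def mem_Collect_eq cong_0_iff)
      note sr = this
      from cong_trans[OF sr(1) cong_sym[OF sr(2)]]
      have "[s * d + 1 = r * d + 1] (mod p)" .
      then have "[s * d = r * d] (mod p)" by (simp only: cong_add_rcancel_nat)
      then have "[s = r] (mod p)" using cop[OF d] by (simp add: cong_mult_rcancel_nat)
      then show ?thesis using sr(3,4) by (rule cong_less_modulus_unique_nat)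
    qed
    then have "E d = {r}" using r by blast
    then show ?thesis by simp
  qed
  have finE: "finite (E d)" for d by (simp add: E_def)
  have disj: "E d \<inter> E d' = {}" if "d \<in> D" "d' \<in> D" "d \<noteq> d'" for d d'
  proof (rule ccontr)
    assume "E d \<inter> E d' \<noteq> {}"
    then obtain r where r: "p dvd r * d + 1" "p dvd r * d' + 1" by (auto simp: E_def)
    have "\<not> p dvd r"
    proof
      assume "p dvd r"
      then have "p dvd r * d" by simp
      then have "p dvd 1" using r(1) dvd_add_right_iff[of p "r * d" 1] by blast
      then show False using p1 by simp
    qed
    then have "coprime r p" by (subst coprime_commute) (rule prime_imp_coprime[OF p(1)])
    moreover have "[r * d + 1 = 0] (mod p)" "[r * d' + 1 = 0] (mod p)"
      using r by (simp_all only: cong_0_iff)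
    from cong_trans[OF this(1) cong_sym[OF this(2)]]
    have "[r * d + 1 = r * d' + 1] (mod p)" .
    then have "[r * d = r * d'] (mod p)" by (simp only: cong_add_rcancel_nat)
    ultimately have "[d = d'] (mod p)" by (simp add: cong_mult_lcancel_nat)
    then show False using dist that by auto
  qed
  have "{r. r < p \<and> (p dvd r \<or> (\<exists>d\<in>D. p dvd r * d + 1))} = {0} \<union> (\<Union>d\<in>D. E d)"
  proof -
    have eqv: "r < p \<and> (p dvd r \<or> (\<exists>d\<in>D. p dvd r * d + 1)) \<longleftrightarrow> r = 0 \<or> (\<exists>d\<in>D. r < p \<and> p dvd r * d + 1)" for r
    proof (cases "r = 0")
      case False
      then have "\<not> (r < p \<and> p dvd r)" using nat_dvd_not_less[of r p] by blast
      then show ?thesis using False by blast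
    qed (use p1 in simp)
    show ?thesis by (rule Set.set_eqI) (simp only: eqv E_def mem_Collect_eq Un_iff UN_iff singleton_iff)
  qed
  also have "card \<dots> = card {0::nat} + card (\<Union>d\<in>D. E d)"
  proof (rule card_Un_disjoint)
    have "0 \<notin> E d" for d using p1 unfolding E_def by simp
    then show "{0} \<inter> (\<Union>d\<in>D. E d) = {}" by blast
  qed (use assms finE in auto)
  also have "card (\<Union>d\<in>D. E d) = (\<Sum>d\<in>D. card (E d))"
    by (rule card_UN_disjoint) (use assms finE disj in auto)
  also have "\<dots> = card D" using cE by simp
  finally show ?thesis by simp
qed

section \<open>The sieve for tuples of primes\<close>

lemma power_le_exp:
  assumes "k \<ge> 1" "a > 0" "x \<ge> 0"
  shows "x ^ k \<le> (real k / a) ^ k * exp (a * x)"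
proof -
  have "a * x / real k \<le> exp (a * x / real k)" using exp_ge_add_one_self[of "a * x / real k"] by linarith
  then have "x \<le> real k / a * exp (a * x / real k)" using assms by (simp add: field_simps)
  then have "x ^ k \<le> (real k / a * exp (a * x / real k)) ^ k" using assms by (intro power_mono) auto
  also have "\<dots> = (real k / a) ^ k * exp (a * x / real k) ^ k" by (rule power_mult_distrib)
  also have "exp (a * x / real k) ^ k = exp (a * x)"
    using assms by (simp add: exp_of_nat_mult[symmetric])
  finally show ?thesis .
qed

lemma inverse_prod_primes_le:
  assumes "w \<ge> 2"
  shows "(\<Prod>p\<in>primes_le w. 1 - 1 / real p) \<le> 1 / ln (real w)"
proof -
  have pos: "(\<Prod>p\<in>primes_le w. 1 - 1 / real p) > 0"
    by (rule prod_pos) (auto dest: prime_gt_1_nat)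
  have "ln (real w) \<le> 1 / (\<Prod>p\<in>primes_le w. 1 - 1 / real p)"
    using ln_le_prod_primes[of w] assms by (simp add: prod_dividef)
  then have "ln (real w) * (\<Prod>p\<in>primes_le w. 1 - 1 / real p) \<le> 1"
    using pos by (simp add: le_divide_eq)
  moreover have "ln (real w) > 0" using assms by simp
  ultimately show ?thesis by (simp add: field_simps)
qed

lemma two_power_eq_exp: "(2::real) ^ n = exp (real n * ln 2)"
  by (simp add: exp_of_nat_mult)

text \<open>The exceptional primes are simply not sieved by.\<close>
theorem prime_tuple_sieve:
  assumes "k \<ge> 1"
  obtains C where "C > 0" "\<And>i D. i \<ge> 1 \<Longrightarrow> finite D \<Longrightarrow> card D + 1 = k \<Longrightarrow> (\<And>d. d \<in> D \<Longrightarrow> d > 0) \<Longrightarrow>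
    real (card {q \<in> {2 ^ i..<2 ^ Suc i}. prime q \<and> (\<forall>d\<in>D. prime (q * d + 1))})
    \<le> C * 2 ^ i / real i ^ k * Euler_prod (exceptional D \<inter> {..2 ^ i}) ^ k"
proof -
  \<comment> \<open>Below, the sieving limit is w = 2^(i div M) and the level is z = 2^(i div 8).
    \<open>b\<close> is so large that M = 8 b gives the ratio of ln z to ln w which
    \<open>sieve_density_lower\<close> asks for; the 8 gives z^4 \<le> 2^(i / 2), which keeps the
    error term small.\<close>
  define b where "b = nat \<lceil>(12 * real k + ln 2) / ln 2\<rceil> + 1"
  define M where "M = 8 * b"
  \<comment> \<open>Primes below 2k are left out because the sieve requires 2k \<le> p;
    \<open>K\<close> is the price, a constant depending on k.\<close>
  define K where "K = Euler_prod (primes_le (2 * k)) ^ k"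
  define C where "C = real M ^ k + 2 * (2 * real M / ln 2) ^ k * K + (real k / (ln 2 / 2)) ^ k"
  have b1: "b \<ge> 1" by (simp add: b_def)
  have M: "M \<ge> 8" using b1 by (simp add: M_def)
  have bb: "real b * ln 2 \<ge> 12 * real k + ln 2"
  proof -
    have "(12 * real k + ln 2) / ln 2 \<le> real b" unfolding b_def by linarith
    then show ?thesis by (simp add: divide_le_eq)
  qed
  have prodge1: "1 \<le> Euler_prod A" if "\<And>p. p \<in> A \<Longrightarrow> prime p" for A :: "nat set"
    by (rule prod_ge_1) (use that Euler_factor_ge_1 in auto)
  have K1: "K \<ge> 1" unfolding K_def by (rule one_le_power, rule prodge1) auto
  have Cpos: "C > 0" using M K1 by (auto simp: C_def intro!: add_pos_nonneg)
  have main: "real (card {q \<in> {2 ^ i..<2 ^ Suc i}. prime q \<and> (\<forall>d\<in>D. prime (q * d + 1))})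
    \<le> C * 2 ^ i / real i ^ k * Euler_prod (exceptional D \<inter> {..2 ^ i}) ^ k"
    if i: "i \<ge> 1" and D: "finite D" "card D + 1 = k" "\<And>d. d \<in> D \<Longrightarrow> d > 0" for i D
  proof -
    define Q where "Q = {q \<in> {2 ^ i..<2 ^ Suc i}. prime q \<and> (\<forall>d\<in>D. prime (q * d + 1))}"
    define E where "E = exceptional D \<inter> {..(2::nat) ^ i}"
    have finE: "finite E" by (simp add: E_def)
    define S where "S = Euler_prod E ^ k"
    have S1: "S \<ge> 1" unfolding S_def by (rule one_le_power, rule prodge1) (auto simp: E_def exceptional_def)
    have ik: "real i ^ k > 0" using i by simp
    have "card Q \<le> card {(2::nat) ^ i..<2 ^ Suc i}" by (rule card_mono) (auto simp: Q_def)
    then have triv: "real (card Q) \<le> 2 ^ i" by simp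
    have suff: "real (card Q) \<le> C * 2 ^ i / real i ^ k * S" if "real (card Q) * real i ^ k \<le> c * 2 ^ i * S" "c \<le> C" for c
    proof -
      have "c * 2 ^ i * S \<le> C * 2 ^ i * S" using that(2) S1 by (intro mult_right_mono) auto
      then show ?thesis using that(1) ik by (simp add: field_simps)
    qed
    show ?thesis
    proof (cases "i < M")
      \<comment> \<open>For i < M the trivial count 2^i suffices, since i^k stays below the constant
        M^k.\<close>
      case True
      have "real (card Q) * real i ^ k \<le> 2 ^ i * real M ^ k"
        by (intro mult_mono triv power_mono) (use True in auto)
      also have "\<dots> * 1 \<le> (2 ^ i * real M ^ k) * S" using S1 by (intro mult_left_mono) auto
      finally have "real (card Q) * real i ^ k \<le> real M ^ k * 2 ^ i * S" by (simp add: mult_ac)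
      moreover have "real M ^ k \<le> C" using K1 M by (simp add: C_def)
      ultimately have "real (card Q) \<le> C * 2 ^ i / real i ^ k * S" by (rule suff)
      then show ?thesis unfolding Q_def S_def E_def .
    next
      case False
      define z where "z = (2::nat) ^ (i div 8)"
      define m where "m = i div M"
      define w where "w = (2::nat) ^ m"
      have m1: "m \<ge> 1" using False M by (simp add: m_def Suc_le_eq div_greater_zero_iff)
      have w2: "w \<ge> 2" using m1 unfolding w_def by (metis power_increasing power_one_right one_le_numeral)
      have mi: "m < i" unfolding m_def using i M by (intro div_less_dividend) auto
      have wi: "w < 2 ^ i" unfolding w_def using mi by simp
      have mb: "m * b \<le> i div 8" unfolding m_def M_def by (simp add: div_mult2_eq)
      define P where "P = {p \<in> primes_le w. 2 * k \<le> p \<and> p \<notin> exceptional D}"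
      define B where "B = (\<lambda>p n. p dvd n \<or> (\<exists>d\<in>D. p dvd n * d + 1))"
      define G where "G = (\<Sum>A | A \<subseteq> P \<and> \<Prod>A \<le> z. \<Prod>p\<in>A. real k / (real p - real k))"
      have finP: "finite P" by (simp add: P_def)
      have Bper: "B p (n mod p) = B p n" for p n
      proof -
        have "p dvd n mod p * d + 1 \<longleftrightarrow> p dvd n * d + 1" for d
        proof -
          have "[n mod p * d + 1 = n * d + 1] (mod p)"
            by (rule cong_add[OF cong_mult[OF _ cong_refl] cong_refl]) (rule cong_mod_leftI, rule cong_refl)
          then show ?thesis by (rule cong_dvd_iff)
        qed
        moreover have "p dvd n mod p \<longleftrightarrow> p dvd n" by (rule dvd_mod_iff) simp
        ultimately show ?thesis unfolding B_def by blast
      qed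
      have cP: "prime p" "2 * k \<le> p" "card {r. r < p \<and> B p r} = k" if p: "p \<in> P" for p
      proof -
        show "prime p" "2 * k \<le> p" using p by (auto simp: P_def)
        show "card {r. r < p \<and> B p r} = k"
          unfolding B_def using card_sieved_residues[of p D] p D by (simp add: P_def)
      qed
      have z1: "z \<ge> 1" by (simp add: z_def)
      have sel1: "G \<ge> 1"
        unfolding G_def by (rule Selberg_sieve(1)[OF finP cP(1) z1 assms Bper cP(3) cP(2)])
      have sel2: "real (card {n \<in> {2 ^ i..<2 ^ i + 2 ^ i}. \<forall>p\<in>P. \<not> B p n}) \<le> real (2 ^ i) / G + real z ^ 4"
        unfolding G_def by (rule Selberg_sieve(2)[OF finP cP(1) z1 assms Bper cP(3) cP(2)])
      \<comment> \<open>A sieving prime p \<le> w < 2^i \<le> q is smaller than q and than q d + 1,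
        so it cannot divide either of these primes.\<close>
      have "Q \<subseteq> {n \<in> {2 ^ i..<2 ^ i + 2 ^ i}. \<forall>p\<in>P. \<not> B p n}"
      proof
        fix q assume q: "q \<in> Q"
        have "\<not> B p q" if p: "p \<in> P" for p
        proof
          have pw: "prime p" "p \<le> w" using p by (auto simp: P_def)
          have pq: "p < q" using pw wi q by (simp add: Q_def)
          assume "B p q"
          then consider "p dvd q" | d where "d \<in> D" "p dvd q * d + 1" unfolding B_def by blast
          then show False
          proof cases
            case 1
            then have "p = q" using pw q primes_dvd_imp_eq[of p q] by (simp add: Q_def)
            then show False using pq by simp
          next
            case 2
            then have "prime (q * d + 1)" using q by (simp add: Q_def)
            then have "p = q * d + 1" using primes_dvd_imp_eq[OF pw(1) _ 2(2)] by simp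
            moreover have "q * 1 \<le> q * d" using D(3)[OF 2(1)] by (intro mult_le_mono2) simp
            ultimately show False using pq by simp
          qed
        qed
        then show "q \<in> {n \<in> {2 ^ i..<2 ^ i + 2 ^ i}. \<forall>p\<in>P. \<not> B p n}" using q by (simp add: Q_def)
      qed
      then have "card Q \<le> card {n \<in> {2 ^ i..<2 ^ i + 2 ^ i}. \<forall>p\<in>P. \<not> B p n}" by (intro card_mono) auto
      then have cQ: "real (card Q) \<le> 2 ^ i / G + real z ^ 4" using sel2 by simp
      define R where "R = (\<Prod>p\<in>P. 1 + real k / (real p - real k))"
      have R: "R \<le> 2 * G" unfolding R_def G_def
      proof (rule sieve_density_lower)
        show "ln (real z) \<ge> (12 * real k + ln 2) * ln (real w)"
        proof -
          have "(12 * real k + ln 2) * (real m * ln 2) \<le> (real b * ln 2) * (real m * ln 2)"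
            by (rule mult_right_mono[OF bb]) simp
          also have "\<dots> = real (m * b) * ln 2 * ln 2" by (simp add: mult_ac)
          also have "\<dots> \<le> real (m * b) * ln 2 * 1"
            using ln_2_less_1 by (intro mult_left_mono) auto
          also have "\<dots> \<le> real (i div 8) * ln 2" using mult_right_mono[OF of_nat_mono[OF mb], of "ln 2 :: real"] by simp
          finally show ?thesis by (simp add: z_def w_def ln_realpow)
        qed
      qed (use finP assms w2 in \<open>auto simp: P_def z_def\<close>)
      have Ppos: "real p - real k > 0" "real p \<ge> 2" if "p \<in> P" for p
      proof -
        have "prime p" "2 * k \<le> p" using that by (auto simp: P_def)
        then show "real p - real k > 0" "real p \<ge> 2" using assms prime_ge_2_nat[of p] by linarith+
      qed
      have "1 / R = (\<Prod>p\<in>P. 1 / (1 + real k / (real p - real k)))" by (simp add: R_def prod_dividef)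
      also have "\<dots> = (\<Prod>p\<in>P. 1 - real k / real p)"
        by (rule prod.cong) (use Ppos in \<open>force simp: field_simps\<close>)+
      \<comment> \<open>Bernoulli's inequality reduces dimension k to the k-th power of Mertens'
        product. The primes up to w missing from \<open>P\<close> are at most 2k or exceptional, and
        restoring them costs the factors \<open>K\<close> and \<open>S\<close>.\<close>
      also have "\<dots> \<le> (\<Prod>p\<in>P. (1 - 1 / real p) ^ k)"
      proof (rule prod_mono, intro conjI)
        fix p assume p: "p \<in> P"
        show "0 \<le> 1 - real k / real p" using Ppos[OF p] by simp
        show "1 - real k / real p \<le> (1 - 1 / real p) ^ k"
          using Bernoulli_inequality[of "- 1 / real p" k] Ppos[OF p] by simp
      qed
      also have "\<dots> = (\<Prod>p\<in>P. 1 - 1 / real p) ^ k" by (simp add: prod_power_distrib)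
      also have "\<dots> \<le> (1 / ln (real w) * (Euler_prod (primes_le (2 * k)) * Euler_prod E)) ^ k"
      proof (rule power_mono)
        define V where "V = primes_le w - P"
        have VP: "primes_le w = P \<union> V" "P \<inter> V = {}" "finite V" by (auto simp: V_def P_def)
        have pos: "(\<Prod>p\<in>A. 1 - 1 / real p) > 0" if "\<And>p. p \<in> A \<Longrightarrow> prime p" for A :: "nat set"
        proof (rule prod_pos)
          fix p assume "p \<in> A"
          then have "p > 1" using prime_gt_1_nat that by blast
          then show "1 - 1 / real p > 0" by simp
        qed
        have prV: "prime p" if "p \<in> V" for p using that by (simp add: V_def)
        have "(\<Prod>p\<in>primes_le w. 1 - 1 / real p) = (\<Prod>p\<in>P. 1 - 1 / real p) * (\<Prod>p\<in>V. 1 - 1 / real p)"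
          unfolding VP(1) by (rule prod.union_disjoint) (use finP VP in auto)
        then have "(\<Prod>p\<in>P. 1 - 1 / real p) = (\<Prod>p\<in>primes_le w. 1 - 1 / real p) * Euler_prod V"
          using pos[of V] prV by (simp add: prod_dividef)
        also have "\<dots> \<le> 1 / ln (real w) * (Euler_prod (primes_le (2 * k)) * Euler_prod E)"
        proof (rule mult_mono)
          show "(\<Prod>p\<in>primes_le w. 1 - 1 / real p) \<le> 1 / ln (real w)" by (rule inverse_prod_primes_le[OF w2])
          have "Euler_prod V \<le> Euler_prod (primes_le (2 * k) \<union> (E - primes_le (2 * k)))"
          proof (rule prod_mono2)
            show "V \<subseteq> primes_le (2 * k) \<union> (E - primes_le (2 * k))"
              using wi by (auto simp: V_def P_def E_def)
            show "1 \<le> 1 / (1 - 1 / real p)" if "p \<in> primes_le (2 * k) \<union> (E - primes_le (2 * k)) - V" for p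
              using that by (intro Euler_factor_ge_1) (auto simp: E_def exceptional_def)
            show "0 \<le> 1 / (1 - 1 / real p)" if "p \<in> V" for p using Euler_factor_ge_1[OF prV[OF that]] by linarith
          qed (use finE in auto)
          also have "\<dots> = Euler_prod (primes_le (2 * k)) * Euler_prod (E - primes_le (2 * k))"
            by (rule prod.union_disjoint) (use finE in auto)
          also have "\<dots> \<le> Euler_prod (primes_le (2 * k)) * Euler_prod E"
          proof (rule mult_left_mono)
            show "Euler_prod (E - primes_le (2 * k)) \<le> Euler_prod E"
            proof (rule prod_mono2)
              show "1 \<le> 1 / (1 - 1 / real p)" if "p \<in> E - (E - primes_le (2 * k))" for p
                using that by (intro Euler_factor_ge_1) auto
              show "0 \<le> 1 / (1 - 1 / real p)" if "p \<in> E - primes_le (2 * k)" for p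
                using that Euler_factor_ge_1[of p] by (auto simp: E_def exceptional_def)
            qed (use finE in auto)
            have "1 \<le> Euler_prod (primes_le (2 * k))" by (rule prodge1) simp
            then show "0 \<le> Euler_prod (primes_le (2 * k))" by linarith
          qed
          finally show "Euler_prod V \<le> Euler_prod (primes_le (2 * k)) * Euler_prod E" .
          show "0 \<le> 1 / ln (real w)" using w2 by simp
          have "1 \<le> Euler_prod V" by (rule prodge1) (rule prV)
          then show "0 \<le> Euler_prod V" by linarith
        qed
        finally show "(\<Prod>p\<in>P. 1 - 1 / real p) \<le> 1 / ln (real w) * (Euler_prod (primes_le (2 * k)) * Euler_prod E)" .
        show "0 \<le> (\<Prod>p\<in>P. 1 - 1 / real p)" using pos[of P] by (simp add: P_def less_imp_le)
      qed
      also have "\<dots> = (1 / ln (real w)) ^ k * (K * S)" by (simp only: power_mult_distrib K_def S_def)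
      also have "\<dots> \<le> (2 * real M / ln 2 / real i) ^ k * (K * S)"
      proof (rule mult_right_mono, rule power_mono)
        have "i < (m + 1) * M" unfolding m_def using M by (simp add: dividend_less_times_div mult.commute)
        also have "\<dots> \<le> (2 * m) * M" using m1 by (intro mult_le_mono1) simp
        finally have "real i \<le> real (2 * m * M)" by (simp del: of_nat_mult)
        then have "real i * ln 2 \<le> 2 * real m * real M * ln 2" by simp
        moreover have "ln (real w) = real m * ln 2" by (simp add: w_def ln_realpow)
        ultimately show "1 / ln (real w) \<le> 2 * real M / ln 2 / real i"
          using m1 i by (simp add: field_simps)
      qed (use w2 K1 S1 in auto)
      finally have R': "1 / R \<le> (2 * real M / ln 2) ^ k / real i ^ k * (K * S)" by (simp add: power_divide power_mult_distrib)
      have Rpos: "R > 0" unfolding R_def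
      proof (rule prod_pos)
        fix p assume "p \<in> P"
        from Ppos(1)[OF this] show "0 < 1 + real k / (real p - real k)" by (intro add_pos_nonneg) auto
      qed
      have "1 / G \<le> 2 * (1 / R)" using R Rpos sel1 by (simp add: field_simps)
      then have "1 / G * real i ^ k \<le> 2 * (1 / R) * real i ^ k" using ik by (intro mult_right_mono) auto
      also have "\<dots> \<le> 2 * ((2 * real M / ln 2) ^ k / real i ^ k * (K * S)) * real i ^ k"
        using R' ik by (intro mult_right_mono mult_left_mono) auto
      also have "\<dots> = 2 * (2 * real M / ln 2) ^ k * K * S" using i by simp
      finally have G': "2 ^ i / G * real i ^ k \<le> 2 ^ i * (2 * (2 * real M / ln 2) ^ k * K * S)"
        using mult_left_mono[of "1 / G * real i ^ k" "2 * (2 * real M / ln 2) ^ k * K * S" "2 ^ i"] by simp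
      \<comment> \<open>Of 2^i one square root absorbs z^4 and the other absorbs i^k, with a
        constant depending on k only.\<close>
      have "real z ^ 4 * real i ^ k \<le> 2 ^ i * ((real k / (ln 2 / 2)) ^ k * S)"
      proof -
        have "real z ^ 4 = 2 ^ (4 * (i div 8))" by (simp add: z_def power_mult[symmetric] mult.commute)
        also have "\<dots> = exp (real (4 * (i div 8)) * ln 2)" by (rule two_power_eq_exp)
        also have "\<dots> \<le> exp (ln 2 / 2 * real i)"
        proof -
          have "8 * (i div 8) \<le> i" by simp
          then have "real (8 * (i div 8)) \<le> real i" by (rule of_nat_mono)
          then have "real (4 * (i div 8)) * ln 2 \<le> real i / 2 * ln 2" by (intro mult_right_mono) auto
          then show ?thesis by (simp add: mult_ac)
        qed
        finally have "real z ^ 4 * real i ^ k \<le> exp (ln 2 / 2 * real i) * ((real k / (ln 2 / 2)) ^ k * exp (ln 2 / 2 * real i))"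
          by (intro mult_mono power_le_exp) (use assms in auto)
        also have "\<dots> = exp (ln 2 * real i) * (real k / (ln 2 / 2)) ^ k"
        proof -
          have "exp (ln 2 / 2 * real i) * exp (ln 2 / 2 * real i) = exp (ln 2 * real i)"
            unfolding mult_exp_exp by simp
          then show ?thesis by (simp add: mult_ac)
        qed
        also have "exp (ln 2 * real i) = 2 ^ i" by (simp only: two_power_eq_exp mult.commute)
        also have "(2::real) ^ i * (real k / (ln 2 / 2)) ^ k * 1 \<le> 2 ^ i * (real k / (ln 2 / 2)) ^ k * S"
          by (intro mult_left_mono S1) auto
        finally show ?thesis by (simp add: mult_ac)
      qed
      with G' have "(2 ^ i / G + real z ^ 4) * real i ^ k \<le> (2 * (2 * real M / ln 2) ^ k * K + (real k / (ln 2 / 2)) ^ k) * 2 ^ i * S"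
        by (simp add: algebra_simps)
      moreover have "real (card Q) * real i ^ k \<le> (2 ^ i / G + real z ^ 4) * real i ^ k"
        using cQ ik by (intro mult_right_mono) auto
      ultimately have "real (card Q) * real i ^ k \<le> (2 * (2 * real M / ln 2) ^ k * K + (real k / (ln 2 / 2)) ^ k) * 2 ^ i * S"
        by linarith
      moreover have "2 * (2 * real M / ln 2) ^ k * K + (real k / (ln 2 / 2)) ^ k \<le> C" by (simp add: C_def)
      ultimately have "real (card Q) \<le> C * 2 ^ i / real i ^ k * S" by (rule suff)
      then show ?thesis unfolding Q_def S_def E_def .
    qed
  qed
  show ?thesis by (rule that[OF Cpos main])
qed

lemma ln_power_le_powr:
  assumes "k \<ge> 1" "\<epsilon> > 0" "x \<ge> 1"
  shows "ln x ^ k \<le> (real k / \<epsilon>) ^ k * x powr \<epsilon>"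
  using power_le_exp[OF assms(1,2), of "ln x"] assms(3) by (simp add: powr_def)

text \<open>If \<open>W\<close> is the least cutoff with \<open>\<Sum>1/p \<le> 1\<close> over the elements of \<open>A\<close> above \<open>W\<close>, the product
  is \<open>O((ln W)^k)\<close>, while \<open>A\<close> has reciprocal sum at least \<open>1\<close> from \<open>W\<close> on.\<close>
lemma prod_primes_linearise:
  fixes k :: nat and \<epsilon> :: real
  assumes k: "k \<ge> 1" and \<epsilon>: "\<epsilon> > 0"
  obtains C where "C > 0" "\<And>A. finite A \<Longrightarrow> (\<And>p. p \<in> A \<Longrightarrow> prime p) \<Longrightarrow>
    Euler_prod A ^ k \<le> C * (1 + (\<Sum>p\<in>A. real p powr (\<epsilon> - 1)))"
proof -
  obtain C1 where C1: "C1 > 0" "\<And>n. n \<ge> 2 \<Longrightarrow> Euler_prod (primes_le n) \<le> C1 * ln (real n)"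
    using Mertens_third_upper by blast
  obtain C2 where C2: "C2 > 0" "\<And>A. finite A \<Longrightarrow> (\<And>p. p \<in> A \<Longrightarrow> prime p) \<Longrightarrow>
    Euler_prod A \<le> C2 * exp (\<Sum>p\<in>A. 1 / real p)"
    using prod_Euler_factors_le_exp by blast
  define c where "c = (C1 * C2 * exp 1) ^ k"
  define C where "C = c * ((real k / \<epsilon>) ^ k + 1)"
  have c: "c > 0" using C1 C2 by (simp add: c_def)
  have C: "C > 0" using c k \<epsilon> by (auto simp: C_def intro!: mult_pos_pos add_nonneg_pos)
  have main: "Euler_prod A ^ k \<le> C * (1 + (\<Sum>p\<in>A. real p powr (\<epsilon> - 1)))"
    if A: "finite A" "\<And>p. p \<in> A \<Longrightarrow> prime p" for A
  proof -
    define good where "good = (\<lambda>W. W \<ge> 2 \<and> (\<Sum>p\<in>{p\<in>A. p > W}. 1 / real p) \<le> 1)"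
    define m where "m = Max (insert 2 A)"
    have m: "2 \<le> m" "\<And>p. p \<in> A \<Longrightarrow> p \<le> m" unfolding m_def using A(1) by (auto intro: Max_ge)
    then have e: "{p \<in> A. p > m} = {}" by (auto simp: not_less)
    have "good m" unfolding good_def e using m(1) by simp
    define W where "W = (LEAST W. good W)"
    have gW: "good W" unfolding W_def by (rule LeastI) fact
    then have W2: "W \<ge> 2" and Wt: "(\<Sum>p\<in>{p\<in>A. p > W}. 1 / real p) \<le> 1" by (auto simp: good_def)
    have lnW: "ln (real W) > 0" using W2 by simp
    have "Euler_prod A \<le> (\<Prod>p\<in>primes_le W \<union> {p\<in>A. p > W}. 1 / (1 - 1 / real p))"
    proof (rule prod_mono2)
      show "A \<subseteq> primes_le W \<union> {p \<in> A. W < p}" using A(2) by auto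
      show "1 \<le> 1 / (1 - 1 / real p)" if "p \<in> primes_le W \<union> {p \<in> A. W < p} - A" for p
        using that by (intro Euler_factor_ge_1) auto
      show "0 \<le> 1 / (1 - 1 / real p)" if "p \<in> A" for p using Euler_factor_ge_1[OF A(2)[OF that]] by linarith
    qed (use A(1) in auto)
    also have "\<dots> = Euler_prod (primes_le W) * Euler_prod {p\<in>A. p > W}"
      by (rule prod.union_disjoint) (use A(1) in auto)
    also have "\<dots> \<le> (C1 * ln (real W)) * (C2 * exp 1)"
    proof (rule mult_mono)
      show "Euler_prod (primes_le W) \<le> C1 * ln (real W)" by (rule C1(2)[OF W2])
      have "Euler_prod {p\<in>A. p > W} \<le> C2 * exp (\<Sum>p\<in>{p\<in>A. p > W}. 1 / real p)"
        by (rule C2(2)) (use A in auto)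
      also have "\<dots> \<le> C2 * exp 1" using Wt C2(1) by simp
      finally show "Euler_prod {p\<in>A. p > W} \<le> C2 * exp 1" .
      show "0 \<le> C1 * ln (real W)" using C1(1) lnW by simp
      show "0 \<le> Euler_prod {p\<in>A. p > W}"
      proof (rule prod_nonneg)
        fix p assume "p \<in> {p\<in>A. p > W}"
        then have "1 \<le> 1 / (1 - 1 / real p)" by (intro Euler_factor_ge_1 A(2)) simp
        then show "0 \<le> 1 / (1 - 1 / real p)" by linarith
      qed
    qed
    finally have "Euler_prod A ^ k \<le> ((C1 * ln (real W)) * (C2 * exp 1)) ^ k"
    proof (rule power_mono)
      show "0 \<le> Euler_prod A"
      proof (rule prod_nonneg)
        fix p assume "p \<in> A"
        then have "1 \<le> 1 / (1 - 1 / real p)" by (intro Euler_factor_ge_1 A(2))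
        then show "0 \<le> 1 / (1 - 1 / real p)" by linarith
      qed
    qed
    also have "\<dots> = c * ln (real W) ^ k" by (simp add: c_def power_mult_distrib mult_ac)
    finally have 1: "Euler_prod A ^ k \<le> c * ln (real W) ^ k" .
    have T: "(\<Sum>p\<in>A. real p powr (\<epsilon> - 1)) \<ge> 0" by (rule sum_nonneg) auto
    have "ln (real W) ^ k \<le> ((real k / \<epsilon>) ^ k + 1) * (1 + (\<Sum>p\<in>A. real p powr (\<epsilon> - 1)))"
    proof (cases "W = 2")
      case True
      have "ln (real W) ^ k \<le> 1" using True ln_2_less_1 by (intro power_le_one) auto
      also have "\<dots> \<le> ((real k / \<epsilon>) ^ k + 1) * 1" using k \<epsilon> by simp
      also have "\<dots> \<le> ((real k / \<epsilon>) ^ k + 1) * (1 + (\<Sum>p\<in>A. real p powr (\<epsilon> - 1)))"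
        using T k \<epsilon> by (intro mult_left_mono) (auto intro!: add_nonneg_nonneg)
      finally show ?thesis .
    next
      case False
      \<comment> \<open>By minimality the elements of \<open>A\<close> above W - 1 have reciprocal
        sum above 1. Multiplying (ln W)^k by this sum and using W \<le> p termwise turns it into a
        sum over \<open>A\<close>.\<close>
      then have "\<not> good (W - 1)" unfolding W_def by (intro not_less_Least) (use W2 in \<open>simp add: W_def[symmetric]\<close>)
      then have "1 \<le> (\<Sum>p\<in>{p\<in>A. p > W - 1}. 1 / real p)" using W2 False by (auto simp: good_def)
      then have "ln (real W) ^ k * 1 \<le> ln (real W) ^ k * (\<Sum>p\<in>{p\<in>A. p > W - 1}. 1 / real p)"
        using lnW by (intro mult_left_mono) auto
      also have "\<dots> = (\<Sum>p\<in>{p\<in>A. p > W - 1}. ln (real W) ^ k / real p)" by (simp add: sum_distrib_left)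
      also have "\<dots> \<le> (\<Sum>p\<in>{p\<in>A. p > W - 1}. (real k / \<epsilon>) ^ k * real p powr (\<epsilon> - 1))"
      proof (rule sum_mono)
        fix p assume "p \<in> {p\<in>A. p > W - 1}"
        then have p: "W \<le> p" "p > 0" using W2 by auto
        have "ln (real W) ^ k \<le> ln (real p) ^ k" using p W2 by (intro power_mono) auto
        also have "\<dots> \<le> (real k / \<epsilon>) ^ k * real p powr \<epsilon>" by (rule ln_power_le_powr) (use k \<epsilon> p in auto)
        finally have "ln (real W) ^ k / real p \<le> (real k / \<epsilon>) ^ k * real p powr \<epsilon> / real p"
          by (intro divide_right_mono) auto
        also have "\<dots> = (real k / \<epsilon>) ^ k * real p powr (\<epsilon> - 1)" using p by (simp add: powr_diff)
        finally show "ln (real W) ^ k / real p \<le> (real k / \<epsilon>) ^ k * real p powr (\<epsilon> - 1)" .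
      qed
      also have "\<dots> = (real k / \<epsilon>) ^ k * (\<Sum>p\<in>{p\<in>A. p > W - 1}. real p powr (\<epsilon> - 1))"
        by (simp add: sum_distrib_left)
      also have "\<dots> \<le> ((real k / \<epsilon>) ^ k + 1) * (1 + (\<Sum>p\<in>A. real p powr (\<epsilon> - 1)))"
      proof (rule mult_mono)
        have "(\<Sum>p\<in>{p\<in>A. p > W - 1}. real p powr (\<epsilon> - 1)) \<le> (\<Sum>p\<in>A. real p powr (\<epsilon> - 1))"
          by (rule sum_mono2) (use A(1) in auto)
        then show "(\<Sum>p\<in>{p\<in>A. p > W - 1}. real p powr (\<epsilon> - 1)) \<le> 1 + (\<Sum>p\<in>A. real p powr (\<epsilon> - 1))" by simp
        show "0 \<le> (\<Sum>p\<in>{p\<in>A. p > W - 1}. real p powr (\<epsilon> - 1))" by (rule sum_nonneg) simp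
      qed (use k \<epsilon> in \<open>auto intro!: add_nonneg_nonneg\<close>)
      finally show ?thesis by simp
    qed
    then have "c * ln (real W) ^ k \<le> c * (((real k / \<epsilon>) ^ k + 1) * (1 + (\<Sum>p\<in>A. real p powr (\<epsilon> - 1))))"
      using c by (intro mult_left_mono) auto
    then show ?thesis using 1 by (simp add: C_def mult_ac)
  qed
  show ?thesis by (rule that[OF C main])
qed

section \<open>Divisor sums over smooth numbers\<close>

definition tau :: "nat \<Rightarrow> nat" where "tau m = card {d. d dvd m}"

definition divisor_closed :: "nat set \<Rightarrow> bool" where
  "divisor_closed S \<longleftrightarrow> finite S \<and> (\<forall>m\<in>S. m > 0 \<and> (\<forall>d. d dvd m \<longrightarrow> d \<in> S))"

lemma divisor_closedD:
  assumes "divisor_closed S"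
  shows "finite S" "m \<in> S \<Longrightarrow> m > 0" "m \<in> S \<Longrightarrow> d dvd m \<Longrightarrow> d \<in> S"
  using assms by (auto simp: divisor_closed_def)

lemma tau_mult_le: "tau (a * b) \<le> tau a * tau b" if "a > 0" "b > 0"
proof -
  have "{d. d dvd a * b} \<subseteq> (\<lambda>(d, e). d * e) ` ({d. d dvd a} \<times> {e. e dvd b})"
  proof
    fix d assume "d \<in> {d. d dvd a * b}"
    then obtain d1 d2 where "d = d1 * d2" "d1 dvd a" "d2 dvd b"
      using division_decomp[of d a b] by auto
    then show "d \<in> (\<lambda>(d, e). d * e) ` ({d. d dvd a} \<times> {e. e dvd b})" by force
  qed
  moreover have "finite ({d. d dvd a} \<times> {e. e dvd b})" using that by simp
  ultimately have "card {d. d dvd a * b} \<le> card ({d. d dvd a} \<times> {e. e dvd b})" by (rule surj_card_le[rotated])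
  then show ?thesis by (simp add: tau_def card_cartesian_product)
qed

lemma tau_power_mult_le: "real (tau (a * b)) ^ j \<le> real (tau a) ^ j * real (tau b) ^ j" if "a > 0" "b > 0"
proof -
  have "real (tau (a * b)) \<le> real (tau a * tau b)" using tau_mult_le[OF that] by (rule of_nat_mono)
  then have "real (tau (a * b)) ^ j \<le> (real (tau a * tau b)) ^ j" by (rule power_mono) simp
  then show ?thesis by (simp add: power_mult_distrib)
qed

text \<open>Opening one factor \<open>\<tau>\<close> replaces a sum over \<open>m\<close> by a sum over factorisations \<open>m = x y\<close>.\<close>
lemma sum_tau_open:
  fixes f :: "nat \<Rightarrow> real"
  assumes S: "divisor_closed S" and T: "T \<subseteq> S"
    and f: "\<And>m. f m \<ge> 0" "\<And>a b. a > 0 \<Longrightarrow> b > 0 \<Longrightarrow> f (a * b) \<le> f a * f b"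
  shows "(\<Sum>m\<in>T. real (tau m) * f m / real m) \<le> (\<Sum>(x, y) | (x, y) \<in> S \<times> S \<and> x * y \<in> T. (f x / real x) * (f y / real y))"
proof -
  have finS: "finite S" using S by (rule divisor_closedD)
  then have finT: "finite T" using T finite_subset by blast
  have pos: "m > 0" if "m \<in> T" for m using divisor_closedD(2)[OF S] T that by blast
  have "(\<Sum>m\<in>T. real (tau m) * f m / real m) = (\<Sum>m\<in>T. \<Sum>d | d dvd m. f m / real m)"
    by (simp add: tau_def)
  also have "\<dots> = (\<Sum>(m, d)\<in>Sigma T (\<lambda>m. {d. d dvd m}). f m / real m)"
    by (rule sum.Sigma) (use finT pos in auto)
  also have "\<dots> = (\<Sum>(x, y) | (x, y) \<in> S \<times> S \<and> x * y \<in> T. f (x * y) / real (x * y))"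
  proof (rule sum.reindex_bij_witness[where i = "\<lambda>(x, y). (x * y, x)" and j = "\<lambda>(m, d). (d, m div d)"])
    fix a assume a: "a \<in> Sigma T (\<lambda>m. {d. d dvd m})"
    obtain m d where md: "a = (m, d)" by (cases a)
    have m: "m \<in> T" "d dvd m" "m \<in> S" "m > 0" using a md T pos by auto
    have dm: "d * (m div d) = m" using m by simp
    have "m div d dvd m" using dm by (metis dvd_triv_right)
    then have "d \<in> S" "m div d \<in> S" using divisor_closedD(3)[OF S m(3)] m(2) by auto
    then show "(case a of (m, d) \<Rightarrow> (d, m div d)) \<in> {(x, y). (x, y) \<in> S \<times> S \<and> x * y \<in> T}"
      using m dm md by simp
    show "(case case a of (m, d) \<Rightarrow> (d, m div d) of (x, y) \<Rightarrow> (x * y, x)) = a"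
      using dm md by simp
    show "(case case a of (m, d) \<Rightarrow> (d, m div d) of (x, y) \<Rightarrow> f (x * y) / real (x * y)) = (case a of (m, d) \<Rightarrow> f m / real m)"
      using md by (simp only: prod.case dm)
  next
    fix b assume b: "b \<in> {(x, y). (x, y) \<in> S \<times> S \<and> x * y \<in> T}"
    obtain x y where xy: "b = (x, y)" by (cases b)
    have "x > 0" using b xy divisor_closedD(2)[OF S] by auto
    then show "(case case b of (x, y) \<Rightarrow> (x * y, x) of (m, d) \<Rightarrow> (d, m div d)) = b" using xy by simp
    show "(case b of (x, y) \<Rightarrow> (x * y, x)) \<in> Sigma T (\<lambda>m. {d. d dvd m})" using b xy by simp
  qed
  also have "\<dots> \<le> (\<Sum>(x, y) | (x, y) \<in> S \<times> S \<and> x * y \<in> T. (f x / real x) * (f y / real y))"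
  proof (rule sum_mono)
    fix b assume "b \<in> {(x, y). (x, y) \<in> S \<times> S \<and> x * y \<in> T}"
    then obtain x y where b: "b = (x, y)" "x \<in> S" "y \<in> S" by auto
    then have "x > 0" "y > 0" using divisor_closedD(2)[OF S] by auto
    then show "(case b of (x, y) \<Rightarrow> f (x * y) / real (x * y)) \<le> (case b of (x, y) \<Rightarrow> (f x / real x) * (f y / real y))"
      using f(2)[of x y] b by (simp add: divide_right_mono)
  qed
  finally show ?thesis .
qed

text \<open>Opening one factor \<open>tau\<close> turns the sum for j + 1 into at most the square of
  the sum for j, by submultiplicativity. Hence the exponent doubles with each factor, the source of
  every 2^j in the result.\<close>

lemma sum_tau_power_le:
  assumes S: "divisor_closed S"
  shows "(\<Sum>m\<in>S. real (tau m) ^ j / real m) \<le> (\<Sum>m\<in>S. 1 / real m) ^ (2 ^ j)"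
proof (induction j)
  case (Suc j)
  define f where "f = (\<lambda>m. real (tau m) ^ j)"
  have finS: "finite S" using S by (rule divisor_closedD)
  have "(\<Sum>m\<in>S. real (tau m) ^ Suc j / real m) = (\<Sum>m\<in>S. real (tau m) * f m / real m)" by (simp add: f_def)
  also have "\<dots> \<le> (\<Sum>(x, y) | (x, y) \<in> S \<times> S \<and> x * y \<in> S. (f x / real x) * (f y / real y))"
    by (rule sum_tau_open[OF S]) (auto simp: f_def tau_power_mult_le)
  also have "\<dots> \<le> (\<Sum>(x, y)\<in>S \<times> S. (f x / real x) * (f y / real y))"
    by (rule sum_mono2) (use finS in \<open>auto simp: f_def\<close>)
  also have "\<dots> = (\<Sum>x\<in>S. f x / real x) * (\<Sum>y\<in>S. f y / real y)"
    by (simp only: sum_product sum.cartesian_product)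
  also have "\<dots> = (\<Sum>x\<in>S. f x / real x) ^ 2" by (simp add: power2_eq_square)
  also have "\<dots> \<le> ((\<Sum>m\<in>S. 1 / real m) ^ (2 ^ j)) ^ 2"
    by (rule power_mono) (use Suc in \<open>auto simp: f_def intro!: sum_nonneg\<close>)
  also have "\<dots> = (\<Sum>m\<in>S. 1 / real m) ^ (2 ^ Suc j)" by (simp add: power_mult[symmetric] mult.commute)
  finally show ?case .
qed simp

text \<open>Opening one \<open>tau\<close> writes u = x y. If u \<ge> b^2, one of the factors is at
  least b; with the other one fixed and prime to p, it runs through a single residue class, and
  induction applies. The threshold is squared and the constant doubled at each step. Of the 2^j sums
  over \<open>S\<close> that result, one is replaced by the bound \<open>K\<close> for a residue
  class.\<close>

lemma sum_tau_congruence: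
  fixes B K :: real
  assumes S: "divisor_closed S" and p: "prime p" and B: "B \<ge> 1"
    and K: "\<And>a. (\<Sum>u | u \<in> S \<and> B \<le> real u \<and> [u = a] (mod p). 1 / real u) \<le> K"
  shows "(\<Sum>u | u \<in> S \<and> B ^ (2 ^ j) \<le> real u \<and> [u = a] (mod p) \<and> \<not> p dvd u. real (tau u) ^ j / real u)
    \<le> 2 ^ j * (\<Sum>m\<in>S. 1 / real m) ^ (2 ^ j - 1) * K"
proof (induction j arbitrary: a)
  case 0
  have "(\<Sum>u | u \<in> S \<and> B \<le> real u \<and> [u = a] (mod p) \<and> \<not> p dvd u. 1 / real u) \<le> (\<Sum>u | u \<in> S \<and> B \<le> real u \<and> [u = a] (mod p). 1 / real u)"
    by (rule sum_mono2) (use divisor_closedD(1)[OF S] in auto)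
  then show ?case using K[of a] by simp
next
  case (Suc j)
  define f where "f = (\<lambda>m. real (tau m) ^ j)"
  define M where "M = (\<Sum>m\<in>S. 1 / real m)"
  define b where "b = B ^ (2 ^ j)"
  have finS: "finite S" using S by (rule divisor_closedD)
  have K0: "K \<ge> 0" using K[of 0] by (rule order_trans[rotated]) (rule sum_nonneg, simp)
  have M0: "M \<ge> 0" unfolding M_def by (rule sum_nonneg) simp
  have b0: "b > 0" unfolding b_def using B by simp
  have bb: "B ^ (2 ^ Suc j) = b * b" by (simp add: b_def power_mult power2_eq_square mult.commute[of 2])
  define T where "T = {u \<in> S. B ^ (2 ^ Suc j) \<le> real u \<and> [u = a] (mod p) \<and> \<not> p dvd u}"
  define T' where "T' = {(x, y). (x, y) \<in> S \<times> S \<and> b \<le> real x \<and> [x * y = a] (mod p) \<and> \<not> p dvd x \<and> \<not> p dvd y}"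
  define g where "g = (\<lambda>(x, y). (f x / real x) * (f y / real y))"
  have g0: "g z \<ge> 0" for z by (cases z) (simp add: g_def f_def)
  have finT': "finite T'" by (rule finite_subset[of _ "S \<times> S"]) (use finS in \<open>auto simp: T'_def\<close>)
  have "(\<Sum>u\<in>T. real (tau u) ^ Suc j / real u) = (\<Sum>u\<in>T. real (tau u) * f u / real u)" by (simp add: f_def)
  also have "\<dots> \<le> (\<Sum>(x, y) | (x, y) \<in> S \<times> S \<and> x * y \<in> T. (f x / real x) * (f y / real y))"
    by (rule sum_tau_open[OF S]) (auto simp: f_def tau_power_mult_le T_def)
  also have "\<dots> = sum g {(x, y). (x, y) \<in> S \<times> S \<and> x * y \<in> T}" by (simp add: g_def)
  also have "\<dots> \<le> sum g (T' \<union> prod.swap ` T')"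
  proof (rule sum_mono2)
    show "{(x, y). (x, y) \<in> S \<times> S \<and> x * y \<in> T} \<subseteq> T' \<union> prod.swap ` T'"
    proof
      fix z assume "z \<in> {(x, y). (x, y) \<in> S \<times> S \<and> x * y \<in> T}"
      then obtain x y where z: "z = (x, y)" "x \<in> S" "y \<in> S" "x * y \<in> T" by auto
      have xy: "b * b \<le> real x * real y" "[x * y = a] (mod p)" "\<not> p dvd x" "\<not> p dvd y"
        using z(4) unfolding T_def bb by auto
      have "b \<le> real x \<or> b \<le> real y"
      proof (rule ccontr)
        assume "\<not> (b \<le> real x \<or> b \<le> real y)"
        then have "real x * real y < b * b" using b0 by (intro mult_strict_mono) auto
        then show False using xy(1) by simp
      qed
      then show "z \<in> T' \<union> prod.swap ` T'"
      proof
        assume "b \<le> real x"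
        then have "z \<in> T'" using z xy by (simp add: T'_def)
        then show ?thesis by simp
      next
        assume "b \<le> real y"
        then have "(y, x) \<in> T'" using z xy by (simp add: T'_def mult.commute)
        then have "prod.swap (y, x) \<in> prod.swap ` T'" by (rule imageI)
        then show ?thesis using z(1) by simp
      qed
    qed
  qed (use finT' g0 in auto)
  also have "\<dots> \<le> sum g T' + sum g (prod.swap ` T')"
  proof -
    have "0 \<le> sum g (T' \<inter> prod.swap ` T')" by (rule sum_nonneg) (rule g0)
    then show ?thesis using sum.union_inter[of T' "prod.swap ` T'" g] finT' by simp
  qed
  also have "sum g (prod.swap ` T') = sum g T'"
  proof -
    have "sum g (prod.swap ` T') = (\<Sum>z\<in>T'. g (prod.swap z))"
      by (subst sum.reindex) (auto intro: inj_on_subset[OF inj_swap])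
    also have "\<dots> = sum g T'" by (rule sum.cong) (auto simp: g_def mult.commute)
    finally show ?thesis .
  qed
  also have "sum g T' \<le> M ^ (2 ^ j) * (2 ^ j * M ^ (2 ^ j - 1) * K)"
  proof -
    define H where "H = (\<lambda>y. {x \<in> S. b \<le> real x \<and> [x * y = a] (mod p) \<and> \<not> p dvd x})"
    have "sum g T' = (\<Sum>y | y \<in> S \<and> \<not> p dvd y. \<Sum>x\<in>H y. (f x / real x) * (f y / real y))"
    proof -
      have "(\<Sum>y | y \<in> S \<and> \<not> p dvd y. \<Sum>x\<in>H y. (f x / real x) * (f y / real y))
        = (\<Sum>(y, x)\<in>Sigma {y \<in> S. \<not> p dvd y} H. (f x / real x) * (f y / real y))"
        by (rule sum.Sigma) (use finS in \<open>auto simp: H_def\<close>)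
      also have "\<dots> = sum g T'"
        by (rule sum.reindex_bij_witness[where i = prod.swap and j = prod.swap]) (auto simp: T'_def H_def g_def)
      finally show ?thesis by simp
    qed
    also have "\<dots> = (\<Sum>y | y \<in> S \<and> \<not> p dvd y. (f y / real y) * (\<Sum>x\<in>H y. f x / real x))"
      by (simp add: sum_distrib_left mult.commute)
    also have "\<dots> \<le> (\<Sum>y | y \<in> S \<and> \<not> p dvd y. (f y / real y) * (2 ^ j * M ^ (2 ^ j - 1) * K))"
    proof (rule sum_mono, rule mult_left_mono)
      fix y assume y: "y \<in> {y \<in> S. \<not> p dvd y}"
      show "(\<Sum>x\<in>H y. f x / real x) \<le> 2 ^ j * M ^ (2 ^ j - 1) * K"
      proof (cases "H y = {}")
        case True
        then show ?thesis using K0 M0 by simp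
      next
        case False
        \<comment> \<open>Any one solution serves as representative of the class a / y; cancelling y
          puts all other solutions in its class.\<close>
        then obtain x0 where x0: "[x0 * y = a] (mod p)" by (auto simp: H_def)
        have cop: "coprime y p" using y p by (subst coprime_commute) (auto intro: prime_imp_coprime)
        have "H y \<subseteq> {u \<in> S. b \<le> real u \<and> [u = x0] (mod p) \<and> \<not> p dvd u}"
        proof
          fix x assume x: "x \<in> H y"
          then have "[x * y = a] (mod p)" by (simp add: H_def)
          then have "[x * y = x0 * y] (mod p)" using x0 by (metis cong_trans cong_sym)
          then have "[x = x0] (mod p)" using cop by (simp only: cong_mult_rcancel_nat)
          then show "x \<in> {u \<in> S. b \<le> real u \<and> [u = x0] (mod p) \<and> \<not> p dvd u}" using x by (simp add: H_def)
        qed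
        then have "(\<Sum>x\<in>H y. f x / real x) \<le> (\<Sum>x | x \<in> S \<and> b \<le> real x \<and> [x = x0] (mod p) \<and> \<not> p dvd x. f x / real x)"
          by (intro sum_mono2) (use finS in \<open>auto simp: f_def\<close>)
        also have "\<dots> \<le> 2 ^ j * M ^ (2 ^ j - 1) * K" using Suc.IH[of x0] by (simp add: f_def b_def M_def)
        finally show ?thesis .
      qed
    qed (simp add: f_def)
    also have "\<dots> = (\<Sum>y | y \<in> S \<and> \<not> p dvd y. f y / real y) * (2 ^ j * M ^ (2 ^ j - 1) * K)"
      by (simp only: sum_distrib_right)
    also have "\<dots> \<le> M ^ (2 ^ j) * (2 ^ j * M ^ (2 ^ j - 1) * K)"
    proof (rule mult_right_mono)
      have "(\<Sum>y | y \<in> S \<and> \<not> p dvd y. f y / real y) \<le> (\<Sum>y\<in>S. f y / real y)"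
        by (rule sum_mono2) (use finS in \<open>auto simp: f_def\<close>)
      also have "\<dots> \<le> M ^ (2 ^ j)" using sum_tau_power_le[OF S, of j] by (simp add: f_def M_def)
      finally show "(\<Sum>y | y \<in> S \<and> \<not> p dvd y. f y / real y) \<le> M ^ (2 ^ j)" .
    qed (use K0 M0 in simp)
    finally show ?thesis .
  qed
  finally have "(\<Sum>u\<in>T. real (tau u) ^ Suc j / real u) \<le> 2 * (M ^ (2 ^ j) * (2 ^ j * M ^ (2 ^ j - 1) * K))" by (simp only: mult_2)
  also have "\<dots> = 2 ^ Suc j * (M ^ (2 ^ j) * M ^ (2 ^ j - 1)) * K" by simp
  also have "M ^ (2 ^ j) * M ^ (2 ^ j - 1) = M ^ (2 ^ Suc j - 1)"
  proof -
    have "(2::nat) ^ j \<ge> 1" by simp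
    then have "(2::nat) ^ j + (2 ^ j - 1) = 2 ^ Suc j - 1" by simp
    then show ?thesis by (simp only: power_add[symmetric])
  qed
  finally show ?case by (simp only: T_def M_def)
qed

section \<open>Reciprocal sums over smooth numbers, also in residue classes\<close>

definition smooth_upto :: "nat \<Rightarrow> nat \<Rightarrow> nat set" where
  "smooth_upto y X = {m. 0 < m \<and> m \<le> X \<and> (\<forall>p. prime p \<and> p dvd m \<longrightarrow> p \<le> y)}"

lemma finite_smooth_upto [simp]: "finite (smooth_upto y X)"
  by (rule finite_subset[of _ "{..X}"]) (auto simp: smooth_upto_def)

lemma divisor_closed_smooth: "divisor_closed (smooth_upto y X)"
  unfolding divisor_closed_def
proof (intro conjI ballI allI impI)
  fix m d assume m: "m \<in> smooth_upto y X"
  then show "m > 0" by (simp add: smooth_upto_def)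
  assume d: "d dvd m"
  have "d \<le> m" using d \<open>m > 0\<close> by (rule dvd_imp_le)
  moreover have "d > 0" using d \<open>m > 0\<close> by (auto intro: gr0I)
  moreover have "p \<le> y" if "prime p" "p dvd d" for p
    using m that d dvd_trans unfolding smooth_upto_def by blast
  ultimately show "d \<in> smooth_upto y X" using m by (simp add: smooth_upto_def)
qed simp

lemma smooth_prime_factors: "m \<in> smooth_upto y X \<Longrightarrow> m > 0 \<and> prime_factors m \<subseteq> primes_le y"
  by (auto simp: smooth_upto_def in_prime_factors_iff)

text \<open>The cutoff \<open>X\<close> serves finiteness alone; this bound and the later ones are
  uniform in it.\<close>

lemma smooth_sum_le:
  obtains C where "C > 0" "\<And>y X. y \<ge> 2 \<Longrightarrow> (\<Sum>m\<in>smooth_upto y X. 1 / real m) \<le> C * ln (real y)"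
proof -
  obtain C where C: "C > 0" "\<And>n. n \<ge> 2 \<Longrightarrow> Euler_prod (primes_le n) \<le> C * ln (real n)"
    using Mertens_third_upper by blast
  have "(\<Sum>m\<in>smooth_upto y X. 1 / real m) \<le> C * ln (real y)" if "y \<ge> 2" for y X
  proof -
    have "(\<Sum>m\<in>smooth_upto y X. 1 / real m) \<le> Euler_prod (primes_le y)"
    proof (rule Euler_product_upper)
      fix p assume "p \<in> primes_le y"
      then have "p > 1" using prime_gt_1_nat by blast
      then show "1 / real p < 1" by simp
    qed (use smooth_prime_factors in auto)
    also have "\<dots> \<le> C * ln (real y)" by (rule C(2)[OF that])
    finally show ?thesis .
  qed
  then show ?thesis using that C(1) by blast
qed

lemma harmonic_le: "(\<Sum>k\<in>{1..n}. 1 / real k) \<le> 1 + ln (real n)" if "n \<ge> 1"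
  using that
proof (induction n rule: dec_induct)
  case (step n)
  have "1 / real (Suc n) \<le> ln (real (Suc n)) - ln (real n)"
  proof -
    have "ln (real n / real (Suc n)) \<le> real n / real (Suc n) - 1"
      by (rule ln_le_minus_one) (use step in auto)
    moreover have "ln (real n / real (Suc n)) = ln (real n) - ln (real (Suc n))"
      by (rule ln_divide_pos) (use step in auto)
    moreover have "real n / real (Suc n) - 1 = - (1 / real (Suc n))" by (simp add: field_simps)
    ultimately show ?thesis by linarith
  qed
  then show ?case using step by simp
qed simp

text \<open>Rankin's trick: for m \<ge> T and \<sigma> = 1 / ln y, the term 1/m is at most
  T^(-\<sigma>) m^(\<sigma> - 1), and the shifted sum is still O(ln y).\<close>

lemma smooth_tail:
  obtains C where "C > 0" "\<And>y S T. y \<ge> (8::nat) \<Longrightarrow> finite S \<Longrightarrow> S \<subseteq> {m. m > 0 \<and> prime_factors m \<subseteq> primes_le y} \<Longrightarrow>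
     (\<And>m. m \<in> S \<Longrightarrow> T \<le> real m) \<Longrightarrow> T > 0 \<Longrightarrow> (\<Sum>m\<in>S. 1 / real m) \<le> C * ln (real y) * T powr (- (1 / ln (real y)))"
proof -
  obtain C where C: "C > 0" "\<And>y S. y \<ge> (8::nat) \<Longrightarrow> finite S \<Longrightarrow> (\<And>m. m \<in> S \<Longrightarrow> m > 0 \<and> prime_factors m \<subseteq> primes_le y) \<Longrightarrow>
    (\<Sum>m\<in>S. real m powr (- 1 + 1 / ln (real y))) \<le> C * ln (real y)"
    using smooth_sum_Rankin by blast
  have "(\<Sum>m\<in>S. 1 / real m) \<le> C * ln (real y) * T powr (- (1 / ln (real y)))"
    if y: "y \<ge> (8::nat)" and S: "finite S" "S \<subseteq> {m. m > 0 \<and> prime_factors m \<subseteq> primes_le y}"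
      and T: "\<And>m. m \<in> S \<Longrightarrow> T \<le> real m" "T > 0" for y S T
  proof -
    define \<sigma> where "\<sigma> = 1 / ln (real y)"
    have \<sigma>: "\<sigma> > 0" using y by (simp add: \<sigma>_def)
    have "(\<Sum>m\<in>S. 1 / real m) \<le> (\<Sum>m\<in>S. T powr - \<sigma> * real m powr (- 1 + \<sigma>))"
    proof (rule sum_mono)
      fix m assume m: "m \<in> S"
      have m0: "m > 0" using m S by auto
      have "real m powr - \<sigma> \<le> T powr - \<sigma>" by (rule powr_mono2') (use T m \<sigma> in auto)
      then have "real m powr - \<sigma> * real m powr (- 1 + \<sigma>) \<le> T powr - \<sigma> * real m powr (- 1 + \<sigma>)"
        by (rule mult_right_mono) simp
      moreover have "real m powr - \<sigma> * real m powr (- 1 + \<sigma>) = real m powr (- \<sigma> + (- 1 + \<sigma>))"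
        by (rule powr_add[symmetric])
      then have "real m powr - \<sigma> * real m powr (- 1 + \<sigma>) = 1 / real m"
        using m0 by (simp add: powr_minus inverse_eq_divide)
      ultimately show "1 / real m \<le> T powr - \<sigma> * real m powr (- 1 + \<sigma>)" by simp
    qed
    also have "\<dots> = T powr - \<sigma> * (\<Sum>m\<in>S. real m powr (- 1 + \<sigma>))" by (simp add: sum_distrib_left)
    also have "\<dots> \<le> T powr - \<sigma> * (C * ln (real y))"
      unfolding \<sigma>_def by (rule mult_left_mono[OF C(2)]) (use y S in auto)
    finally show ?thesis by (simp add: \<sigma>_def mult_ac)
  qed
  then show ?thesis using that C(1) by blast
qed

text \<open>The class is cut at p and at T = p^(ln y). Below p it has at most one element, which is
  at least B. Between p and T smoothness is ignored and the progression gives a harmonic sum, O(ln T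
  / p). Beyond T the congruence is ignored: the smooth tail gains T^(-1 / ln y) = 1/p. Since B \<le>
  p, every part is at most its numerator over B.\<close>

lemma smooth_congruence_sum:
  obtains C where "C > 0" "\<And>y X p B a. y \<ge> 8 \<Longrightarrow> prime p \<Longrightarrow> 1 \<le> B \<Longrightarrow> B \<le> real p \<Longrightarrow>
    (\<Sum>u | u \<in> smooth_upto y X \<and> B \<le> real u \<and> [u = a] (mod p). 1 / real u) \<le> C * ln (real y) * (1 + ln (real p)) / B"
proof -
  obtain C where C: "C > 0" "\<And>y S T. y \<ge> (8::nat) \<Longrightarrow> finite S \<Longrightarrow> S \<subseteq> {m. m > 0 \<and> prime_factors m \<subseteq> primes_le y} \<Longrightarrow>
     (\<And>m. m \<in> S \<Longrightarrow> T \<le> real m) \<Longrightarrow> T > 0 \<Longrightarrow> (\<Sum>m\<in>S. 1 / real m) \<le> C * ln (real y) * T powr (- (1 / ln (real y)))"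
    using smooth_tail by blast
  have main: "(\<Sum>u | u \<in> smooth_upto y X \<and> B \<le> real u \<and> [u = a] (mod p). 1 / real u) \<le> (C + 3) * ln (real y) * (1 + ln (real p)) / B"
    if y: "y \<ge> 8" and p: "prime p" and B: "1 \<le> B" "B \<le> real p" for y X p B a
  proof -
    define L where "L = ln (real y)"
    have L1: "L \<ge> 1" unfolding L_def using y exp_le by (subst ln_ge_iff) auto
    have p2: "p \<ge> 2" using p by (rule prime_ge_2_nat)
    have lp: "ln (real p) > 0" using p2 by simp
    define U where "U = {u \<in> smooth_upto y X. B \<le> real u \<and> [u = a] (mod p)}"
    define T where "T = exp (L * ln (real p))"
    have finU: "finite U" by (simp add: U_def)
    define U1 U2 U3 where "U1 = {u \<in> U. u < p}" and "U2 = {u \<in> U. p \<le> u \<and> real u \<le> T}" and "U3 = {u \<in> U. T \<le> real u}"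
    have "(\<Sum>u\<in>U. 1 / real u) \<le> (\<Sum>u\<in>U1 \<union> U2 \<union> U3. 1 / real u)"
      by (rule sum_mono2) (use finU in \<open>auto simp: U1_def U2_def U3_def\<close>)
    also have "\<dots> \<le> (\<Sum>u\<in>U1. 1 / real u) + (\<Sum>u\<in>U2. 1 / real u) + (\<Sum>u\<in>U3. 1 / real u)"
    proof -
      have fin: "finite U1" "finite U2" "finite U3" using finU by (auto simp: U1_def U2_def U3_def)
      have un: "(\<Sum>u\<in>A \<union> A'. 1 / real u) \<le> (\<Sum>u\<in>A. 1 / real u) + (\<Sum>u\<in>A'. 1 / real u)"
        if "finite A" "finite A'" for A A' :: "nat set"
        using sum.union_inter[OF that, of "\<lambda>u. 1 / real u"] sum_nonneg[of "A \<inter> A'" "\<lambda>u. 1 / real u"] by simp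
      show ?thesis using un[of "U1 \<union> U2" U3] un[of U1 U2] fin by simp
    qed
    also have "(\<Sum>u\<in>U1. 1 / real u) \<le> 1 / B"
    proof -
      have "(\<Sum>u\<in>U1. 1 / real u) \<le> (\<Sum>u\<in>{a mod p}. 1 / B)"
      proof (rule sum_le_included[where i = "\<lambda>u. u"])
        show "\<forall>s\<in>U1. \<exists>t\<in>{a mod p}. t = s \<and> 1 / real s \<le> 1 / B"
        proof
          fix u assume u: "u \<in> U1"
          then have "u = a mod p" "B \<le> real u" by (auto simp: U1_def U_def cong_def)
          then show "\<exists>t\<in>{a mod p}. t = u \<and> 1 / real u \<le> 1 / B"
            using B(1) frac_le[of 1 1 B "real u"] by auto
        qed
      qed (use finU B in \<open>auto simp: U1_def\<close>)
      then show ?thesis by simp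
    qed
    also have "(\<Sum>u\<in>U2. 1 / real u) \<le> (1 + L * ln (real p)) / real p"
    proof -
      define n where "n = nat \<lfloor>T\<rfloor>"
      have T1: "T \<ge> 1" using L1 lp by (simp add: T_def)
      have n1: "n \<ge> 1" unfolding n_def using T1 by (simp add: le_nat_iff le_floor_iff)
      have nT: "real n \<le> T" unfolding n_def using T1 by simp
      have "(\<Sum>u\<in>U2. 1 / real u) \<le> (\<Sum>k\<in>{1..n}. 1 / (real k * real p))"
      proof (rule sum_le_included[where i = "\<lambda>k. a mod p + k * p"])
        show "\<forall>s\<in>U2. \<exists>t\<in>{1..n}. a mod p + t * p = s \<and> 1 / real s \<le> 1 / (real t * real p)"
        proof
          fix u assume u: "u \<in> U2"
          then have um: "u mod p = a mod p" "p \<le> u" "real u \<le> T" by (auto simp: U2_def U_def cong_def)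
          define k where "k = u div p"
          have k1: "k \<ge> 1" using um(2) p2 by (simp add: k_def Suc_le_eq div_greater_zero_iff)
          have "u \<le> n" unfolding n_def using um(3) by (simp add: le_nat_iff le_floor_iff)
          then have kn: "k \<le> n" unfolding k_def by (meson div_le_dividend le_trans)
          have uk: "a mod p + k * p = u" unfolding k_def um(1)[symmetric] by simp
          then have "k * p \<le> u" by linarith
          then have "real (k * p) \<le> real u" by (rule of_nat_mono)
          then have "1 / real u \<le> 1 / (real k * real p)"
            using k1 p2 by (intro frac_le) auto
          then show "\<exists>t\<in>{1..n}. a mod p + t * p = u \<and> 1 / real u \<le> 1 / (real t * real p)"
            using k1 kn uk by (intro bexI[of _ k]) auto
        qed
      qed (use finU in \<open>auto simp: U2_def\<close>)
      also have "\<dots> = (\<Sum>k\<in>{1..n}. 1 / real k) / real p" by (simp add: sum_divide_distrib)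
      also have "\<dots> \<le> (1 + ln (real n)) / real p"
        by (rule divide_right_mono[OF harmonic_le[OF n1]]) simp
      also have "ln (real n) \<le> ln T" using nT n1 by (intro ln_mono) auto
      also have "ln T = L * ln (real p)" by (simp add: T_def)
      finally show ?thesis by (simp add: divide_right_mono)
    qed
    also have "(\<Sum>u\<in>U3. 1 / real u) \<le> C * L / real p"
    proof -
      have "(\<Sum>u\<in>U3. 1 / real u) \<le> C * ln (real y) * T powr (- (1 / ln (real y)))"
        by (rule C(2)) (use y finU smooth_prime_factors in \<open>auto simp: U3_def U_def T_def\<close>)
      also have "T powr (- (1 / ln (real y))) = 1 / real p"
        using L1 p2 by (simp add: T_def L_def[symmetric] powr_def exp_minus inverse_eq_divide)
      finally show ?thesis by (simp add: L_def)
    qed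
    finally have "(\<Sum>u\<in>U. 1 / real u) \<le> 1 / B + (1 + L * ln (real p)) / real p + C * L / real p" by simp
    also have "\<dots> \<le> 1 / B + (1 + L * ln (real p)) / B + C * L / B"
      using B L1 lp C(1) by (intro add_mono divide_left_mono) auto
    also have "\<dots> = (2 + L * ln (real p) + C * L) / B" by (simp add: add_divide_distrib)
    also have "\<dots> \<le> ((C + 3) * L * (1 + ln (real p))) / B"
    proof (rule divide_right_mono)
      have "2 \<le> 3 * L" using L1 by simp
      moreover have "0 \<le> C * (L * ln (real p))" "0 \<le> L * ln (real p)" using C(1) L1 lp by auto
      ultimately show "2 + L * ln (real p) + C * L \<le> (C + 3) * L * (1 + ln (real p))"
        by (simp add: algebra_simps)
    qed (use B in simp)
    finally show ?thesis by (simp add: U_def L_def)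
  qed
  have "C + 3 > 0" using C(1) by simp
  then show ?thesis by (rule that[OF _ main])
qed

lemma card_multiples_le:
  fixes d x :: nat
  assumes "d > 0"
  shows "real (card {n \<in> {1..x}. d dvd n}) \<le> real x / real d"
proof -
  have "{n \<in> {1..x}. d dvd n} \<subseteq> (\<lambda>k. d * k) ` {1..x div d}"
  proof
    fix n assume "n \<in> {n \<in> {1..x}. d dvd n}"
    then obtain k where k: "n = d * k" "n \<in> {1..x}" by auto
    then have "k \<ge> 1" "k \<le> x div d"
      using assms by (auto simp: less_eq_div_iff_mult_less_eq mult.commute Suc_le_eq)
    then show "n \<in> (\<lambda>k. d * k) ` {1..x div d}" using k(1) by auto
  qed
  then have "card {n \<in> {1..x}. d dvd n} \<le> card {1..x div d}" by (rule surj_card_le[rotated]) simp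
  then have "real (card {n \<in> {1..x}. d dvd n}) \<le> real (x div d)" by simp
  also have "\<dots> \<le> real x / real d" by (rule of_nat_div_le_of_nat)
  finally show ?thesis .
qed

text \<open>The shift by 3 makes 2^(i + 3) at least 8, as Rankin's bound requires, and above every q
  of the block [2^i, 2^(i + 1)), while the logarithm remains O(i).\<close>

lemma ln_smoothness_le: "ln (real (2 ^ (i + 3))) \<le> 4 * real i" if "i \<ge> 1"
proof -
  have "ln (real (2 ^ (i + 3))) = real (i + 3) * ln 2" by (simp only: of_nat_power of_nat_numeral ln_realpow)
  also have "\<dots> \<le> real (i + 3) * 1" using ln_2_less_1 by (intro mult_left_mono) auto
  also have "\<dots> \<le> 4 * real i" using that by simp
  finally show ?thesis .
qed

section \<open>Pairs of divisors congruent modulo a prime\<close>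

definition congruent_pairs :: "nat \<Rightarrow> nat \<Rightarrow> (nat \<times> nat) set" where
  "congruent_pairs p m = {(d, d'). d dvd m \<and> d' dvd m \<and> d' < d \<and> [d = d'] (mod p) \<and> \<not> p dvd d}"

text \<open>With g = gcd (d, d'), d = g u and d' = g u', the product g u u' divides m, so m = g v u'
  u. As g is invertible modulo p, u and u' are congruent, and u' < u forces u \<ge> p. Thus u runs
  over large elements of a class fixed by u' and \<open>sum_tau_congruence\<close> applies. Three
  free sums of exponent 2^j and one of exponent 2^j - 1 give 2^(j + 2) - 1.\<close>

lemma sum_tau_congruent_pairs:
  fixes B K :: real
  assumes S: "divisor_closed S" and p: "prime p" and B: "B \<ge> 1" "B ^ (2 ^ j) \<le> real p"
    and K: "\<And>a. (\<Sum>u | u \<in> S \<and> B \<le> real u \<and> [u = a] (mod p). 1 / real u) \<le> K"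
  shows "(\<Sum>m\<in>S. real (tau m) ^ j / real m * real (card (congruent_pairs p m)))
    \<le> 2 ^ j * (\<Sum>m\<in>S. 1 / real m) ^ (2 ^ (j + 2) - 1) * K"
proof -
  define f where "f = (\<lambda>m. real (tau m) ^ j / real m)"
  define M where "M = (\<Sum>m\<in>S. 1 / real m)"
  have finS: "finite S" and posS: "\<And>m. m \<in> S \<Longrightarrow> m > 0" using divisor_closedD[OF S] by auto
  have K0: "K \<ge> 0" using K[of 0] by (rule order_trans[rotated]) (rule sum_nonneg, simp)
  have M0: "M \<ge> 0" unfolding M_def by (rule sum_nonneg) simp
  have f0: "f m \<ge> 0" for m by (simp add: f_def)
  have fmult: "f (a * b) \<le> f a * f b" if "a > 0" "b > 0" for a b
    using tau_power_mult_le[OF that, of j] that by (simp add: f_def divide_right_mono)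
  have fin_cp: "finite (congruent_pairs p m)" if "m > 0" for m
    by (rule finite_subset[of _ "{d. d dvd m} \<times> {d. d dvd m}"]) (use that in \<open>auto simp: congruent_pairs_def\<close>)
  define U where "U = (\<lambda>u'. {u \<in> S. B ^ (2 ^ j) \<le> real u \<and> [u = u'] (mod p) \<and> \<not> p dvd u})"
  define Q where "Q = Sigma (S \<times> S \<times> S) (\<lambda>(g, v, u'). U u')"
  define F where "F = (\<lambda>((g, v, u'), u). f g * f v * f u' * f u)"
  have finQ: "finite Q" unfolding Q_def by (rule finite_SigmaI) (use finS in \<open>auto simp: U_def\<close>)
  have "(\<Sum>m\<in>S. f m * real (card (congruent_pairs p m))) = (\<Sum>m\<in>S. \<Sum>z\<in>congruent_pairs p m. f m)"
    by (simp add: mult.commute)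
  also have "\<dots> = (\<Sum>(m, z)\<in>Sigma S (congruent_pairs p). f m)"
    by (rule sum.Sigma) (use finS posS fin_cp in auto)
  also have "\<dots> \<le> sum F Q"
  \<comment> \<open>Each triple (m, d, d') can be recovered from its quadruple of factors, so the
    sum over triples is bounded by that over all quadruples in \<open>Q\<close>.\<close>
  proof (rule sum_le_included[where i = "\<lambda>((g, v, u'), u). (g * v * u' * u, (g * u, g * u'))"])
    show "finite (Sigma S (congruent_pairs p))" by (rule finite_SigmaI) (use finS posS fin_cp in auto)
    show "\<forall>t\<in>Q. 0 \<le> F t" by (auto simp: F_def f0 split: prod.splits)
    show "\<forall>s\<in>Sigma S (congruent_pairs p). \<exists>t\<in>Q. (case t of (x, xa) \<Rightarrow> (case x of (g, v, u') \<Rightarrow> \<lambda>u. (g * v * u' * u, g * u, g * u')) xa) = s \<and> (case s of (m, z) \<Rightarrow> f m) \<le> F t"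
    proof
      fix s assume s: "s \<in> Sigma S (congruent_pairs p)"
      then obtain m d d' where s_eq: "s = (m, (d, d'))" by (metis surj_pair)
      have m: "m \<in> S" "m > 0" "d dvd m" "d' dvd m" "d' < d" "[d = d'] (mod p)" "\<not> p dvd d"
        using s posS unfolding s_eq congruent_pairs_def by auto
      have d'0: "d' > 0" using m by (auto intro: gr0I)
      define g u u' where "g = gcd d d'" and "u = d div g" and "u' = d' div g"
      have g0: "g > 0" unfolding g_def using d'0 by simp
      have d: "d = g * u" "d' = g * u'" by (simp_all add: g_def u_def u'_def)
      have u0: "u > 0" "u' > 0" using d m(5) d'0 by (auto intro: gr0I)
      have cop: "coprime u u'" unfolding u_def u'_def g_def using d'0 by (intro div_gcd_coprime) auto
      \<comment> \<open>g u u' is the least common multiple of d and d'.\<close>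
      have "g * (u * u') dvd m"
      proof -
        have "u * u' dvd m div g"
        proof (rule divides_mult)
          show "u dvd m div g" "u' dvd m div g" using m(3,4) g0 unfolding d
            by (metis dvd_mult_div_cancel dvd_mult_left nat_mult_dvd_cancel_disj not_gr_zero)+
        qed (rule cop)
        moreover have "g dvd m" using m(3) d(1) by (metis dvd_mult_left)
        ultimately show ?thesis by (metis dvd_div_mult_self mult.commute mult_dvd_mono dvd_refl)
      qed
      then obtain v where v: "m = g * (u * u') * v" by (elim dvdE)
      have v0: "v > 0" using v m(2) by (auto intro: gr0I)
      have meq: "g * v * u' * u = m" using v by (simp add: mult_ac)
      have inS: "g \<in> S" "v \<in> S" "u' \<in> S" "u \<in> S"
        by (rule divisor_closedD(3)[OF S m(1)], use meq in \<open>auto simp: dvd_def mult_ac\<close>)+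
      have pu: "\<not> p dvd u" "\<not> p dvd g" using m(7) d(1) by auto
      have "coprime g p" using pu(2) p by (subst coprime_commute) (auto intro: prime_imp_coprime)
      then have cong: "[u = u'] (mod p)" using m(6) unfolding d by (simp add: cong_mult_lcancel_nat)
      have "u' < u" using m(5) g0 unfolding d by simp
      then have "p \<le> u"
      proof -
        have "p dvd u - u'" using cong \<open>u' < u\<close> by (metis cong_altdef_nat less_imp_le)
        then have "p \<le> u - u'" using \<open>u' < u\<close> by (intro dvd_imp_le) auto
        then show ?thesis by linarith
      qed
      then have "B ^ (2 ^ j) \<le> real u" using B(2) by (meson of_nat_mono order_trans)
      then have t: "((g, v, u'), u) \<in> Q" using inS cong pu by (simp add: Q_def U_def)
      have "f m = f (g * v * u' * u)" by (simp only: meq)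
      also have "\<dots> \<le> f (g * v * u') * f u" by (rule fmult) (use g0 v0 u0 in auto)
      also have "\<dots> \<le> f (g * v) * f u' * f u" by (rule mult_right_mono[OF fmult f0]) (use g0 v0 u0 in auto)
      also have "\<dots> \<le> f g * f v * f u' * f u"
        by (intro mult_right_mono fmult f0) (use g0 v0 in auto)
      finally have "f m \<le> F ((g, v, u'), u)" by (simp add: F_def)
      then show "\<exists>t\<in>Q. (case t of (x, xa) \<Rightarrow> (case x of (g, v, u') \<Rightarrow> \<lambda>u. (g * v * u' * u, g * u, g * u')) xa) = s \<and> (case s of (m, z) \<Rightarrow> f m) \<le> F t"
        using t s_eq meq d by (intro bexI[of _ "((g, v, u'), u)"]) auto
    qed
  qed (rule finQ)
  also have "sum F Q = (\<Sum>(g, v, u')\<in>S \<times> S \<times> S. \<Sum>u\<in>U u'. f g * f v * f u' * f u)"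
    unfolding Q_def F_def by (subst sum.Sigma[symmetric]) (use finS in \<open>auto simp: U_def split_def\<close>)
  also have "\<dots> \<le> (\<Sum>(g, v, u')\<in>S \<times> S \<times> S. f g * f v * f u' * (2 ^ j * M ^ (2 ^ j - 1) * K))"
  proof (rule sum_mono)
    fix z assume "z \<in> S \<times> S \<times> S"
    obtain g v u' where z: "z = (g, v, u')" by (metis surj_pair)
    have "(\<Sum>u\<in>U u'. f u) \<le> 2 ^ j * M ^ (2 ^ j - 1) * K"
      using sum_tau_congruence[OF S p B(1) K, of j u'] by (simp add: U_def f_def M_def)
    then have "f g * f v * f u' * (\<Sum>u\<in>U u'. f u) \<le> f g * f v * f u' * (2 ^ j * M ^ (2 ^ j - 1) * K)"
      by (intro mult_left_mono) (use f0 in auto)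
    then show "(case z of (g, v, u') \<Rightarrow> \<Sum>u\<in>U u'. f g * f v * f u' * f u) \<le> (case z of (g, v, u') \<Rightarrow> f g * f v * f u' * (2 ^ j * M ^ (2 ^ j - 1) * K))"
      by (simp add: z sum_distrib_left)
  qed
  also have "\<dots> = sum f S * (sum f S * sum f S) * (2 ^ j * M ^ (2 ^ j - 1) * K)"
  proof -
    have "sum f S * (sum f S * sum f S) = (\<Sum>g\<in>S. \<Sum>z\<in>S \<times> S. f g * (f (fst z) * f (snd z)))"
      unfolding sum_product[of f S f S] sum.cartesian_product sum_product[of f S] split_def ..
    also have "\<dots> = (\<Sum>x\<in>S \<times> S \<times> S. f (fst x) * (f (fst (snd x)) * f (snd (snd x))))"
      unfolding sum.cartesian_product split_def ..
    finally show ?thesis by (simp add: sum_distrib_right split_def mult.assoc)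
  qed
  also have "\<dots> \<le> M ^ (2 ^ j) * (M ^ (2 ^ j) * M ^ (2 ^ j)) * (2 ^ j * M ^ (2 ^ j - 1) * K)"
  proof -
    have "sum f S \<le> M ^ (2 ^ j)" using sum_tau_power_le[OF S, of j] by (simp add: f_def M_def)
    moreover have "sum f S \<ge> 0" by (rule sum_nonneg) (rule f0)
    ultimately show ?thesis using K0 M0 by (intro mult_right_mono mult_mono) auto
  qed
  also have "\<dots> = 2 ^ j * (M ^ (2 ^ j) * (M ^ (2 ^ j) * M ^ (2 ^ j)) * M ^ (2 ^ j - 1)) * K" by (simp only: mult_ac)
  also have "M ^ (2 ^ j) * (M ^ (2 ^ j) * M ^ (2 ^ j)) * M ^ (2 ^ j - 1) = M ^ (2 ^ (j + 2) - 1)"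
  proof -
    have "(2::nat) ^ j \<ge> 1" by simp
    then have "(2::nat) ^ j + (2 ^ j + 2 ^ j) + (2 ^ j - 1) = 2 ^ (j + 2) - 1" by (simp add: power_add)
    then show ?thesis by (simp only: power_add[symmetric])
  qed
  finally show ?thesis by (simp only: f_def M_def)
qed

section \<open>The singular series averaged over sets of divisors\<close>

definition divisor_sets :: "nat \<Rightarrow> nat \<Rightarrow> nat set set" where
  "divisor_sets j m = {D. D \<subseteq> {d. d dvd m} \<and> card D = j}"

lemma finite_divisor_sets: "m > 0 \<Longrightarrow> finite (divisor_sets j m)"
  by (rule finite_subset[of _ "Pow {d. d dvd m}"]) (auto simp: divisor_sets_def)

lemma card_divisor_sets: "m > 0 \<Longrightarrow> card (divisor_sets j m) \<le> tau m ^ j"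
  unfolding divisor_sets_def tau_def
  by (subst n_subsets, simp, cases "j \<le> card {d. d dvd m}") (auto simp: binomial_le_pow binomial_eq_0)

text \<open>Prescribing two elements leaves j - 2 to be chosen. The two lost factors
  \<open>tau\<close> are what the count of congruent pairs will replace.\<close>

lemma card_divisor_sets_containing:
  assumes "m > 0" "d \<noteq> d'"
  shows "card {D \<in> divisor_sets j m. d \<in> D \<and> d' \<in> D} \<le> tau m ^ (j - 2)"
proof -
  have "card {D \<in> divisor_sets j m. d \<in> D \<and> d' \<in> D} \<le> card (divisor_sets (j - 2) m)"
  proof (rule card_inj_on_le[of "\<lambda>D. D - {d, d'}"])
    show "inj_on (\<lambda>D. D - {d, d'}) {D \<in> divisor_sets j m. d \<in> D \<and> d' \<in> D}"
      by (rule inj_onI) blast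
    show "(\<lambda>D. D - {d, d'}) ` {D \<in> divisor_sets j m. d \<in> D \<and> d' \<in> D} \<subseteq> divisor_sets (j - 2) m"
    proof
      fix E assume "E \<in> (\<lambda>D. D - {d, d'}) ` {D \<in> divisor_sets j m. d \<in> D \<and> d' \<in> D}"
      then obtain D where D: "E = D - {d, d'}" "D \<subseteq> {d. d dvd m}" "card D = j" "{d, d'} \<subseteq> D"
        by (auto simp: divisor_sets_def)
      have "card E = card D - card {d, d'}"
        unfolding D(1) by (rule card_Diff_subset) (use D(4) in auto)
      then show "E \<in> divisor_sets (j - 2) m" using D assms(2) by (auto simp: divisor_sets_def)
    qed
    show "finite (divisor_sets (j - 2) m)" by (rule finite_divisor_sets) fact
  qed
  also have "\<dots> \<le> tau m ^ (j - 2)" by (rule card_divisor_sets) fact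
  finally show ?thesis .
qed

text \<open>If p does not divide m, it divides no member of D, so p can be exceptional only through
  two congruent members. For j = 1 this is impossible. The sets D are then counted by running over
  the congruent pairs.\<close>

lemma card_exceptional_divisor_sets:
  assumes m: "m > 0" and j: "j \<ge> 1"
  shows "real (card {D \<in> divisor_sets j m. p \<in> exceptional D}) \<le>
    (if p dvd m then real (tau m) ^ j else 0) + (if j \<ge> 2 then real (tau m) ^ (j - 2) * real (card (congruent_pairs p m)) else 0)"
proof -
  have fin: "finite (divisor_sets j m)" by (rule finite_divisor_sets) fact
  have fin_cp: "finite (congruent_pairs p m)"
    by (rule finite_subset[of _ "{d. d dvd m} \<times> {d. d dvd m}"]) (use m in \<open>auto simp: congruent_pairs_def\<close>)
  consider "p dvd m" | "\<not> p dvd m" "j = 1" | "\<not> p dvd m" "j \<ge> 2" using j by linarith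
  then show ?thesis
  proof cases
    case 1
    have "card {D \<in> divisor_sets j m. p \<in> exceptional D} \<le> card (divisor_sets j m)"
      by (rule card_mono) (use fin in auto)
    also have "\<dots> \<le> tau m ^ j" by (rule card_divisor_sets) fact
    finally have "real (card {D \<in> divisor_sets j m. p \<in> exceptional D}) \<le> real (tau m ^ j)" by (rule of_nat_mono)
    moreover have "0 \<le> (if j \<ge> 2 then real (tau m) ^ (j - 2) * real (card (congruent_pairs p m)) else 0)" by simp
    ultimately show ?thesis using 1 by (simp only: if_True of_nat_power)
  next
    case 2
    have e: "{D \<in> divisor_sets j m. p \<in> exceptional D} = {}"
    proof -
      have False if D: "D \<in> divisor_sets j m" "p \<in> exceptional D" for D
      proof -
        obtain d where d: "D = {d}" "d dvd m" using D(1) 2(2) by (auto simp: divisor_sets_def card_1_singleton_iff)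
        then have "p dvd d" using D(2) by (auto simp: exceptional_def)
        then show False using d(2) 2(1) dvd_trans by blast
      qed
      then show ?thesis by blast
    qed
    show ?thesis unfolding e using 2 by simp
  next
    case 3
    have "{D \<in> divisor_sets j m. p \<in> exceptional D} \<subseteq>
      (\<Union>z\<in>congruent_pairs p m. {D \<in> divisor_sets j m. fst z \<in> D \<and> snd z \<in> D})"
    proof
      fix D assume D: "D \<in> {D \<in> divisor_sets j m. p \<in> exceptional D}"
      then have Dm: "\<And>d. d \<in> D \<Longrightarrow> d dvd m" by (auto simp: divisor_sets_def)
      then have pd: "\<not> p dvd d" if "d \<in> D" for d using that 3(1) dvd_trans by blast
      obtain d d' where d: "d \<in> D" "d' \<in> D" "d \<noteq> d'" "[d = d'] (mod p)"
        using D pd unfolding exceptional_def by blast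
      obtain e e' where e: "e \<in> D" "e' \<in> D" "e' < e" "[e = e'] (mod p)"
        using d cong_sym[OF d(4)] by (metis linorder_neqE_nat)
      then have "(e, e') \<in> congruent_pairs p m" using Dm pd by (simp add: congruent_pairs_def)
      then show "D \<in> (\<Union>z\<in>congruent_pairs p m. {D \<in> divisor_sets j m. fst z \<in> D \<and> snd z \<in> D})"
        using D e by force
    qed
    then have "card {D \<in> divisor_sets j m. p \<in> exceptional D} \<le>
      card (\<Union>z\<in>congruent_pairs p m. {D \<in> divisor_sets j m. fst z \<in> D \<and> snd z \<in> D})"
      by (intro card_mono) (use fin fin_cp in auto)
    also have "\<dots> \<le> (\<Sum>z\<in>congruent_pairs p m. card {D \<in> divisor_sets j m. fst z \<in> D \<and> snd z \<in> D})"
      by (rule card_UN_le) (rule fin_cp)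
    also have "\<dots> \<le> (\<Sum>z\<in>congruent_pairs p m. tau m ^ (j - 2))"
      by (rule sum_mono, rule card_divisor_sets_containing) (use m in \<open>auto simp: congruent_pairs_def\<close>)
    also have "\<dots> = tau m ^ (j - 2) * card (congruent_pairs p m)" by simp
    finally have "real (card {D \<in> divisor_sets j m. p \<in> exceptional D}) \<le> real (tau m ^ (j - 2) * card (congruent_pairs p m))"
      by (rule of_nat_mono)
    then show ?thesis using 3 by simp
  qed
qed

lemma tau_prime: "prime p \<Longrightarrow> tau p = 2"
proof -
  assume p: "prime p"
  then have "{d. d dvd p} = {1, p}" by (auto simp: prime_nat_iff)
  then show ?thesis using prime_gt_1_nat[OF p] by (simp add: tau_def)
qed

lemma sum_tau_power_multiples:
  assumes S: "divisor_closed S" and p: "prime p"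
  shows "(\<Sum>m | m \<in> S \<and> p dvd m. real (tau m) ^ j / real m) \<le> 2 ^ j / real p * (\<Sum>m\<in>S. 1 / real m) ^ (2 ^ j)"
proof -
  have p0: "p > 0" using p by (rule prime_gt_0_nat)
  have "(\<Sum>m | m \<in> S \<and> p dvd m. real (tau m) ^ j / real m) \<le> (\<Sum>m\<in>S. 2 ^ j / real p * (real (tau m) ^ j / real m))"
  proof (rule sum_le_included[where i = "\<lambda>m. p * m"])
    show "\<forall>s\<in>{m \<in> S. p dvd m}. \<exists>t\<in>S. p * t = s \<and> real (tau s) ^ j / real s \<le> 2 ^ j / real p * (real (tau t) ^ j / real t)"
    proof
      fix s assume s: "s \<in> {m \<in> S. p dvd m}"
      then obtain t where t: "s = p * t" by (elim CollectE conjE dvdE)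
      have s0: "s > 0" using s divisor_closedD(2)[OF S] by blast
      have t0: "t > 0" using t s0 by (auto intro: gr0I)
      have tS: "t \<in> S" using divisor_closedD(3)[OF S, of s t] s t by simp
      have "real (tau (p * t)) ^ j \<le> 2 ^ j * real (tau t) ^ j"
        using tau_power_mult_le[OF p0 t0, of j] tau_prime[OF p] by simp
      then have "real (tau s) ^ j / real s \<le> 2 ^ j * real (tau t) ^ j / real s" unfolding t by (rule divide_right_mono) simp
      also have "\<dots> = 2 ^ j / real p * (real (tau t) ^ j / real t)" by (simp add: t)
      finally show "\<exists>t\<in>S. p * t = s \<and> real (tau s) ^ j / real s \<le> 2 ^ j / real p * (real (tau t) ^ j / real t)"
        using tS t by blast
    qed
  qed (use divisor_closedD(1)[OF S] in auto)
  also have "\<dots> = 2 ^ j / real p * (\<Sum>m\<in>S. real (tau m) ^ j / real m)" by (simp only: sum_distrib_left)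
  also have "\<dots> \<le> 2 ^ j / real p * (\<Sum>m\<in>S. 1 / real m) ^ (2 ^ j)"
    by (rule mult_left_mono[OF sum_tau_power_le[OF S]]) simp
  finally show ?thesis .
qed

text \<open>The singular series costs only a constant on average.
  \<open>prod_primes_linearise\<close> replaces its power by a sum of p^(\<epsilon> - 1) over
  exceptional p, so that the sums over p and over (m, D) can be exchanged. For fixed p, exceptional
  sets are rarer than all sets by a factor 1/p if p divides m, and otherwise by about p^(-\<delta>)
  through the congruent pairs. What remains of the sum over m has the order i^(2^j) of the sum
  without singular series.\<close>

lemma block_sum:
  assumes j: "j \<ge> 1"
  obtains C where "C > 0" "\<And>i X. i \<ge> 1 \<Longrightarrow>
    (\<Sum>m\<in>smooth_upto (2 ^ (i + 3)) X. 1 / real m * (\<Sum>D\<in>divisor_sets j m. Euler_prod (exceptional D \<inter> {..2 ^ i}) ^ (j + 1)))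
    \<le> C * real i ^ (2 ^ j)"
proof -
  \<comment> \<open>With B = p^\<delta> the threshold B^(2^(j - 2)) is exactly p. Taking \<epsilon>
    = \<delta> / 4 leaves p^(-1 - \<delta> / 2): one \<epsilon> comes from the linearisation, a
    second one pays for the factor 1 + ln p.\<close>
  define \<delta> :: real where "\<delta> = 1 / 2 ^ (j - 2)"
  define \<epsilon> where "\<epsilon> = \<delta> / 4"
  have \<delta>: "0 < \<delta>" "\<delta> \<le> 1" by (simp_all add: \<delta>_def)
  have \<epsilon>: "\<epsilon> > 0" using \<delta> by (simp add: \<epsilon>_def)
  obtain C1 where C1: "C1 > 0" "\<And>A. finite A \<Longrightarrow> (\<And>p. p \<in> A \<Longrightarrow> prime p) \<Longrightarrow>
    Euler_prod A ^ (j + 1) \<le> C1 * (1 + (\<Sum>p\<in>A. real p powr (\<epsilon> - 1)))"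
    using prod_primes_linearise[of "j + 1" \<epsilon>] \<epsilon> by auto
  obtain C2 where C2: "C2 > 0" "\<And>y X. y \<ge> 2 \<Longrightarrow> (\<Sum>m\<in>smooth_upto y X. 1 / real m) \<le> C2 * ln (real y)"
    using smooth_sum_le by blast
  obtain C3 where C3: "C3 > 0" "\<And>y X p B a. y \<ge> 8 \<Longrightarrow> prime p \<Longrightarrow> 1 \<le> B \<Longrightarrow> B \<le> real p \<Longrightarrow>
    (\<Sum>u | u \<in> smooth_upto y X \<and> B \<le> real u \<and> [u = a] (mod p). 1 / real u) \<le> C3 * ln (real y) * (1 + ln (real p)) / B"
    using smooth_congruence_sum by blast
  obtain C4 where C4: "C4 > 0" "\<And>A::nat set. finite A \<Longrightarrow> (\<Sum>k\<in>A. real k powr - (1 + \<delta> / 2)) \<le> C4"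
    using sum_powr_bounded[of "1 + \<delta> / 2"] \<delta> by auto
  define A where "A = 4 * C2"
  define C where "C = C1 * (A ^ (2 ^ j) + C4 * (2 ^ j * A ^ (2 ^ j)) + C4 * ((1 + 1 / \<epsilon>) * 2 ^ (j - 2) * A ^ (2 ^ j - 1) * (4 * C3)))"
  have A0: "A > 0" using C2 by (simp add: A_def)
  have Cpos: "C > 0" unfolding C_def using C1 C3 C4 A0 \<epsilon> by (intro mult_pos_pos add_pos_pos) auto
  have main: "(\<Sum>m\<in>smooth_upto (2 ^ (i + 3)) X. 1 / real m * (\<Sum>D\<in>divisor_sets j m. Euler_prod (exceptional D \<inter> {..2 ^ i}) ^ (j + 1)))
    \<le> C * real i ^ (2 ^ j)" if i: "i \<ge> 1" for i X
  proof -
    define y where "y = (2::nat) ^ (i + 3)"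
    define S where "S = smooth_upto y X"
    define M where "M = (\<Sum>m\<in>S. 1 / real m)"
    define P where "P = primes_le (2 ^ i)"
    have S: "divisor_closed S" unfolding S_def by (rule divisor_closed_smooth)
    have finS: "finite S" and posS: "\<And>m. m \<in> S \<Longrightarrow> m > 0" using divisor_closedD[OF S] by auto
    have y8: "y \<ge> 8" unfolding y_def by (simp add: power_add)
    have ly: "ln (real y) \<le> 4 * real i" unfolding y_def by (rule ln_smoothness_le) fact
    have M0: "M \<ge> 0" unfolding M_def by (rule sum_nonneg) simp
    have MA: "M \<le> A * real i"
    proof -
      have "M \<le> C2 * ln (real y)" unfolding M_def S_def by (rule C2(2)) (use y8 in simp)
      also have "\<dots> \<le> C2 * (4 * real i)" using ly C2(1) by (intro mult_left_mono) auto
      finally show ?thesis by (simp add: A_def)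
    qed
    define t1 where "t1 = (\<lambda>p m. (if p dvd m then real (tau m) ^ j else 0))"
    define t2 where "t2 = (\<lambda>p m. (if j \<ge> 2 then real (tau m) ^ (j - 2) * real (card (congruent_pairs p m)) else 0))"
    have inner: "(\<Sum>D\<in>divisor_sets j m. Euler_prod (exceptional D \<inter> {..2 ^ i}) ^ (j + 1))
      \<le> C1 * (real (tau m) ^ j + (\<Sum>p\<in>P. real p powr (\<epsilon> - 1) * (t1 p m + t2 p m)))" if m: "m \<in> S" for m
    proof -
      have m0: "m > 0" using posS m by blast
      have fin: "finite (divisor_sets j m)" by (rule finite_divisor_sets) fact
      have "(\<Sum>D\<in>divisor_sets j m. Euler_prod (exceptional D \<inter> {..2 ^ i}) ^ (j + 1))
        \<le> (\<Sum>D\<in>divisor_sets j m. C1 * (1 + (\<Sum>p\<in>exceptional D \<inter> {..2 ^ i}. real p powr (\<epsilon> - 1))))"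
        by (rule sum_mono, rule C1(2)) (auto simp: exceptional_def)
      also have "\<dots> = C1 * (real (card (divisor_sets j m)) + (\<Sum>D\<in>divisor_sets j m. \<Sum>p\<in>exceptional D \<inter> {..2 ^ i}. real p powr (\<epsilon> - 1)))"
        by (simp add: sum_distrib_left[symmetric] sum.distrib)
      also have "(\<Sum>D\<in>divisor_sets j m. \<Sum>p\<in>exceptional D \<inter> {..2 ^ i}. real p powr (\<epsilon> - 1))
        = (\<Sum>D\<in>divisor_sets j m. \<Sum>p | p \<in> P \<and> p \<in> exceptional D. real p powr (\<epsilon> - 1))"
        by (rule sum.cong[OF refl], rule sum.cong) (auto simp: P_def exceptional_def)
      also have "\<dots> = (\<Sum>p\<in>P. \<Sum>D | D \<in> divisor_sets j m \<and> p \<in> exceptional D. real p powr (\<epsilon> - 1))"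
        by (rule sum.swap_restrict) (use fin in \<open>auto simp: P_def\<close>)
      also have "\<dots> = (\<Sum>p\<in>P. real p powr (\<epsilon> - 1) * real (card {D \<in> divisor_sets j m. p \<in> exceptional D}))"
        by (simp add: mult.commute)
      also have "C1 * (real (card (divisor_sets j m)) + \<dots>) \<le> C1 * (real (tau m) ^ j + (\<Sum>p\<in>P. real p powr (\<epsilon> - 1) * (t1 p m + t2 p m)))"
      proof (rule mult_left_mono, rule add_mono)
        show "real (card (divisor_sets j m)) \<le> real (tau m) ^ j"
          using of_nat_mono[OF card_divisor_sets[OF m0, of j], where ?'a = real] by simp
        show "(\<Sum>p\<in>P. real p powr (\<epsilon> - 1) * real (card {D \<in> divisor_sets j m. p \<in> exceptional D})) \<le> (\<Sum>p\<in>P. real p powr (\<epsilon> - 1) * (t1 p m + t2 p m))"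
          unfolding t1_def t2_def by (intro sum_mono mult_left_mono card_exceptional_divisor_sets m0 j) auto
      qed (use C1 in simp)
      finally show ?thesis .
    qed
    have "(\<Sum>m\<in>S. 1 / real m * (\<Sum>D\<in>divisor_sets j m. Euler_prod (exceptional D \<inter> {..2 ^ i}) ^ (j + 1)))
      \<le> (\<Sum>m\<in>S. 1 / real m * (C1 * (real (tau m) ^ j + (\<Sum>p\<in>P. real p powr (\<epsilon> - 1) * (t1 p m + t2 p m)))))"
      by (intro sum_mono mult_left_mono inner) auto
    also have "\<dots> = C1 * ((\<Sum>m\<in>S. real (tau m) ^ j / real m) + (\<Sum>m\<in>S. \<Sum>p\<in>P. real p powr (\<epsilon> - 1) * (t1 p m / real m + t2 p m / real m)))"
      by (simp add: sum_distrib_left sum.distrib[symmetric] algebra_simps add_divide_distrib)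
    also have "(\<Sum>m\<in>S. \<Sum>p\<in>P. real p powr (\<epsilon> - 1) * (t1 p m / real m + t2 p m / real m))
      = (\<Sum>p\<in>P. real p powr (\<epsilon> - 1) * ((\<Sum>m\<in>S. t1 p m / real m) + (\<Sum>m\<in>S. t2 p m / real m)))"
      by (subst sum.swap) (simp add: sum_distrib_left sum.distrib[symmetric])
    also have "\<dots> \<le> (\<Sum>p\<in>P. real p powr - (1 + \<delta> / 2) *
       (2 ^ j * A ^ (2 ^ j) * real i ^ (2 ^ j) + (1 + 1 / \<epsilon>) * 2 ^ (j - 2) * A ^ (2 ^ j - 1) * (4 * C3) * real i ^ (2 ^ j)))"
    proof (rule sum_mono)
      fix p assume "p \<in> P"
      then have p: "prime p" by (simp add: P_def)
      have p2: "p \<ge> 2" using p by (rule prime_ge_2_nat)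
      have "(\<Sum>m\<in>S. t1 p m / real m) = (\<Sum>m | m \<in> S \<and> p dvd m. real (tau m) ^ j / real m)"
        unfolding t1_def by (subst sum.inter_filter[OF finS]) (rule sum.cong, auto)
      also have "\<dots> \<le> 2 ^ j / real p * M ^ (2 ^ j)" unfolding M_def by (rule sum_tau_power_multiples[OF S p])
      also have "\<dots> \<le> 2 ^ j / real p * (A * real i) ^ (2 ^ j)"
        by (intro mult_left_mono power_mono MA M0) auto
      finally have 1: "real p powr (\<epsilon> - 1) * (\<Sum>m\<in>S. t1 p m / real m) \<le> real p powr - (1 + \<delta> / 2) * (2 ^ j * A ^ (2 ^ j) * real i ^ (2 ^ j))"
      proof -
        assume *: "(\<Sum>m\<in>S. t1 p m / real m) \<le> 2 ^ j / real p * (A * real i) ^ (2 ^ j)"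
        have "real p powr (\<epsilon> - 1) * (\<Sum>m\<in>S. t1 p m / real m) \<le> real p powr (\<epsilon> - 1) * (2 ^ j / real p * (A * real i) ^ (2 ^ j))"
          by (rule mult_left_mono[OF *]) simp
        also have "\<dots> = real p powr (\<epsilon> - 1) / real p * (2 ^ j * A ^ (2 ^ j) * real i ^ (2 ^ j))"
          by (simp add: power_mult_distrib)
        also have "real p powr (\<epsilon> - 1) / real p = real p powr (\<epsilon> - 2)"
        proof -
          have "real p powr (\<epsilon> - 1) / real p powr 1 = real p powr (\<epsilon> - 1 - 1)" by (rule powr_diff[symmetric])
          then show ?thesis using p2 by simp
        qed
        also have "real p powr (\<epsilon> - 2) * (2 ^ j * A ^ (2 ^ j) * real i ^ (2 ^ j)) \<le> real p powr - (1 + \<delta> / 2) * (2 ^ j * A ^ (2 ^ j) * real i ^ (2 ^ j))"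
          by (intro mult_right_mono powr_mono) (use \<delta> p2 A0 in \<open>auto simp: \<epsilon>_def\<close>)
        finally show ?thesis .
      qed
      have 2: "real p powr (\<epsilon> - 1) * (\<Sum>m\<in>S. t2 p m / real m) \<le> real p powr - (1 + \<delta> / 2) * ((1 + 1 / \<epsilon>) * 2 ^ (j - 2) * A ^ (2 ^ j - 1) * (4 * C3) * real i ^ (2 ^ j))"
      proof (cases "j \<ge> 2")
        case False
        then show ?thesis using \<epsilon> A0 C3(1) by (simp add: t2_def)
      next
        case True
        define B where "B = real p powr \<delta>"
        have B: "1 \<le> B" "B \<le> real p" "B ^ (2 ^ (j - 2)) = real p"
        proof -
          show "1 \<le> B" unfolding B_def using p2 \<delta> by (intro ge_one_powr_ge_zero) auto
          have "real p powr \<delta> \<le> real p powr 1" by (rule powr_mono) (use p2 \<delta> in auto)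
          then show "B \<le> real p" using p2 by (simp add: B_def)
          have "B ^ (2 ^ (j - 2)) = real p powr (\<delta> * real (2 ^ (j - 2)))"
            unfolding B_def using p2 by (simp add: powr_realpow[symmetric] powr_powr)
          also have "\<delta> * real (2 ^ (j - 2)) = 1" by (simp add: \<delta>_def)
          finally show "B ^ (2 ^ (j - 2)) = real p" using p2 by simp
        qed
        define K where "K = C3 * (4 * real i) * (1 + ln (real p)) / B"
        have lp: "ln (real p) \<ge> 0" using p2 by simp
        have K: "(\<Sum>u | u \<in> S \<and> B \<le> real u \<and> [u = a] (mod p). 1 / real u) \<le> K" for a
        proof -
          have "(\<Sum>u | u \<in> S \<and> B \<le> real u \<and> [u = a] (mod p). 1 / real u) \<le> C3 * ln (real y) * (1 + ln (real p)) / B"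
            unfolding S_def by (rule C3(2)[OF y8 p B(1,2)])
          also have "\<dots> \<le> K" unfolding K_def
            by (intro divide_right_mono mult_right_mono mult_left_mono ly) (use C3(1) lp B in auto)
          finally show ?thesis .
        qed
        have "(\<Sum>m\<in>S. t2 p m / real m) = (\<Sum>m\<in>S. real (tau m) ^ (j - 2) / real m * real (card (congruent_pairs p m)))"
          using True by (simp add: t2_def)
        also have "\<dots> \<le> 2 ^ (j - 2) * M ^ (2 ^ (j - 2 + 2) - 1) * K" unfolding M_def
          by (rule sum_tau_congruent_pairs[OF S p B(1) _ K]) (use B(3) in simp)
        also have "j - 2 + 2 = j" using True by simp
        also have "2 ^ (j - 2) * M ^ (2 ^ j - 1) * K \<le> 2 ^ (j - 2) * (A * real i) ^ (2 ^ j - 1) * K"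
          by (intro mult_right_mono mult_left_mono power_mono MA M0) (use C3(1) lp B in \<open>auto simp: K_def\<close>)
        finally have *: "(\<Sum>m\<in>S. t2 p m / real m) \<le> 2 ^ (j - 2) * (A * real i) ^ (2 ^ j - 1) * K" .
        have "real p powr (\<epsilon> - 1) * (\<Sum>m\<in>S. t2 p m / real m) \<le> real p powr (\<epsilon> - 1) * (2 ^ (j - 2) * (A * real i) ^ (2 ^ j - 1) * K)"
          by (rule mult_left_mono[OF *]) simp
        also have "\<dots> = (real p powr (\<epsilon> - 1) / B * (1 + ln (real p))) * (2 ^ (j - 2) * A ^ (2 ^ j - 1) * (4 * C3) * (real i ^ (2 ^ j - 1) * real i))"
          by (simp add: K_def power_mult_distrib mult_ac)
        also have "real i ^ (2 ^ j - 1) * real i = real i ^ (2 ^ j)"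
        proof -
          have "real i ^ (2 ^ j - 1) * real i = real i ^ Suc (2 ^ j - 1)" by (rule power_Suc2[symmetric])
          moreover have "Suc (2 ^ j - 1) = (2::nat) ^ j" by simp
          ultimately show ?thesis by simp
        qed
        also have "real p powr (\<epsilon> - 1) / B * (1 + ln (real p)) * (2 ^ (j - 2) * A ^ (2 ^ j - 1) * (4 * C3) * real i ^ (2 ^ j))
          \<le> real p powr - (1 + \<delta> / 2) * (1 + 1 / \<epsilon>) * (2 ^ (j - 2) * A ^ (2 ^ j - 1) * (4 * C3) * real i ^ (2 ^ j))"
        proof (rule mult_right_mono)
          have "ln (real p) ^ 1 \<le> (real 1 / \<epsilon>) ^ 1 * real p powr \<epsilon>"
            by (rule ln_power_le_powr) (use \<epsilon> p2 in auto)
          moreover have "1 \<le> real p powr \<epsilon>" using p2 \<epsilon> by (intro ge_one_powr_ge_zero) auto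
          ultimately have "1 + ln (real p) \<le> (1 + 1 / \<epsilon>) * real p powr \<epsilon>" by (simp add: algebra_simps)
          then have "real p powr (\<epsilon> - 1) / B * (1 + ln (real p)) \<le> real p powr (\<epsilon> - 1) / B * ((1 + 1 / \<epsilon>) * real p powr \<epsilon>)"
            by (intro mult_left_mono) (auto simp: B_def)
          also have "\<dots> = (real p powr (\<epsilon> - 1) / B * real p powr \<epsilon>) * (1 + 1 / \<epsilon>)" by simp
          also have "real p powr (\<epsilon> - 1) / B * real p powr \<epsilon> = real p powr - (1 + \<delta> / 2)"
          proof -
            have "real p powr (\<epsilon> - 1) / B * real p powr \<epsilon> = real p powr (\<epsilon> - 1 - \<delta> + \<epsilon>)"
              unfolding B_def by (simp only: powr_add powr_diff)
            also have "\<epsilon> - 1 - \<delta> + \<epsilon> = - (1 + \<delta> / 2)" by (simp add: \<epsilon>_def)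
            finally show ?thesis .
          qed
          finally show "real p powr (\<epsilon> - 1) / B * (1 + ln (real p)) \<le> real p powr - (1 + \<delta> / 2) * (1 + 1 / \<epsilon>)" .
        qed (use A0 C3(1) in auto)
        also have "real p powr - (1 + \<delta> / 2) * (1 + 1 / \<epsilon>) * (2 ^ (j - 2) * A ^ (2 ^ j - 1) * (4 * C3) * real i ^ (2 ^ j))
          = real p powr - (1 + \<delta> / 2) * ((1 + 1 / \<epsilon>) * 2 ^ (j - 2) * A ^ (2 ^ j - 1) * (4 * C3) * real i ^ (2 ^ j))"
          by (simp only: mult.assoc)
        finally show ?thesis .
      qed
      show "real p powr (\<epsilon> - 1) * ((\<Sum>m\<in>S. t1 p m / real m) + (\<Sum>m\<in>S. t2 p m / real m)) \<le>
        real p powr - (1 + \<delta> / 2) * (2 ^ j * A ^ (2 ^ j) * real i ^ (2 ^ j) + (1 + 1 / \<epsilon>) * 2 ^ (j - 2) * A ^ (2 ^ j - 1) * (4 * C3) * real i ^ (2 ^ j))"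
        unfolding distrib_left by (rule add_mono[OF 1 2])
    qed
    also have "\<dots> = (\<Sum>p\<in>P. real p powr - (1 + \<delta> / 2)) * (2 ^ j * A ^ (2 ^ j) * real i ^ (2 ^ j) + (1 + 1 / \<epsilon>) * 2 ^ (j - 2) * A ^ (2 ^ j - 1) * (4 * C3) * real i ^ (2 ^ j))"
      by (simp only: sum_distrib_right)
    also have "\<dots> \<le> C4 * (2 ^ j * A ^ (2 ^ j) * real i ^ (2 ^ j) + (1 + 1 / \<epsilon>) * 2 ^ (j - 2) * A ^ (2 ^ j - 1) * (4 * C3) * real i ^ (2 ^ j))"
      by (rule mult_right_mono[OF C4(2)]) (use A0 C3(1) \<epsilon> in \<open>auto simp: P_def\<close>)
    also have "(\<Sum>m\<in>S. real (tau m) ^ j / real m) \<le> A ^ (2 ^ j) * real i ^ (2 ^ j)"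
    proof -
      have "(\<Sum>m\<in>S. real (tau m) ^ j / real m) \<le> M ^ (2 ^ j)" unfolding M_def by (rule sum_tau_power_le[OF S])
      also have "\<dots> \<le> (A * real i) ^ (2 ^ j)" by (intro power_mono MA M0)
      finally show ?thesis by (simp add: power_mult_distrib)
    qed
    finally have "(\<Sum>m\<in>S. 1 / real m * (\<Sum>D\<in>divisor_sets j m. Euler_prod (exceptional D \<inter> {..2 ^ i}) ^ (j + 1)))
      \<le> C1 * (A ^ (2 ^ j) * real i ^ (2 ^ j) + C4 * (2 ^ j * A ^ (2 ^ j) * real i ^ (2 ^ j) + (1 + 1 / \<epsilon>) * 2 ^ (j - 2) * A ^ (2 ^ j - 1) * (4 * C3) * real i ^ (2 ^ j)))"
      using C1(1) by simp
    also have "\<dots> = C * real i ^ (2 ^ j)" unfolding C_def by (simp only: ring_distribs mult_ac)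
    finally show ?thesis unfolding S_def y_def .
  qed
  show ?thesis by (rule that[OF Cpos main])
qed

section \<open>Moments\<close>

text \<open>Each \<open>F p\<close> is written as 1 plus the increments over the powers of p
  dividing n. Monotonicity makes the increments nonnegative, so the number N div p^k of multiples
  may be replaced by N / p^k, one prime at a time.\<close>

lemma multiplicative_mean:
  fixes F :: "nat \<Rightarrow> nat \<Rightarrow> real" and E :: "nat \<Rightarrow> real" and N :: nat
  assumes "finite P" "\<And>p. p \<in> P \<Longrightarrow> prime p"
    and "\<And>p. F p 0 = 1" "\<And>p k. F p k \<le> F p (Suc k)"
    and "\<And>p K. p \<in> P \<Longrightarrow> 1 + (\<Sum>k\<in>{1..K}. (F p k - F p (k - 1)) / real p ^ k) \<le> E p"
  shows "(\<Sum>n\<in>{1..N}. \<Prod>p\<in>P. F p (multiplicity p n)) \<le> real N * (\<Prod>p\<in>P. E p)"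
  using assms
proof (induction P arbitrary: N rule: finite_induct)
  case (insert p P)
  define f where "f = (\<lambda>n. \<Prod>q\<in>P. F q (multiplicity q n))"
  have p: "prime p" using insert by auto
  have p2: "p \<ge> 2" using p by (rule prime_ge_2_nat)
  have prP: "prime q" if "q \<in> P" for q using insert.prems(1) that by auto
  have IH: "(\<Sum>n\<in>{1..N}. f n) \<le> real N * (\<Prod>q\<in>P. E q)" for N
    unfolding f_def by (rule insert.IH) (use insert.prems in auto)
  have F1: "F q k \<ge> 1" for q k
    by (induction k) (use insert.prems(2,3) order_trans in \<open>auto, blast\<close>)
  have f0: "f n \<ge> 0" for n unfolding f_def by (rule prod_nonneg) (use F1 in \<open>smt (verit)\<close>)
  define \<Delta> where "\<Delta> = (\<lambda>k. F p k - F p (k - 1))"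
  have \<Delta>0: "\<Delta> k \<ge> 0" for k using insert.prems(3)[of p "k - 1"] by (cases k) (auto simp: \<Delta>_def)
  have tele: "F p v = 1 + (\<Sum>k\<in>{1..v}. \<Delta> k)" for v
    by (induction v) (use insert.prems(2) in \<open>auto simp: \<Delta>_def\<close>)
  have E0: "(\<Prod>q\<in>P. E q) \<ge> 0"
  proof (rule prod_nonneg)
    fix q assume "q \<in> P"
    then have "1 + (\<Sum>k\<in>{1..0}. (F q k - F q (k - 1)) / real q ^ k) \<le> E q" by (intro insert.prems(4)) auto
    then show "0 \<le> E q" by simp
  qed
  have Fn: "F p (multiplicity p n) = 1 + (\<Sum>k | k \<in> {1..N} \<and> p ^ k dvd n. \<Delta> k)" if n: "n \<in> {1..N}" for n
  proof -
    have "{k. k \<in> {1..N} \<and> p ^ k dvd n} = {1..multiplicity p n}"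
    proof -
      have iff: "p ^ k dvd n \<longleftrightarrow> k \<le> multiplicity p n" for k
        by (rule power_dvd_iff_le_multiplicity) (use n p in auto)
      have "multiplicity p n < p ^ multiplicity p n" by (rule power_gt_expt) (use p2 in simp)
      also have "p ^ multiplicity p n \<le> n" using n iff[of "multiplicity p n"] by (intro dvd_imp_le) auto
      finally have "multiplicity p n \<le> N" using n by simp
      then show ?thesis unfolding iff by auto
    qed
    then show ?thesis using tele by simp
  qed
  have "(\<Sum>n\<in>{1..N}. \<Prod>q\<in>insert p P. F q (multiplicity q n)) = (\<Sum>n\<in>{1..N}. F p (multiplicity p n) * f n)"
    using insert.hyps by (simp add: f_def)
  also have "\<dots> = (\<Sum>n\<in>{1..N}. f n + (\<Sum>k | k \<in> {1..N} \<and> p ^ k dvd n. \<Delta> k * f n))"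
    by (rule sum.cong[OF refl]) (simp only: Fn distrib_right sum_distrib_right mult_1_left)
  also have "\<dots> = (\<Sum>n\<in>{1..N}. f n) + (\<Sum>k\<in>{1..N}. \<Sum>n | n \<in> {1..N} \<and> p ^ k dvd n. \<Delta> k * f n)"
    unfolding sum.distrib by (subst sum.swap_restrict) auto
  also have "\<dots> \<le> real N * (\<Prod>q\<in>P. E q) + (\<Sum>k\<in>{1..N}. \<Delta> k * (real N / real p ^ k * (\<Prod>q\<in>P. E q)))"
  proof (rule add_mono[OF IH], rule sum_mono)
    fix k assume "k \<in> {1..N}"
    have pk: "p ^ k > 0" using p2 by simp
    \<comment> \<open>Removing p^k does not affect multiplicities at the other primes, so the inner
      sum is the same problem with N div p^k. This is why the induction generalises over
      \<open>N\<close>.\<close>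
    have "(\<Sum>n | n \<in> {1..N} \<and> p ^ k dvd n. f n) = (\<Sum>n'\<in>{1..N div p ^ k}. f n')"
    proof (rule sum.reindex_bij_witness[where i = "\<lambda>n'. p ^ k * n'" and j = "\<lambda>n. n div p ^ k"])
      fix n assume n: "n \<in> {n. n \<in> {1..N} \<and> p ^ k dvd n}"
      then obtain n' where n': "n = p ^ k * n'" by (elim CollectE conjE dvdE)
      then have n'0: "n' > 0" using n by (auto intro: gr0I)
      have eq: "n div p ^ k = n'" using n' pk by simp
      show "p ^ k * (n div p ^ k) = n" using n' eq by simp
      have "n div p ^ k \<le> N div p ^ k" using n by (intro div_le_mono) auto
      then show "n div p ^ k \<in> {1..N div p ^ k}" using eq n'0 by simp
      show "f (n div p ^ k) = f n" unfolding eq f_def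
      proof (rule prod.cong[OF refl])
        fix q assume q: "q \<in> P"
        have "q \<noteq> p" using q insert.hyps by auto
        then have "multiplicity q p = 0"
          using prP[OF q] p by (intro not_dvd_imp_multiplicity_0) (auto dest: primes_dvd_imp_eq)
        then have "multiplicity q n = multiplicity q n'"
          unfolding n' using prP[OF q] p2 n'0
          by (subst prime_elem_multiplicity_mult_distrib) (auto simp: prime_elem_multiplicity_power_distrib)
        then show "F q (multiplicity q n') = F q (multiplicity q n)" by simp
      qed
    next
      fix n' assume n': "n' \<in> {1..N div p ^ k}"
      show "p ^ k * n' div p ^ k = n'" using pk by simp
      have "p ^ k * n' \<le> p ^ k * (N div p ^ k)" using n' by (intro mult_le_mono2) auto
      also have "\<dots> \<le> N" by simp
      finally have "p ^ k * n' \<le> N" .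
      moreover have "1 \<le> p ^ k * n'" using pk n' by (simp only: Suc_le_eq One_nat_def) simp
      ultimately show "p ^ k * n' \<in> {n. n \<in> {1..N} \<and> p ^ k dvd n}" by simp
    qed
    also have "\<dots> \<le> real (N div p ^ k) * (\<Prod>q\<in>P. E q)" by (rule IH)
    also have "\<dots> \<le> real N / real p ^ k * (\<Prod>q\<in>P. E q)"
    proof (rule mult_right_mono[OF _ E0])
      have "real (N div p ^ k) \<le> real N / real (p ^ k)" by (rule of_nat_div_le_of_nat)
      then show "real (N div p ^ k) \<le> real N / real p ^ k" by simp
    qed
    finally show "(\<Sum>n | n \<in> {1..N} \<and> p ^ k dvd n. \<Delta> k * f n) \<le> \<Delta> k * (real N / real p ^ k * (\<Prod>q\<in>P. E q))"
      unfolding sum_distrib_left[symmetric] by (rule mult_left_mono[OF _ \<Delta>0])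
  qed
  also have "\<dots> = real N * (\<Prod>q\<in>P. E q) * (1 + (\<Sum>k\<in>{1..N}. \<Delta> k / real p ^ k))"
    by (simp add: sum_distrib_left algebra_simps)
  also have "\<dots> \<le> real N * (\<Prod>q\<in>P. E q) * E p"
    using insert.prems(4)[of p N] E0 by (intro mult_left_mono) (auto simp: \<Delta>_def)
  finally show ?case using insert.hyps by (simp add: mult_ac)
qed simp

text \<open>A prime p > q carries 3/2 = 1 + 1/2, hence the Euler factor 1 + 1 / (2p). Half the sum
  of 1/p over q < p \<le> x exponentiates to the square root of ln x / ln q.\<close>

lemma sum_weight_large_primes:
  obtains C where "C > 0" "\<And>q x N. 2 \<le> q \<Longrightarrow> q \<le> x \<Longrightarrow> N \<le> x \<Longrightarrow>
    (\<Sum>n\<in>{1..N}. (3 / 2 :: real) ^ card {p \<in> prime_factors n. q < p}) \<le> C * real N * (ln (real x) / ln (real q)) powr (1 / 2)"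
proof -
  obtain C where C: "C > 0" "\<And>m n. 2 \<le> m \<Longrightarrow> m \<le> n \<Longrightarrow>
    (\<Sum>p | prime p \<and> m < p \<and> p \<le> n. 1 / real p) \<le> ln (ln (real n) / ln (real m)) + C"
    using sum_primes_between by blast
  have main: "(\<Sum>n\<in>{1..N}. (3 / 2 :: real) ^ card {p \<in> prime_factors n. q < p}) \<le> exp (C / 2) * real N * (ln (real x) / ln (real q)) powr (1 / 2)"
    if q: "2 \<le> q" "q \<le> x" "N \<le> x" for q x N
  proof -
    define P where "P = {p. prime p \<and> q < p \<and> p \<le> x}"
    have finP: "finite P" by (rule finite_subset[of _ "{..x}"]) (auto simp: P_def)
    define F :: "nat \<Rightarrow> nat \<Rightarrow> real" where "F = (\<lambda>p k. if k = 0 then 1 else 3 / 2)"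
    have "(\<Sum>n\<in>{1..N}. (3 / 2 :: real) ^ card {p \<in> prime_factors n. q < p}) = (\<Sum>n\<in>{1..N}. \<Prod>p\<in>P. F p (multiplicity p n))"
    proof (rule sum.cong[OF refl])
      fix n assume n: "n \<in> {1..N}"
      have "{p \<in> prime_factors n. q < p} = {p \<in> P. multiplicity p n \<noteq> 0}"
      proof -
        have "p \<in> prime_factors n \<and> q < p \<longleftrightarrow> p \<in> P \<and> multiplicity p n \<noteq> 0" for p
        proof -
          have "p \<le> x" if "p dvd n" using dvd_imp_le[OF that] n q by simp
          then show ?thesis using n
            by (auto simp: P_def in_prime_factors_iff prime_multiplicity_gt_zero_iff multiplicity_eq_zero_iff)
        qed
        then show ?thesis by blast
      qed
      then show "(3 / 2 :: real) ^ card {p \<in> prime_factors n. q < p} = (\<Prod>p\<in>P. F p (multiplicity p n))"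
        using finP by (simp add: F_def prod.If_cases Int_def)
    qed
    also have "\<dots> \<le> real N * (\<Prod>p\<in>P. 1 + 1 / (2 * real p))"
    proof (rule multiplicative_mean[OF finP])
      fix p K assume "p \<in> P"
      show "1 + (\<Sum>k\<in>{1..K}. (F p k - F p (k - 1)) / real p ^ k) \<le> 1 + 1 / (2 * real p)"
      proof (cases K)
        case (Suc K')
        have "(\<Sum>k\<in>{1..K}. (F p k - F p (k - 1)) / real p ^ k) = (\<Sum>k\<in>{1}. (F p k - F p (k - 1)) / real p ^ k)"
          by (rule sum.mono_neutral_right) (use Suc in \<open>auto simp: F_def\<close>)
        then show ?thesis by (simp add: F_def)
      qed simp
    qed (auto simp: P_def F_def)
    finally have A: "(\<Sum>n\<in>{1..N}. (3 / 2 :: real) ^ card {p \<in> prime_factors n. q < p}) \<le> real N * (\<Prod>p\<in>P. 1 + 1 / (2 * real p))" .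
    have "(\<Prod>p\<in>P. 1 + 1 / (2 * real p)) \<le> (\<Prod>p\<in>P. exp (1 / (2 * real p)))"
      by (rule prod_mono) (auto intro: exp_ge_add_one_self add_nonneg_nonneg)
    also have "\<dots> = exp ((\<Sum>p\<in>P. 1 / real p) / 2)"
      by (simp add: exp_sum[OF finP, symmetric] sum_divide_distrib mult.commute)
    also have "\<dots> \<le> exp ((ln (ln (real x) / ln (real q)) + C) / 2)"
      using C(2)[OF q(1,2)] by (simp add: P_def)
    also have "\<dots> = exp (C / 2) * (ln (real x) / ln (real q)) powr (1 / 2)"
      using q by (simp add: powr_def exp_add[symmetric] add_divide_distrib add.commute)
    finally have "real N * (\<Prod>p\<in>P. 1 + 1 / (2 * real p)) \<le> real N * (exp (C / 2) * (ln (real x) / ln (real q)) powr (1 / 2))"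
      by (rule mult_left_mono) simp
    then show ?thesis using A by (simp add: mult_ac)
  qed
  have "exp (C / 2) > 0" by simp
  then show ?thesis by (rule that[OF _ main])
qed

text \<open>For n = q L t the factor L has no prime above q, so apart from q itself only the primes
  of t above q count, and the weight of n is at most 3/2 times that of t.\<close>

lemma sum_weight_multiples:
  obtains C where "C > 0" "\<And>q x L. prime q \<Longrightarrow> q \<le> x \<Longrightarrow> L > 0 \<Longrightarrow> (\<And>p. prime p \<Longrightarrow> p dvd L \<Longrightarrow> p \<le> q) \<Longrightarrow>
    (\<Sum>n | n \<in> {1..x} \<and> q * L dvd n. (3 / 2 :: real) ^ card {p \<in> prime_factors n. q \<le> p})
    \<le> C * real x / (real q * real L) * (ln (real x) / ln (real q)) powr (1 / 2)"
proof -
  obtain C where C: "C > 0" "\<And>q x N. 2 \<le> q \<Longrightarrow> q \<le> x \<Longrightarrow> N \<le> x \<Longrightarrow>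
    (\<Sum>n\<in>{1..N}. (3 / 2 :: real) ^ card {p \<in> prime_factors n. q < p}) \<le> C * real N * (ln (real x) / ln (real q)) powr (1 / 2)"
    using sum_weight_large_primes by blast
  have main: "(\<Sum>n | n \<in> {1..x} \<and> q * L dvd n. (3 / 2 :: real) ^ card {p \<in> prime_factors n. q \<le> p})
    \<le> (3 / 2 * C) * real x / (real q * real L) * (ln (real x) / ln (real q)) powr (1 / 2)"
    if q: "prime q" "q \<le> x" and L: "L > 0" "\<And>p. prime p \<Longrightarrow> p dvd L \<Longrightarrow> p \<le> q" for q x L
  proof -
    have q2: "q \<ge> 2" using q(1) by (rule prime_ge_2_nat)
    define N where "N = x div (q * L)"
    define R where "R = (ln (real x) / ln (real q)) powr (1 / 2)"
    have qL: "q * L > 0" using q2 L by simp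
    have "(\<Sum>n | n \<in> {1..x} \<and> q * L dvd n. (3 / 2 :: real) ^ card {p \<in> prime_factors n. q \<le> p})
      \<le> (\<Sum>n\<in>{1..N}. 3 / 2 * (3 / 2 :: real) ^ card {p \<in> prime_factors n. q < p})"
    proof (rule sum_le_included[where i = "\<lambda>n. q * L * n"])
      show "\<forall>s\<in>{n. n \<in> {1..x} \<and> q * L dvd n}. \<exists>t\<in>{1..N}. q * L * t = s \<and>
        (3 / 2 :: real) ^ card {p \<in> prime_factors s. q \<le> p} \<le> 3 / 2 * (3 / 2) ^ card {p \<in> prime_factors t. q < p}"
      proof
        fix s assume s: "s \<in> {n. n \<in> {1..x} \<and> q * L dvd n}"
        then obtain t where t: "s = q * L * t" by (elim CollectE conjE dvdE)
        have t0: "t > 0" using s t by (auto intro: gr0I)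
        have "t = s div (q * L)" using t qL by simp
        then have tN: "t \<le> N" unfolding N_def using s by (simp add: div_le_mono)
        have "{p \<in> prime_factors s. q \<le> p} \<subseteq> insert q {p \<in> prime_factors t. q < p}"
        proof
          fix p assume p: "p \<in> {p \<in> prime_factors s. q \<le> p}"
          then have pp: "prime p" "p dvd q * L * t" "q \<le> p" using t by (auto simp: in_prime_factors_iff)
          show "p \<in> insert q {p \<in> prime_factors t. q < p}"
          proof (cases "p = q")
            case False
            then have "\<not> p dvd q" using primes_dvd_imp_eq[OF pp(1) q(1)] by blast
            moreover have "\<not> p dvd L" using L(2)[OF pp(1)] pp(3) False by auto
            ultimately have "p dvd t" using pp(1,2) by (simp add: prime_dvd_mult_iff)
            then show ?thesis using False pp t0 by (simp add: in_prime_factors_iff)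
          qed simp
        qed
        then have "card {p \<in> prime_factors s. q \<le> p} \<le> card (insert q {p \<in> prime_factors t. q < p})"
          by (intro card_mono) auto
        also have "\<dots> \<le> Suc (card {p \<in> prime_factors t. q < p})" by (rule card_insert_le_m1) auto
        finally have "(3 / 2 :: real) ^ card {p \<in> prime_factors s. q \<le> p} \<le> (3 / 2) ^ Suc (card {p \<in> prime_factors t. q < p})"
          by (rule power_increasing) simp
        then show "\<exists>t\<in>{1..N}. q * L * t = s \<and>
          (3 / 2 :: real) ^ card {p \<in> prime_factors s. q \<le> p} \<le> 3 / 2 * (3 / 2) ^ card {p \<in> prime_factors t. q < p}"
          using t t0 tN by (intro bexI[of _ t]) auto
      qed
    qed auto
    also have "\<dots> = 3 / 2 * (\<Sum>n\<in>{1..N}. (3 / 2 :: real) ^ card {p \<in> prime_factors n. q < p})"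
      by (simp only: sum_distrib_left)
    also have "\<dots> \<le> 3 / 2 * (C * real N * R)"
      unfolding R_def by (intro mult_left_mono C(2) q2 q(2)) (auto simp: N_def)
    also have "\<dots> \<le> 3 / 2 * (C * (real x / (real q * real L)) * R)"
    proof -
      have "real N \<le> real x / real (q * L)" unfolding N_def by (rule of_nat_div_le_of_nat)
      then show ?thesis using C(1) by (intro mult_left_mono mult_right_mono) (auto simp: R_def)
    qed
    finally show ?thesis by (simp add: R_def)
  qed
  have "3 / 2 * C > 0" using C(1) by simp
  then show ?thesis by (rule that[OF _ main])
qed

text \<open>The \<open>d\<close> such that \<open>q d + 1\<close> is a prime counted by \<open>\<omega>\<^sup>*(n)\<close> and \<open>q\<close> is the largest prime
  factor of \<open>q d\<close>.\<close>
definition cofactors :: "nat \<Rightarrow> nat \<Rightarrow> nat set" where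
  "cofactors q n = {d. q * d dvd n \<and> prime (q * d + 1) \<and> (\<forall>p. prime p \<and> p dvd d \<longrightarrow> p \<le> q)}"

section \<open>The moment over one dyadic block of primes\<close>

lemma finite_cofactors: "n > 0 \<Longrightarrow> finite (cofactors q n)"
proof -
  assume n: "n > 0"
  have "cofactors q n \<subseteq> {d. d dvd n}" by (auto simp: cofactors_def intro: dvd_mult_right)
  then show ?thesis using n finite_subset by fastforce
qed

text \<open>Trades 1/L for a sum over smooth multiples of L at a gain of ln y: all L k with k \<le>
  y are again y-smooth. Applied to L = Lcm D, it turns a sum over sets D into one over divisors of
  m, and the gain lowers the exponent 2^j of i by one.\<close>

lemma sum_reciprocal_multiples:
  assumes L: "L \<in> smooth_upto y x" and y: "y \<ge> 1"
  shows "ln (real y) / real L \<le> (\<Sum>m | m \<in> smooth_upto y (x * y) \<and> L dvd m. 1 / real m)"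
proof -
  have L0: "L > 0" "L \<le> x" using L by (auto simp: smooth_upto_def)
  have "ln (real y) \<le> ln (real y + 1)" using y by simp
  also have "\<dots> \<le> harm y" by (rule ln_le_harm)
  also have "harm y = (\<Sum>k\<in>{1..y}. 1 / real k)" by (simp add: harm_def inverse_eq_divide)
  finally have "ln (real y) / real L \<le> (\<Sum>k\<in>{1..y}. 1 / real k) / real L" by (rule divide_right_mono) simp
  also have "\<dots> = (\<Sum>k\<in>{1..y}. 1 / (real L * real k))" by (simp add: sum_divide_distrib mult.commute)
  also have "\<dots> \<le> (\<Sum>m | m \<in> smooth_upto y (x * y) \<and> L dvd m. 1 / real m)"
  proof (rule sum_le_included[where i = "\<lambda>m. m div L"])
    show "\<forall>k\<in>{1..y}. \<exists>t\<in>{m \<in> smooth_upto y (x * y). L dvd m}. t div L = k \<and> 1 / (real L * real k) \<le> 1 / real t"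
    proof
      fix k assume k: "k \<in> {1..y}"
      have "L * k \<in> smooth_upto y (x * y)"
        unfolding smooth_upto_def
      proof (intro CollectI conjI allI impI)
        show "0 < L * k" using L0 k by simp
        show "L * k \<le> x * y" using L0 k by (intro mult_le_mono) auto
        fix p assume p: "prime p \<and> p dvd L * k"
        then have "p dvd L \<or> p dvd k" using prime_dvd_mult_iff[of p L k] by blast
        then show "p \<le> y"
        proof
          assume "p dvd L"
          then show ?thesis using L p by (simp add: smooth_upto_def)
        next
          assume "p dvd k"
          then have "p \<le> k" using k by (intro dvd_imp_le) auto
          then show ?thesis using k by simp
        qed
      qed
      then show "\<exists>t\<in>{m \<in> smooth_upto y (x * y). L dvd m}. t div L = k \<and> 1 / (real L * real k) \<le> 1 / real t"
        using L0 by (intro bexI[of _ "L * k"]) auto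
    qed
  qed (auto intro: finite_subset[OF _ finite_smooth_upto])
  finally show ?thesis .
qed

text \<open>The binomial coefficient counts j-element sets D of cofactors, and such a D forces q Lcm
  D to divide n. The sum over n gives x / (q Lcm D) times the mean weight, the sieve bounds the
  number of q for fixed D, and its 2^i cancels against q \<ge> 2^i. Of the denominator i^(j + 2),
  the sieve supplies i^(j + 1) and the passage from Lcm D to multiples m supplies i; the numerator
  is \<open>block_sum\<close>.\<close>

lemma block_moment:
  assumes j: "j \<ge> 1"
  obtains C where "C > 0" "\<And>i x. i \<ge> 1 \<Longrightarrow>
    (\<Sum>q | q \<in> {2 ^ i..<2 ^ Suc i} \<and> prime q \<and> q \<le> x. \<Sum>n\<in>{1..x}. (3 / 2) ^ card {p \<in> prime_factors n. q \<le> p} * real (card (cofactors q n) choose j))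
    \<le> C * real x * (real i ^ (2 ^ j) / real i ^ (j + 2)) * (ln (real x) / real i) powr (1 / 2)"
proof -
  obtain C1 where C1: "C1 > 0" "\<And>q x L. prime q \<Longrightarrow> q \<le> x \<Longrightarrow> L > 0 \<Longrightarrow> (\<And>p. prime p \<Longrightarrow> p dvd L \<Longrightarrow> p \<le> q) \<Longrightarrow>
    (\<Sum>n | n \<in> {1..x} \<and> q * L dvd n. (3 / 2 :: real) ^ card {p \<in> prime_factors n. q \<le> p})
    \<le> C1 * real x / (real q * real L) * (ln (real x) / ln (real q)) powr (1 / 2)"
    using sum_weight_multiples by blast
  obtain C2 where C2: "C2 > 0" "\<And>i D. i \<ge> 1 \<Longrightarrow> finite D \<Longrightarrow> card D + 1 = j + 1 \<Longrightarrow> (\<And>d. d \<in> D \<Longrightarrow> d > 0) \<Longrightarrow>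
    real (card {q \<in> {2 ^ i..<2 ^ Suc i}. prime q \<and> (\<forall>d\<in>D. prime (q * d + 1))})
    \<le> C2 * 2 ^ i / real i ^ (j + 1) * Euler_prod (exceptional D \<inter> {..2 ^ i}) ^ (j + 1)"
    using prime_tuple_sieve[of "j + 1"] by auto
  obtain C3 where C3: "C3 > 0" "\<And>i X. i \<ge> 1 \<Longrightarrow>
    (\<Sum>m\<in>smooth_upto (2 ^ (i + 3)) X. 1 / real m * (\<Sum>D\<in>divisor_sets j m. Euler_prod (exceptional D \<inter> {..2 ^ i}) ^ (j + 1)))
    \<le> C3 * real i ^ (2 ^ j)"
    using block_sum[OF j] by blast
  define C where "C = C1 * C2 * C3 / ln 2 * (1 / ln 2) powr (1 / 2)"
  have Cpos: "C > 0" using C1(1) C2(1) C3(1) by (simp add: C_def)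
  have main: "(\<Sum>q | q \<in> {2 ^ i..<2 ^ Suc i} \<and> prime q \<and> q \<le> x. \<Sum>n\<in>{1..x}. (3 / 2) ^ card {p \<in> prime_factors n. q \<le> p} * real (card (cofactors q n) choose j))
    \<le> C * real x * (real i ^ (2 ^ j) / real i ^ (j + 2)) * (ln (real x) / real i) powr (1 / 2)" if i: "i \<ge> 1" for i x
  proof -
    define y where "y = (2::nat) ^ (i + 3)"
    define Q where "Q = {q. q \<in> {2 ^ i..<2 ^ Suc i} \<and> prime q \<and> q \<le> x}"
    define sing where "sing = (\<lambda>D. Euler_prod (exceptional D \<inter> {..2 ^ i}) ^ (j + 1))"
    define W where "W = (\<lambda>(q::nat) (n::nat). (3 / 2 :: real) ^ card {p \<in> prime_factors n. q \<le> p})"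
    define R where "R = (1 / ln 2) powr (1 / 2) * (ln (real x) / real i) powr (1 / 2)"
    \<comment> \<open>\<open>DD\<close> holds all candidate sets and depends neither on q nor on n,
      so that summations can be exchanged; the dependence on q is confined to
      \<open>ok\<close>.\<close>
    define DD where "DD = {D. D \<subseteq> smooth_upto y x \<and> card D = j \<and> Lcm D \<in> smooth_upto y x}"
    define ok where "ok = (\<lambda>(q::nat) (D::nat set). \<forall>d\<in>D. prime (q * d + 1) \<and> (\<forall>p. prime p \<and> p dvd d \<longrightarrow> p \<le> q))"
    have R0: "R \<ge> 0" by (simp add: R_def)
    have W0: "W q n \<ge> 0" for q n by (simp add: W_def)
    have finQ: "finite Q" by (simp add: Q_def)
    have finDD: "finite DD" by (rule finite_subset[of _ "Pow (smooth_upto y x)"]) (auto simp: DD_def)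
    have finD: "finite D" if "D \<in> DD" for D
      using that finite_subset[OF _ finite_smooth_upto] by (auto simp: DD_def)
    have Dpos: "d > 0" if "D \<in> DD" "d \<in> D" for D d using that by (auto simp: DD_def smooth_upto_def)
    have Lpos: "Lcm D > 0" if "D \<in> DD" for D using that by (simp add: DD_def smooth_upto_def)
    have single: "(\<Sum>n\<in>{1..x}. W q n * real (card (cofactors q n) choose j)) \<le> C1 * real x / 2 ^ i * R * (\<Sum>D | D \<in> DD \<and> ok q D. 1 / real (Lcm D))"
      if q: "q \<in> Q" for q
    proof -
      have qp: "prime q" "q \<le> x" "2 ^ i \<le> q" "q < 2 ^ Suc i" using q by (auto simp: Q_def)
      have q2: "q \<ge> 2" using qp(1) by (rule prime_ge_2_nat)
      have qy: "q \<le> y" using qp(4) unfolding y_def by (simp add: power_add)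
      define G where "G = (\<lambda>n. {D. D \<subseteq> cofactors q n \<and> card D = j})"
      have "(\<Sum>n\<in>{1..x}. W q n * real (card (cofactors q n) choose j)) = (\<Sum>n\<in>{1..x}. \<Sum>D\<in>G n. W q n)"
        unfolding G_def by (rule sum.cong[OF refl]) (simp add: n_subsets finite_cofactors mult.commute)
      also have "\<dots> \<le> (\<Sum>n\<in>{1..x}. \<Sum>D | D \<in> {D \<in> DD. ok q D} \<and> q * Lcm D dvd n. W q n)"
      proof (rule sum_mono, rule sum_mono2)
        fix n assume n: "n \<in> {1..x}"
        show "G n \<subseteq> {D. D \<in> {D \<in> DD. ok q D} \<and> q * Lcm D dvd n}"
        proof
          fix D assume "D \<in> G n"
          then have D: "D \<subseteq> cofactors q n" "card D = j" by (auto simp: G_def)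
          have Dd: "q * d dvd n" "prime (q * d + 1)" "\<And>p. prime p \<Longrightarrow> p dvd d \<Longrightarrow> p \<le> q" if "d \<in> D" for d
            using D(1) that by (auto simp: cofactors_def)
          have finD: "finite D" using D(1) finite_cofactors[of n q] n finite_subset by auto
          have D_ne: "D \<noteq> {}" using D(2) j by auto
          then have qn: "q dvd n" using Dd(1) by (meson all_not_in_conv dvd_mult_left)
          then obtain n' where n': "n = q * n'" by (elim dvdE)
          have n'0: "n' > 0" using n n' by (auto intro: gr0I)
          have dn': "d dvd n'" if "d \<in> D" for d
            using Dd(1)[OF that] q2 unfolding n' by simp
          then have Ln': "Lcm D dvd n'" by (intro Lcm_least)
          have n'x: "n' \<le> x"
          proof -
            have "1 * n' \<le> q * n'" using q2 by (intro mult_le_mono1) simp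
            moreover have "q * n' \<le> x" using n n' by simp
            ultimately show ?thesis by linarith
          qed
          have smooth: "d \<in> smooth_upto y x" if d: "d \<in> D" for d
            unfolding smooth_upto_def
          proof (intro CollectI conjI allI impI)
            show "0 < d" using dn'[OF d] n'0 by (auto intro: gr0I)
            show "d \<le> x" using dvd_imp_le[OF dn'[OF d] n'0] n'x by simp
            show "p \<le> y" if "prime p \<and> p dvd d" for p
            proof -
              have "p \<le> q" using Dd(3)[OF d] that by blast
              then show ?thesis using qy by linarith
            qed
          qed
          have "Lcm D \<in> smooth_upto y x"
            unfolding smooth_upto_def
          proof (intro CollectI conjI allI impI)
            show "0 < Lcm D" using Ln' n'0 by (auto intro: gr0I)
            show "Lcm D \<le> x" using dvd_imp_le[OF Ln' n'0] n'x by simp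
            fix p assume p: "prime p \<and> p dvd Lcm D"
            have "Lcm D dvd \<Prod>D" by (intro Lcm_least dvd_prodI finD)
            then have "p dvd \<Prod>D" using p dvd_trans by blast
            then obtain d where "d \<in> D" "p dvd d" using p finD by (auto simp: prime_dvd_prod_iff)
            then show "p \<le> y" using Dd(3)[of d p] p qy by linarith
          qed
          then have "D \<in> DD" using smooth D(2) by (auto simp: DD_def)
          moreover have "ok q D" unfolding ok_def using Dd(2,3) by blast
          moreover have "q * Lcm D dvd n" unfolding n' using Ln' by simp
          ultimately show "D \<in> {D. D \<in> {D \<in> DD. ok q D} \<and> q * Lcm D dvd n}" by blast
        qed
      qed (use finDD W0 in auto)
      also have "\<dots> = (\<Sum>D | D \<in> DD \<and> ok q D. \<Sum>n | n \<in> {1..x} \<and> q * Lcm D dvd n. W q n)"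
        by (subst sum.swap_restrict) (use finDD in auto)
      also have "\<dots> \<le> (\<Sum>D | D \<in> DD \<and> ok q D. C1 * real x / 2 ^ i * R * (1 / real (Lcm D)))"
      proof (rule sum_mono)
        fix D assume D: "D \<in> {D. D \<in> DD \<and> ok q D}"
        have "(\<Sum>n | n \<in> {1..x} \<and> q * Lcm D dvd n. W q n) \<le> C1 * real x / (real q * real (Lcm D)) * (ln (real x) / ln (real q)) powr (1 / 2)"
          unfolding W_def
        proof (rule C1(2)[OF qp(1,2)])
          show "Lcm D > 0" using Lpos D by blast
          fix p :: nat assume p: "prime p" "p dvd Lcm D"
          have fD: "finite D" using finD D by blast
          have "Lcm D dvd \<Prod>D" by (intro Lcm_least dvd_prodI fD)
          then have "p dvd \<Prod>D" using p dvd_trans by blast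
          then obtain d where "d \<in> D" "p dvd d" using p fD by (auto simp: prime_dvd_prod_iff)
          then show "p \<le> q" using D p by (auto simp: ok_def)
        qed
        also have "\<dots> \<le> C1 * real x / (2 ^ i * real (Lcm D)) * R"
        proof (rule mult_mono)
          have "(2::real) ^ i \<le> real q" using qp(3) by (metis of_nat_le_iff of_nat_numeral of_nat_power)
          then show "C1 * real x / (real q * real (Lcm D)) \<le> C1 * real x / (2 ^ i * real (Lcm D))"
            using C1(1) Lpos D q2 by (intro divide_left_mono mult_right_mono mult_pos_pos) auto
          have "real i * ln 2 \<le> ln (real q)"
          proof -
            have "ln ((2::real) ^ i) \<le> ln (real q)" using \<open>2 ^ i \<le> real q\<close> by (intro ln_mono) auto
            then show ?thesis by (simp add: ln_realpow)
          qed
          moreover have "real i * ln 2 > 0" using i by simp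
          ultimately have "ln (real x) / ln (real q) \<le> ln (real x) / (real i * ln 2)"
            using qp(2) q2 i by (intro divide_left_mono mult_pos_pos) auto
          then have "(ln (real x) / ln (real q)) powr (1 / 2) \<le> (ln (real x) / (real i * ln 2)) powr (1 / 2)"
            using qp(2) q2 by (intro powr_mono2) auto
          also have "ln (real x) / (real i * ln 2) = (1 / ln 2) * (ln (real x) / real i)" by simp
          also have "\<dots> powr (1 / 2) = R" unfolding R_def by (rule powr_mult)
          finally show "(ln (real x) / ln (real q)) powr (1 / 2) \<le> R" .
        qed (use C1(1) in auto)
        finally show "(\<Sum>n | n \<in> {1..x} \<and> q * Lcm D dvd n. W q n) \<le> C1 * real x / 2 ^ i * R * (1 / real (Lcm D))"
          by (simp add: mult_ac)
      qed
      also have "\<dots> = C1 * real x / 2 ^ i * R * (\<Sum>D | D \<in> DD \<and> ok q D. 1 / real (Lcm D))"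
        by (simp only: sum_distrib_left)
      finally show ?thesis .
    qed
    have DL: "(\<Sum>D\<in>DD. sing D / real (Lcm D)) \<le> 1 / (real i * ln 2) * (C3 * real i ^ (2 ^ j))"
    proof -
      define S where "S = smooth_upto y (x * y)"
      have s0: "sing D \<ge> 0" for D unfolding sing_def
      proof (intro zero_le_power prod_nonneg)
        fix p assume "p \<in> exceptional D \<inter> {..2 ^ i}"
        then have "p > 1" using prime_gt_1_nat by (auto simp: exceptional_def)
        then show "0 \<le> 1 / (1 - 1 / real p)" by simp
      qed
      have yl: "ln (real y) \<ge> real i * ln 2"
      proof -
        have "ln (real y) = real (i + 3) * ln 2" unfolding y_def by (simp only: of_nat_power of_nat_numeral ln_realpow)
        then show ?thesis by simp
      qed
      have il: "real i * ln 2 > 0" using i by simp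
      have "(\<Sum>D\<in>DD. sing D / real (Lcm D)) \<le> (\<Sum>D\<in>DD. 1 / (real i * ln 2) * (\<Sum>m | m \<in> S \<and> Lcm D dvd m. sing D / real m))"
      proof (rule sum_mono)
        fix D assume D: "D \<in> DD"
        have "ln (real y) / real (Lcm D) \<le> (\<Sum>m | m \<in> S \<and> Lcm D dvd m. 1 / real m)"
          unfolding S_def by (rule sum_reciprocal_multiples) (use D in \<open>auto simp: DD_def y_def\<close>)
        moreover have "(real i * ln 2) / real (Lcm D) \<le> ln (real y) / real (Lcm D)"
          by (rule divide_right_mono[OF yl]) simp
        ultimately have "(real i * ln 2) / real (Lcm D) \<le> (\<Sum>m | m \<in> S \<and> Lcm D dvd m. 1 / real m)" by linarith
        then have "sing D / (real i * ln 2) * ((real i * ln 2) / real (Lcm D)) \<le> sing D / (real i * ln 2) * (\<Sum>m | m \<in> S \<and> Lcm D dvd m. 1 / real m)"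
          by (rule mult_left_mono) (use s0 il in simp)
        moreover have "sing D / (real i * ln 2) * ((real i * ln 2) / real (Lcm D)) = sing D / real (Lcm D)"
          using i by simp
        moreover have "sing D / (real i * ln 2) * (\<Sum>m | m \<in> S \<and> Lcm D dvd m. 1 / real m) = 1 / (real i * ln 2) * (\<Sum>m | m \<in> S \<and> Lcm D dvd m. sing D / real m)"
          by (simp add: sum_distrib_left)
        ultimately show "sing D / real (Lcm D) \<le> 1 / (real i * ln 2) * (\<Sum>m | m \<in> S \<and> Lcm D dvd m. sing D / real m)" by linarith
      qed
      also have "\<dots> = 1 / (real i * ln 2) * (\<Sum>D\<in>DD. \<Sum>m | m \<in> S \<and> Lcm D dvd m. sing D / real m)"
        by (simp only: sum_distrib_left)
      finally have 1: "(\<Sum>D\<in>DD. sing D / real (Lcm D)) \<le> 1 / (real i * ln 2) * (\<Sum>D\<in>DD. \<Sum>m | m \<in> S \<and> Lcm D dvd m. sing D / real m)" .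
      have "(\<Sum>D\<in>DD. \<Sum>m | m \<in> S \<and> Lcm D dvd m. sing D / real m) = (\<Sum>m\<in>S. \<Sum>D | D \<in> DD \<and> Lcm D dvd m. sing D / real m)"
        by (rule sum.swap_restrict) (use finDD in \<open>auto simp: S_def\<close>)
      also have "\<dots> \<le> (\<Sum>m\<in>S. \<Sum>D\<in>divisor_sets j m. sing D / real m)"
      proof (rule sum_mono, rule sum_mono2)
        fix m assume m: "m \<in> S"
        show "finite (divisor_sets j m)" by (rule finite_divisor_sets) (use m in \<open>auto simp: S_def smooth_upto_def\<close>)
        show "{D. D \<in> DD \<and> Lcm D dvd m} \<subseteq> divisor_sets j m"
          unfolding DD_def divisor_sets_def using dvd_trans[OF dvd_Lcm] by blast
      qed (use s0 in auto)
      also have "\<dots> = (\<Sum>m\<in>S. 1 / real m * (\<Sum>D\<in>divisor_sets j m. sing D))"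
        by (simp add: sum_distrib_left)
      also have "\<dots> \<le> C3 * real i ^ (2 ^ j)"
        unfolding S_def y_def sing_def by (rule C3(2)[OF i])
      finally have "1 / (real i * ln 2) * (\<Sum>D\<in>DD. \<Sum>m | m \<in> S \<and> Lcm D dvd m. sing D / real m) \<le> 1 / (real i * ln 2) * (C3 * real i ^ (2 ^ j))"
        by (rule mult_left_mono) simp
      with 1 show ?thesis by (rule order_trans)
    qed
    have "(\<Sum>q\<in>Q. \<Sum>n\<in>{1..x}. W q n * real (card (cofactors q n) choose j))
      \<le> (\<Sum>q\<in>Q. C1 * real x / 2 ^ i * R * (\<Sum>D | D \<in> DD \<and> ok q D. 1 / real (Lcm D)))"
      by (rule sum_mono[OF single])
    also have "\<dots> = C1 * real x / 2 ^ i * R * (\<Sum>q\<in>Q. \<Sum>D | D \<in> DD \<and> ok q D. 1 / real (Lcm D))"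
      by (simp only: sum_distrib_left)
    also have "(\<Sum>q\<in>Q. \<Sum>D | D \<in> DD \<and> ok q D. 1 / real (Lcm D)) = (\<Sum>D\<in>DD. \<Sum>q | q \<in> Q \<and> ok q D. 1 / real (Lcm D))"
      by (rule sum.swap_restrict[OF finQ finDD])
    also have "C1 * real x / 2 ^ i * R * (\<Sum>D\<in>DD. \<Sum>q | q \<in> Q \<and> ok q D. 1 / real (Lcm D))
      \<le> C1 * real x / 2 ^ i * R * (\<Sum>D\<in>DD. C2 * 2 ^ i / real i ^ (j + 1) * (sing D / real (Lcm D)))"
    proof (rule mult_left_mono, rule sum_mono)
      fix D assume D: "D \<in> DD"
      have "card {q. q \<in> Q \<and> ok q D} \<le> card {q \<in> {2 ^ i..<2 ^ Suc i}. prime q \<and> (\<forall>d\<in>D. prime (q * d + 1))}"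
        by (rule card_mono) (auto simp: Q_def ok_def)
      then have "real (card {q. q \<in> Q \<and> ok q D}) \<le> real (card {q \<in> {2 ^ i..<2 ^ Suc i}. prime q \<and> (\<forall>d\<in>D. prime (q * d + 1))})"
        by (rule of_nat_mono)
      also have "\<dots> \<le> C2 * 2 ^ i / real i ^ (j + 1) * sing D"
        unfolding sing_def
      proof (rule C2(2)[OF i])
        show "finite D" by (rule finD) fact
        show "card D + 1 = j + 1" using D by (simp add: DD_def)
        show "d > 0" if "d \<in> D" for d by (rule Dpos[OF D that])
      qed
      finally have "real (card {q. q \<in> Q \<and> ok q D}) / real (Lcm D) \<le> C2 * 2 ^ i / real i ^ (j + 1) * sing D / real (Lcm D)"
        by (rule divide_right_mono) simp
      then show "(\<Sum>q | q \<in> Q \<and> ok q D. 1 / real (Lcm D)) \<le> C2 * 2 ^ i / real i ^ (j + 1) * (sing D / real (Lcm D))" by simp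
    qed (use C1(1) R0 in simp)
    also have "\<dots> = C1 * real x / 2 ^ i * R * (C2 * 2 ^ i / real i ^ (j + 1) * (\<Sum>D\<in>DD. sing D / real (Lcm D)))"
      by (simp only: sum_distrib_left)
    also have "\<dots> \<le> C1 * real x / 2 ^ i * R * (C2 * 2 ^ i / real i ^ (j + 1) * (1 / (real i * ln 2) * (C3 * real i ^ (2 ^ j))))"
      by (intro mult_left_mono DL) (use C1(1) C2(1) R0 in auto)
    also have "\<dots> = C * real x * (real i ^ (2 ^ j) / real i ^ (j + 2)) * (ln (real x) / real i) powr (1 / 2)"
    proof -
      have alg: "c1 * t / a * (r1 * r2) * (c2 * a / b * (1 / (u * l) * (c3 * e))) = (c1 * c2 * c3 / l * r1) * t * (e / (b * u)) * r2"
        if "a \<noteq> 0" for c1 c2 c3 t a r1 r2 b u l e :: real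
        using that by (simp add: mult_ac)
      have "real i ^ (j + 2) = real i ^ (j + 1) * real i" by simp
      then show ?thesis unfolding C_def R_def by (simp only: alg[of "2 ^ i"] power_not_zero zero_neq_numeral[symmetric] not_False_eq_True)
    qed
    finally show ?thesis by (simp only: Q_def W_def)
  qed
  show ?thesis by (rule that[OF Cpos main])
qed

section \<open>From blocks to the j-th moment\<close>

lemma sum_inverse_sqrt_le: "(\<Sum>i\<in>{1..n}. 1 / sqrt (real i)) \<le> 2 * sqrt (real n)"
proof (induction n)
  case (Suc n)
  have "1 / sqrt (real (Suc n)) \<le> 2 * sqrt (real (Suc n)) - 2 * sqrt (real n)"
  proof -
    define a b where "a = sqrt (real (Suc n))" and "b = sqrt (real n)"
    have ab: "a > 0" "b \<ge> 0" "a\<^sup>2 = b\<^sup>2 + 1" by (simp_all add: a_def b_def)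
    have "2 * a * b \<le> a\<^sup>2 + b\<^sup>2" using sum_squares_bound[of a b] by simp
    then have "1 \<le> (2 * a - 2 * b) * a" using ab(3) by (simp add: power2_eq_square algebra_simps)
    then show ?thesis unfolding a_def[symmetric] b_def[symmetric] using ab(1) by (simp add: divide_le_eq)
  qed
  then show ?case using Suc by simp
qed simp

lemma geometric_partial_le:
  fixes x :: real
  assumes "0 \<le> x" "x < 1"
  shows "(\<Sum>r\<in>{1..K}. x ^ r) \<le> x / (1 - x)"
proof -
  have "(\<Sum>r\<in>{1..K}. x ^ r) = (x - x ^ Suc K) / (1 - x)"
    using sum_gp[of x 1 K] assms by (auto simp: field_simps)
  also have "\<dots> \<le> x / (1 - x)" using assms by (intro divide_right_mono) auto
  finally show ?thesis .
qed

text \<open>The geometric weights make the number of summands irrelevant.\<close>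
lemma power_sum_rank_weights:
  fixes a :: "nat \<Rightarrow> real"
  assumes fin: "finite Q" and a: "\<And>q. a q \<ge> 0" and j: "j \<ge> 1" and \<gamma>: "\<gamma> > 1"
  shows "(\<Sum>q\<in>Q. a q) ^ j \<le> (1 / (\<gamma> powr (1 / real j) - 1)) ^ j * (\<Sum>q\<in>Q. \<gamma> ^ card {p \<in> Q. q \<le> p} * a q ^ j)"
proof (cases "Q = {}")
  case True
  then show ?thesis using j by (simp add: power_0_left)
next
  case False
  define \<beta> where "\<beta> = \<gamma> powr (1 / real j)"
  define r where "r = (\<lambda>q. card {p \<in> Q. q \<le> p})"
  define b where "b = (\<lambda>q. \<beta> ^ r q * a q)"
  have \<beta>1: "\<beta> > 1" unfolding \<beta>_def using \<gamma> j by (intro gr_one_powr) auto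
  have \<beta>j: "\<beta> ^ j = \<gamma>" unfolding \<beta>_def using \<gamma> j by (simp add: powr_realpow[symmetric] powr_powr)
  have b0: "b q \<ge> 0" for q using a \<beta>1 by (simp add: b_def)
  \<comment> \<open>The ranks \<open>r q\<close> are distinct, so the inverse weights form part of a
    geometric series. All weighted terms are bounded by the largest, and the j-th power of the
    largest by the sum of all j-th powers.\<close>
  obtain q0 where q0: "q0 \<in> Q" "\<And>q. q \<in> Q \<Longrightarrow> b q \<le> b q0"
  proof -
    have "Max (b ` Q) \<in> b ` Q" using fin False by (intro Max_in) auto
    then obtain q0 where q0: "Max (b ` Q) = b q0" "q0 \<in> Q" by (rule imageE)
    have "b q \<le> b q0" if "q \<in> Q" for q
      unfolding q0(1)[symmetric] by (rule Max_ge) (use fin that in auto)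
    then show ?thesis using that q0(2) by blast
  qed
  have r_less: "r q' < r q" if "q \<in> Q" "q' \<in> Q" "q < q'" for q q'
    unfolding r_def
  proof (rule psubset_card_mono)
    have "{p \<in> Q. q' \<le> p} \<subseteq> {p \<in> Q. q \<le> p}" using that(3) by auto
    moreover have "q \<in> {p \<in> Q. q \<le> p}" "q \<notin> {p \<in> Q. q' \<le> p}" using that by auto
    ultimately show "{p \<in> Q. q' \<le> p} \<subset> {p \<in> Q. q \<le> p}" by blast
  qed (use fin in simp)
  have inj: "inj_on r Q"
  proof (rule inj_onI)
    fix q q' assume qq: "q \<in> Q" "q' \<in> Q" "r q = r q'"
    show "q = q'"
      using r_less[OF qq(1,2)] r_less[OF qq(2,1)] qq(3) by linarith
  qed
  have sub: "r ` Q \<subseteq> {1..card Q}"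
  proof
    fix k assume "k \<in> r ` Q"
    then obtain q where q: "q \<in> Q" "k = r q" by auto
    have "r q > 0" unfolding r_def card_gt_0_iff using fin q by auto
    moreover have "r q \<le> card Q" unfolding r_def by (rule card_mono) (use fin in auto)
    ultimately show "k \<in> {1..card Q}" using q by simp
  qed
  have "(\<Sum>q\<in>Q. (1 / \<beta>) ^ r q) = (\<Sum>k\<in>r ` Q. (1 / \<beta>) ^ k)" by (simp add: sum.reindex[OF inj])
  also have "\<dots> \<le> (\<Sum>k\<in>{1..card Q}. (1 / \<beta>) ^ k)" by (rule sum_mono2) (use sub \<beta>1 in auto)
  also have "\<dots> \<le> (1 / \<beta>) / (1 - 1 / \<beta>)" by (rule geometric_partial_le) (use \<beta>1 in auto)
  also have "\<dots> = 1 / (\<beta> - 1)" using \<beta>1 by (simp add: field_simps)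
  finally have w: "(\<Sum>q\<in>Q. (1 / \<beta>) ^ r q) \<le> 1 / (\<beta> - 1)" .
  have "(\<Sum>q\<in>Q. a q) = (\<Sum>q\<in>Q. (1 / \<beta>) ^ r q * b q)"
    using \<beta>1 by (simp add: b_def power_one_over)
  also have "\<dots> \<le> (\<Sum>q\<in>Q. (1 / \<beta>) ^ r q * b q0)"
    by (intro sum_mono mult_left_mono q0) (use \<beta>1 in auto)
  also have "\<dots> = (\<Sum>q\<in>Q. (1 / \<beta>) ^ r q) * b q0" by (simp only: sum_distrib_right)
  also have "\<dots> \<le> 1 / (\<beta> - 1) * b q0" by (rule mult_right_mono[OF w b0])
  finally have "(\<Sum>q\<in>Q. a q) ^ j \<le> (1 / (\<beta> - 1) * b q0) ^ j"
    by (rule power_mono) (rule sum_nonneg, rule a)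
  also have "\<dots> = (1 / (\<beta> - 1)) ^ j * b q0 ^ j" by (rule power_mult_distrib)
  also have "\<dots> \<le> (1 / (\<beta> - 1)) ^ j * (\<Sum>q\<in>Q. b q ^ j)"
    using member_le_sum[OF q0(1), of "\<lambda>q. b q ^ j"] fin b0 \<beta>1 by (intro mult_left_mono) auto
  also have "(\<Sum>q\<in>Q. b q ^ j) = (\<Sum>q\<in>Q. \<gamma> ^ r q * a q ^ j)"
  proof -
    have "(\<beta> ^ r q) ^ j = \<gamma> ^ r q" for q
      unfolding \<beta>j[symmetric] by (simp only: power_mult[symmetric] mult.commute)
    then show ?thesis by (simp add: b_def power_mult_distrib)
  qed
  finally show ?thesis by (simp only: r_def \<beta>_def)
qed

text \<open>Binomial coefficients count sets of distinct cofactors, which the sieve can handle. For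
  a < j the j-th one vanishes and the linear term takes over.\<close>

lemma power_le_binomial:
  assumes "j \<ge> 1"
  shows "real a ^ j \<le> real j ^ j * (real (a choose 1) + real (a choose j))"
proof (cases "j \<le> a")
  case True
  have "(real a / real j) ^ j \<le> real (a choose j)" by (rule binomial_ge_n_over_k_pow_k[OF True])
  then have "real a ^ j \<le> real j ^ j * real (a choose j)" using assms by (simp add: power_divide divide_le_eq mult.commute)
  also have "\<dots> \<le> real j ^ j * (real (a choose 1) + real (a choose j))" by (intro mult_left_mono) auto
  finally show ?thesis .
next
  case False
  obtain i where i: "j = Suc i" using assms by (cases j) auto
  have "real a ^ j = real a ^ i * real a" by (simp add: i)
  also have "\<dots> \<le> real j ^ i * real a" using False by (intro mult_right_mono power_mono) auto
  also have "\<dots> \<le> real j ^ j * real a" using assms by (intro mult_right_mono power_increasing) (auto simp: i)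
  also have "\<dots> \<le> real j ^ j * (real (a choose 1) + real (a choose j))" by (intro mult_left_mono) auto
  finally show ?thesis .
qed

lemma largest_prime_factor_cofactor:
  assumes m: "m dvd n" "n > 0" "prime (m + 1)" "m > 1"
  obtains q d where "prime q" "m = q * d" "d \<in> cofactors q n" "\<And>r. prime r \<Longrightarrow> r dvd m \<Longrightarrow> r \<le> q" "q \<le> n"
proof -
  have m0: "m > 0" using m by simp
  define q where "q = Max (prime_factors m)"
  have ne: "prime_factors m \<noteq> {}" using m m0 by (simp add: prime_factorization_empty_iff)
  have q: "q \<in> prime_factors m" unfolding q_def by (rule Max_in) (use ne in auto)
  then have qm: "prime q" "q dvd m" by (auto simp: in_prime_factors_iff)
  obtain d where d: "m = q * d" using qm(2) by (elim dvdE)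
  have rq: "r \<le> q" if r: "prime r" "r dvd m" for r
  proof -
    have "r \<in> prime_factors m" using r m0 by (simp add: in_prime_factors_iff)
    then show ?thesis unfolding q_def by (intro Max_ge) auto
  qed
  have "r \<le> q" if r: "prime r" "r dvd d" for r
    by (rule rq[OF r(1)]) (simp add: d r(2))
  moreover have "prime (q * d + 1)" "q * d dvd n" using m unfolding d by auto
  ultimately have "d \<in> cofactors q n" by (simp add: cofactors_def)
  moreover have "q \<le> n" using dvd_trans[OF qm(2) m(1)] m(2) by (rule dvd_imp_le)
  ultimately show ?thesis using that qm(1) d rq by blast
qed

text \<open>The summand 1 accounts for the divisor 1 = 2 - 1, which has no prime factor; any other
  divisor p - 1 is filed under its largest prime factor.\<close>

lemma omega_star_le:
  assumes n: "n > 0"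
  shows "omega_star n \<le> 1 + (\<Sum>q\<in>prime_factors n. card (cofactors q n))"
proof -
  have "{d. d dvd n \<and> (\<exists>p. prime p \<and> d = p - 1)} \<subseteq> {1} \<union> (\<Union>q\<in>prime_factors n. (\<lambda>d. q * d) ` cofactors q n)"
  proof
    fix m assume "m \<in> {d. d dvd n \<and> (\<exists>p. prime p \<and> d = p - 1)}"
    then obtain p where m: "m dvd n" "prime p" "m = p - 1" by auto
    have p: "p = m + 1" using m prime_gt_0_nat[of p] by simp
    show "m \<in> {1} \<union> (\<Union>q\<in>prime_factors n. (\<lambda>d. q * d) ` cofactors q n)"
    proof (cases "m = 1")
      case False
      have m0: "m > 0" using m(1) n by (auto intro: gr0I)
      have "prime (m + 1)" "m > 1" using m(2) p m0 False by simp_all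
      then obtain q d where q: "prime q" "m = q * d" "d \<in> cofactors q n"
        using largest_prime_factor_cofactor[OF m(1) n] by metis
      have "q dvd n" using m(1) unfolding q(2) by (rule dvd_mult_left)
      then have "q \<in> prime_factors n" using q(1) n by (simp add: in_prime_factors_iff)
      then show ?thesis by (intro UnI2 UN_I[of q] image_eqI[of _ _ d] q)
    qed simp
  qed
  then have "omega_star n \<le> card ({1} \<union> (\<Union>q\<in>prime_factors n. (\<lambda>d. q * d) ` cofactors q n))"
    unfolding omega_star_def by (intro card_mono) (use finite_cofactors[OF n] in auto)
  also have "\<dots> \<le> card {1::nat} + card (\<Union>q\<in>prime_factors n. (\<lambda>d. q * d) ` cofactors q n)" by (rule card_Un_le)
  also have "card (\<Union>q\<in>prime_factors n. (\<lambda>d. q * d) ` cofactors q n) \<le> (\<Sum>q\<in>prime_factors n. card ((\<lambda>d. q * d) ` cofactors q n))"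
    by (rule card_UN_le) simp
  also have "\<dots> \<le> (\<Sum>q\<in>prime_factors n. card (cofactors q n))"
    by (intro sum_mono card_image_le finite_cofactors n)
  finally show ?thesis by simp
qed

text \<open>The rank weights reduce the j-th power of the sum over \<open>q\<close> to separate j-th
  powers, and these to numbers of sets of one or of j cofactors, the quantities which
  \<open>block_moment\<close> estimates.\<close>

lemma omega_star_power_le:
  assumes j: "j \<ge> 1"
  obtains C where "C > 0" "\<And>n. n > 0 \<Longrightarrow> real (omega_star n) ^ j \<le>
    C * (1 + (\<Sum>q\<in>prime_factors n. (3 / 2) ^ card {p \<in> prime_factors n. q \<le> p} * (real (card (cofactors q n) choose 1) + real (card (cofactors q n) choose j))))"
proof -
  define K :: real where "K = (1 / ((3 / 2) powr (1 / real j) - 1)) ^ j"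
  define C where "C = 2 ^ j * (1 + K * real j ^ j)"
  have "(3 / 2 :: real) powr (1 / real j) > 1" using j by (intro gr_one_powr) auto
  then have K: "K > 0" by (simp add: K_def)
  have C: "C > 0" unfolding C_def using K by (intro mult_pos_pos add_pos_nonneg) auto
  have main: "real (omega_star n) ^ j \<le>
    C * (1 + (\<Sum>q\<in>prime_factors n. (3 / 2) ^ card {p \<in> prime_factors n. q \<le> p} * (real (card (cofactors q n) choose 1) + real (card (cofactors q n) choose j))))"
    if n: "n > 0" for n
  proof -
    define a where "a = (\<lambda>q. card (cofactors q n))"
    define s where "s = (\<Sum>q\<in>prime_factors n. real (a q))"
    define U where "U = (\<Sum>q\<in>prime_factors n. (3 / 2 :: real) ^ card {p \<in> prime_factors n. q \<le> p} * (real (a q choose 1) + real (a q choose j)))"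
    have s0: "s \<ge> 0" unfolding s_def by (rule sum_nonneg) simp
    have U0: "U \<ge> 0" unfolding U_def by (rule sum_nonneg) simp
    have "real (omega_star n) \<le> real (1 + (\<Sum>q\<in>prime_factors n. a q))"
      unfolding a_def by (rule of_nat_mono[OF omega_star_le[OF n]])
    also have "\<dots> = 1 + s" by (simp add: s_def)
    finally have "real (omega_star n) ^ j \<le> (1 + s) ^ j" by (rule power_mono) simp
    also have "\<dots> \<le> (2 * max 1 s) ^ j" by (rule power_mono) (use s0 in auto)
    also have "\<dots> = 2 ^ j * max 1 s ^ j" by (rule power_mult_distrib)
    also have "max 1 s ^ j \<le> 1 + s ^ j" using s0 by (auto simp: max_def)
    also have "s ^ j \<le> K * (\<Sum>q\<in>prime_factors n. (3 / 2) ^ card {p \<in> prime_factors n. q \<le> p} * real (a q) ^ j)"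
      unfolding s_def K_def by (rule power_sum_rank_weights) (use j in auto)
    also have "(\<Sum>q\<in>prime_factors n. (3 / 2) ^ card {p \<in> prime_factors n. q \<le> p} * real (a q) ^ j)
      \<le> (\<Sum>q\<in>prime_factors n. (3 / 2) ^ card {p \<in> prime_factors n. q \<le> p} * (real j ^ j * (real (a q choose 1) + real (a q choose j))))"
      by (intro sum_mono mult_left_mono power_le_binomial j) auto
    also have "\<dots> = real j ^ j * U" unfolding U_def by (simp add: sum_distrib_left mult_ac)
    finally have "real (omega_star n) ^ j \<le> 2 ^ j * (1 + K * (real j ^ j * U))" using K by simp
    also have "\<dots> \<le> C * (1 + U)"
    proof -
      have "1 + K * (real j ^ j * U) \<le> (1 + K * real j ^ j) * (1 + U)"
        using K U0 by (simp add: algebra_simps)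
      then have "2 ^ j * (1 + K * (real j ^ j * U)) \<le> 2 ^ j * ((1 + K * real j ^ j) * (1 + U))" by (intro mult_left_mono) auto
      then show ?thesis by (simp add: C_def mult.assoc)
    qed
    finally show ?thesis by (simp only: U_def a_def)
  qed
  show ?thesis by (rule that[OF C main])
qed

lemma ln_2_ge_half: "ln (2::real) \<ge> 1 / 2"
proof -
  have "exp (1 / 2 :: real) \<le> 1 + 1 / 2 + (1 / 2) ^ 2" by (rule exp_bound) auto
  then have "exp (1 / 2 :: real) \<le> 2" by (simp add: power2_eq_square)
  then have "ln (exp (1 / 2 :: real)) \<le> ln 2" by (intro ln_mono) auto
  then show ?thesis by simp
qed

lemma two_power_le_imp:
  assumes "2 ^ i \<le> (x::nat)"
  shows "real i \<le> 2 * ln (real x)"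
proof -
  have "(2::real) ^ i \<le> real x" using assms by (metis of_nat_le_iff of_nat_numeral of_nat_power)
  then have "ln ((2::real) ^ i) \<le> ln (real x)" by (intro ln_mono) auto
  then have "real i * ln 2 \<le> ln (real x)" by (simp add: ln_realpow)
  moreover have "real i * (1 / 2) \<le> real i * ln 2" by (rule mult_left_mono[OF ln_2_ge_half]) simp
  ultimately show ?thesis by linarith
qed

lemma dyadic_index:
  assumes "q \<ge> 2"
  obtains i where "i \<ge> 1" "2 ^ i \<le> (q::nat)" "q < 2 ^ Suc i"
proof -
  obtain i where i: "2 ^ i \<le> q" "q < 2 ^ (i + 1)" using ex_power_ivl1[of 2 q] assms by auto
  have "i \<ge> 1" using i(2) assms by (cases i) auto
  then show ?thesis using that i by simp
qed

text \<open>With E = 2^j - j - 1 and T = ln x, block i contributes x i^(E - 1) (T / i)^(1/2). Since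
  i \<le> 2 T, the first factor is at most (2T)^(E - 1), and the sum of i^(-1/2) is O(T^(1/2)), in
  total O(x T^E). The weights thus cost no power of T.\<close>

theorem omega_star_moment:
  assumes j: "j \<ge> 2"
  obtains C where "C > 0" "\<And>x. x \<ge> 2 \<Longrightarrow> (\<Sum>n\<in>{1..x}. real (omega_star n) ^ j) \<le> C * real x * ln (real x) ^ (2 ^ j - j - 1)"
proof -
  obtain C0 where C0: "C0 > 0" "\<And>n. n > 0 \<Longrightarrow> real (omega_star n) ^ j \<le>
    C0 * (1 + (\<Sum>q\<in>prime_factors n. (3 / 2) ^ card {p \<in> prime_factors n. q \<le> p} * (real (card (cofactors q n) choose 1) + real (card (cofactors q n) choose j))))"
    using omega_star_power_le[of j] j by auto
  have j1: "j \<ge> 1" using j by simp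
  obtain C1 where C1: "C1 > 0" "\<And>i x. i \<ge> 1 \<Longrightarrow>
    (\<Sum>q | q \<in> {2 ^ i..<2 ^ Suc i} \<and> prime q \<and> q \<le> x. \<Sum>n\<in>{1..x}. (3 / 2) ^ card {p \<in> prime_factors n. q \<le> p} * real (card (cofactors q n) choose 1))
    \<le> C1 * real x * (real i ^ (2 ^ 1) / real i ^ (1 + 2)) * (ln (real x) / real i) powr (1 / 2)"
    using block_moment[OF order_refl[of 1]] by blast
  obtain C2 where C2: "C2 > 0" "\<And>i x. i \<ge> 1 \<Longrightarrow>
    (\<Sum>q | q \<in> {2 ^ i..<2 ^ Suc i} \<and> prime q \<and> q \<le> x. \<Sum>n\<in>{1..x}. (3 / 2) ^ card {p \<in> prime_factors n. q \<le> p} * real (card (cofactors q n) choose j))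
    \<le> C2 * real x * (real i ^ (2 ^ j) / real i ^ (j + 2)) * (ln (real x) / real i) powr (1 / 2)"
    using block_moment[OF j1] by blast
  \<comment> \<open>From j \<ge> 2 follows E \<ge> 1. This lets the terms with a single cofactor, of
    order 1/i per block before the weight, be dominated by (2T)^(E - 1).\<close>
  define E where "E = 2 ^ j - j - (1::nat)"
  have E1: "E \<ge> 1" and Ej: "2 ^ j = (E - 1) + (j + 2)"
  proof -
    have "j + 2 \<le> 2 ^ j" using j
    proof (induction j rule: dec_induct)
      case (step n)
      then show ?case by simp
    qed simp
    then show "E \<ge> 1" "2 ^ j = (E - 1) + (j + 2)" by (auto simp: E_def)
  qed
  define C where "C = C0 * (2 ^ E + (C1 + C2) * 2 ^ (E - 1) * 3)"
  have Cpos: "C > 0" unfolding C_def using C0(1) C1(1) C2(1) by (intro mult_pos_pos add_pos_pos) auto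
  have main: "(\<Sum>n\<in>{1..x}. real (omega_star n) ^ j) \<le> C * real x * ln (real x) ^ E" if x: "x \<ge> 2" for x
  proof -
    define T where "T = ln (real x)"
    have T: "2 * T \<ge> 1"
    proof -
      have "ln 2 \<le> T" unfolding T_def using x by (intro ln_mono) auto
      then show ?thesis using ln_2_ge_half by linarith
    qed
    have T0: "T > 0" using T by simp
    define I where "I = {i \<in> {1..x}. 2 ^ i \<le> x}"
    define Q where "Q = (\<lambda>i. {q. q \<in> {2 ^ i..<2 ^ Suc i} \<and> prime q \<and> q \<le> x})"
    define W where "W = (\<lambda>(q::nat) (n::nat). (3 / 2 :: real) ^ card {p \<in> prime_factors n. q \<le> p})"
    define V where "V = (\<lambda>q n. W q n * (real (card (cofactors q n) choose 1) + real (card (cofactors q n) choose j)))"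
    have V0: "V q n \<ge> 0" for q n by (simp add: V_def W_def)
    have finQ: "finite (Q i)" for i by (simp add: Q_def)
    have finI: "finite I" by (simp add: I_def)
    have iT: "real i \<le> 2 * T" if "i \<in> I" for i
      using two_power_le_imp[of i x] that by (simp add: I_def T_def)
    have block: "(\<Sum>q\<in>Q i. \<Sum>n\<in>{1..x}. V q n) \<le> (C1 + C2) * real x * (2 * T) ^ (E - 1) * sqrt T * (1 / sqrt (real i))"
      if i: "i \<in> I" for i
    proof -
      have i1: "i \<ge> 1" using i by (simp add: I_def)
      define P where "P = (ln (real x) / real i) powr (1 / 2)"
      have P: "P = sqrt T * (1 / sqrt (real i))" using T0 i1
        by (simp add: P_def T_def powr_half_sqrt real_sqrt_divide)
      have P0: "P \<ge> 0" by (simp add: P_def)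
      have "(\<Sum>q\<in>Q i. \<Sum>n\<in>{1..x}. V q n) = (\<Sum>q\<in>Q i. \<Sum>n\<in>{1..x}. W q n * real (card (cofactors q n) choose 1)) + (\<Sum>q\<in>Q i. \<Sum>n\<in>{1..x}. W q n * real (card (cofactors q n) choose j))"
        by (simp add: V_def distrib_left sum.distrib)
      also have "\<dots> \<le> C1 * real x * (real i ^ (2 ^ 1) / real i ^ (1 + 2)) * P + C2 * real x * (real i ^ (2 ^ j) / real i ^ (j + 2)) * P"
        unfolding Q_def W_def P_def
        by (rule add_mono[OF C1(2)[OF i1, of x] C2(2)[OF i1, of x]])
      also have "real i ^ (2 ^ j) / real i ^ (j + 2) = real i ^ (E - 1)"
        unfolding Ej using i1 by (simp add: power_add)
      also have "C1 * real x * (real i ^ (2 ^ 1) / real i ^ (1 + 2)) * P + C2 * real x * real i ^ (E - 1) * P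
        \<le> C1 * real x * (2 * T) ^ (E - 1) * P + C2 * real x * (2 * T) ^ (E - 1) * P"
      proof (intro add_mono mult_right_mono mult_left_mono)
        have "real i ^ (2 ^ 1) / real i ^ (1 + 2) = 1 / real i" using i1 by (simp add: power_add power2_eq_square)
        also have "\<dots> \<le> 1" using i1 by simp
        also have "1 \<le> (2 * T) ^ (E - 1)" using T by (rule one_le_power)
        finally show "real i ^ (2 ^ 1) / real i ^ (1 + 2) \<le> (2 * T) ^ (E - 1)" .
        show "real i ^ (E - 1) \<le> (2 * T) ^ (E - 1)" using iT[OF i] by (intro power_mono) auto
      qed (use C1(1) C2(1) P0 in auto)
      also have "\<dots> = (C1 + C2) * real x * (2 * T) ^ (E - 1) * sqrt T * (1 / sqrt (real i))"
        unfolding P by (simp add: algebra_simps)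
      finally show ?thesis .
    qed
    have "(\<Sum>n\<in>{1..x}. \<Sum>q\<in>prime_factors n. V q n) \<le> (\<Sum>n\<in>{1..x}. \<Sum>q\<in>primes_le x. V q n)"
    proof (rule sum_mono, rule sum_mono2)
      fix n assume n: "n \<in> {1..x}"
      show "prime_factors n \<subseteq> primes_le x"
      proof
        fix p assume "p \<in> prime_factors n"
        then have "prime p" "p dvd n" by (auto simp: in_prime_factors_iff)
        moreover have "p \<le> n" using \<open>p dvd n\<close> n by (intro dvd_imp_le) auto
        ultimately show "p \<in> primes_le x" using n by simp
      qed
    qed (use V0 in auto)
    also have "\<dots> = (\<Sum>q\<in>primes_le x. \<Sum>n\<in>{1..x}. V q n)" by (rule sum.swap)
    also have "\<dots> \<le> (\<Sum>z\<in>Sigma I Q. \<Sum>n\<in>{1..x}. V (snd z) n)"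
    proof (rule sum_le_included[where i = snd])
      show "\<forall>q\<in>primes_le x. \<exists>z\<in>Sigma I Q. snd z = q \<and> (\<Sum>n\<in>{1..x}. V q n) \<le> (\<Sum>n\<in>{1..x}. V (snd z) n)"
      proof
        fix q assume q: "q \<in> primes_le x"
        then have "q \<ge> 2" using prime_ge_2_nat by blast
        then obtain i where i: "i \<ge> 1" "2 ^ i \<le> q" "q < 2 ^ Suc i" by (rule dyadic_index)
        have "i < 2 ^ i" by (rule less_exp)
        moreover have "q \<le> x" using q by simp
        ultimately have "i \<le> x" "2 ^ i \<le> x" using i(2) by linarith+
        then have "i \<in> I" using i(1) by (simp add: I_def)
        moreover have "q \<in> Q i" using i q by (simp add: Q_def)
        ultimately show "\<exists>z\<in>Sigma I Q. snd z = q \<and> (\<Sum>n\<in>{1..x}. V q n) \<le> (\<Sum>n\<in>{1..x}. V (snd z) n)"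
          by (intro bexI[of _ "(i, q)"]) auto
      qed
    qed (use finI finQ V0 in \<open>auto intro!: sum_nonneg\<close>)
    also have "\<dots> = (\<Sum>i\<in>I. \<Sum>q\<in>Q i. \<Sum>n\<in>{1..x}. V q n)"
      by (subst sum.Sigma) (use finI finQ in \<open>auto simp: split_def\<close>)
    also have "\<dots> \<le> (\<Sum>i\<in>I. (C1 + C2) * real x * (2 * T) ^ (E - 1) * sqrt T * (1 / sqrt (real i)))"
      by (rule sum_mono[OF block])
    also have "\<dots> = (C1 + C2) * real x * (2 * T) ^ (E - 1) * sqrt T * (\<Sum>i\<in>I. 1 / sqrt (real i))"
      by (simp only: sum_distrib_left)
    also have "\<dots> \<le> (C1 + C2) * real x * (2 * T) ^ (E - 1) * sqrt T * (3 * sqrt T)"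
    proof (rule mult_left_mono)
      define K where "K = nat \<lfloor>2 * T\<rfloor>"
      have KT: "real K \<le> 2 * T" unfolding K_def using T by simp
      have "I \<subseteq> {1..K}"
      proof
        fix i assume i: "i \<in> I"
        have "i \<le> K" unfolding K_def using iT[OF i] by (simp add: le_nat_iff le_floor_iff)
        then show "i \<in> {1..K}" using i by (simp add: I_def)
      qed
      then have "(\<Sum>i\<in>I. 1 / sqrt (real i)) \<le> (\<Sum>i\<in>{1..K}. 1 / sqrt (real i))"
        by (intro sum_mono2) auto
      also have "\<dots> \<le> 2 * sqrt (real K)" by (rule sum_inverse_sqrt_le)
      also have "\<dots> \<le> 2 * sqrt (2 * T)" using KT by simp
      also have "\<dots> = 2 * sqrt 2 * sqrt T" by (simp add: real_sqrt_mult)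
      also have "\<dots> \<le> 3 * sqrt T"
      proof (rule mult_right_mono)
        have "sqrt 2 \<le> 3 / 2" by (rule real_le_lsqrt) (auto simp: power2_eq_square)
        then show "2 * sqrt 2 \<le> 3" by simp
      qed (use T0 in simp)
      finally show "(\<Sum>i\<in>I. 1 / sqrt (real i)) \<le> 3 * sqrt T" .
    qed (use C1(1) C2(1) T0 in auto)
    also have "\<dots> = (C1 + C2) * real x * ((2 * T) ^ (E - 1) * (sqrt T * sqrt T)) * 3" by (simp only: mult_ac)
    also have "(2 * T) ^ (E - 1) * (sqrt T * sqrt T) = 2 ^ (E - 1) * T ^ E"
    proof -
      have "Suc (E - 1) = E" using E1 by simp
      then have "T ^ E = T ^ (E - 1) * T" using power_Suc2[of T "E - 1"] by simp
      then show ?thesis using T0 by (simp add: power_mult_distrib)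
    qed
    finally have S: "(\<Sum>n\<in>{1..x}. \<Sum>q\<in>prime_factors n. V q n) \<le> (C1 + C2) * real x * (2 ^ (E - 1) * T ^ E) * 3" .
    have "(\<Sum>n\<in>{1..x}. real (omega_star n) ^ j) \<le> (\<Sum>n\<in>{1..x}. C0 * (1 + (\<Sum>q\<in>prime_factors n. V q n)))"
      unfolding V_def W_def by (rule sum_mono, rule C0(2)) simp
    also have "\<dots> = C0 * (real x + (\<Sum>n\<in>{1..x}. \<Sum>q\<in>prime_factors n. V q n))"
      by (simp add: sum_distrib_left[symmetric] sum.distrib)
    also have "\<dots> \<le> C0 * (real x * (2 ^ E * T ^ E) + (C1 + C2) * real x * (2 ^ (E - 1) * T ^ E) * 3)"
    proof (intro mult_left_mono add_mono S)
      have "1 \<le> (2 * T) ^ E" using T by (rule one_le_power)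
      then have "real x * 1 \<le> real x * (2 ^ E * T ^ E)"
        unfolding power_mult_distrib by (rule mult_left_mono) simp
      then show "real x \<le> real x * (2 ^ E * T ^ E)" by simp
    qed (use C0(1) in simp)
    also have "\<dots> = C * real x * T ^ E" unfolding C_def by (simp add: algebra_simps)
    finally show ?thesis by (simp only: T_def)
  qed
  show ?thesis by (rule that[OF Cpos main[unfolded E_def]])
qed

section \<open>Divisors that are large shifted primes\<close>

text \<open>The exact factor multiplicity + 1 is relaxed to 2^multiplicity because the latter has
  the clean square root sqrt 2 ^ multiplicity, on which \<open>half_weight\<close> is built.\<close>

lemma card_smooth_divisors_le:
  fixes m :: nat
  assumes "finite P" "\<And>p. p \<in> P \<Longrightarrow> prime p" and m: "m > 0"
  shows "card {d. d dvd m \<and> prime_factors d \<subseteq> P} \<le> (\<Prod>p\<in>P. 2 ^ multiplicity p m)"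
  using assms(1,2)
proof (induction P rule: finite_induct)
  case empty
  have "{d. d dvd m \<and> prime_factors d \<subseteq> {}} \<subseteq> {1}"
  proof
    fix d assume d: "d \<in> {d. d dvd m \<and> prime_factors d \<subseteq> {}}"
    then have "d > 0" using m by (auto intro: gr0I)
    moreover have "prime_factors d = {}" using d by blast
    ultimately show "d \<in> {1}" by (simp add: prime_factorization_empty_iff)
  qed
  then have "card {d. d dvd m \<and> prime_factors d \<subseteq> {}} \<le> card {1::nat}" by (intro card_mono) auto
  then show ?case by simp
next
  case (insert p P)
  have p: "prime p" using insert by auto
  have p2: "p \<ge> 2" using p by (rule prime_ge_2_nat)
  define A where "A = {d. d dvd m \<and> prime_factors d \<subseteq> P}"
  have finA: "finite A" by (rule finite_subset[of _ "{d. d dvd m}"]) (use m in \<open>auto simp: A_def\<close>)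
  have "{d. d dvd m \<and> prime_factors d \<subseteq> insert p P} \<subseteq> (\<lambda>(k, d). p ^ k * d) ` ({..multiplicity p m} \<times> A)"
  proof
    fix d assume d: "d \<in> {d. d dvd m \<and> prime_factors d \<subseteq> insert p P}"
    then have d0: "d > 0" using m by (auto intro: gr0I)
    define k where "k = multiplicity p d"
    define e where "e = d div p ^ k"
    have de: "d = p ^ k * e" by (simp add: e_def k_def multiplicity_dvd)
    have e0: "e > 0" using de d0 by (auto intro: gr0I)
    have edvd: "e dvd d" using de by (metis dvd_triv_right)
    have "\<not> p dvd e" unfolding e_def k_def by (rule multiplicity_decompose) (use d0 p in auto)
    then have "prime_factors e \<subseteq> P"
      using d dvd_prime_factors[OF _ edvd] d0 by (auto simp: in_prime_factors_iff)
    moreover have "e dvd m" using edvd d dvd_trans by blast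
    moreover have "k \<le> multiplicity p m" unfolding k_def using d m by (intro dvd_imp_multiplicity_le) auto
    ultimately have "(k, e) \<in> {..multiplicity p m} \<times> A" by (simp add: A_def)
    then have "(\<lambda>(k, d). p ^ k * d) (k, e) \<in> (\<lambda>(k, d). p ^ k * d) ` ({..multiplicity p m} \<times> A)" by (rule imageI)
    then show "d \<in> (\<lambda>(k, d). p ^ k * d) ` ({..multiplicity p m} \<times> A)" using de by simp
  qed
  then have "card {d. d dvd m \<and> prime_factors d \<subseteq> insert p P} \<le> card ({..multiplicity p m} \<times> A)"
    by (rule surj_card_le[rotated]) (use finA in simp)
  also have "\<dots> = Suc (multiplicity p m) * card A" by (simp add: card_cartesian_product)
  also have "\<dots> \<le> 2 ^ multiplicity p m * (\<Prod>p\<in>P. 2 ^ multiplicity p m)"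
  proof (rule mult_le_mono)
    show "Suc (multiplicity p m) \<le> 2 ^ multiplicity p m" by (simp add: Suc_le_eq)
    show "card A \<le> (\<Prod>p\<in>P. 2 ^ multiplicity p m)" unfolding A_def by (rule insert.IH) (use insert in auto)
  qed
  finally show ?case using insert by simp
qed

text \<open>Square root of the factor at p in the bound 2^k (p / (p - 1))^2: number of divisors
  times squared singular series. The root comes from a geometric mean. \<open>max 1\<close> makes
  the function monotone in k for every natural p, also for 0 and 1, where the quotient
  degenerates.\<close>

definition half_weight :: "nat \<Rightarrow> nat \<Rightarrow> real" where
  "half_weight p k = (if k = 0 then 1 else sqrt 2 ^ k * max 1 (1 / (1 - 1 / real p)))"

lemma half_weight_mono: "half_weight p k \<le> half_weight p (Suc k)"
proof -
  define c where "c = max 1 (1 / (1 - 1 / real p))"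
  have c: "c \<ge> 1" by (simp add: c_def)
  have s: "sqrt 2 \<ge> 1" by simp
  have "1 * c \<le> sqrt 2 * c" using c s by (intro mult_right_mono) auto
  then have 1: "1 \<le> sqrt 2 * c" using c by linarith
  have 2: "sqrt 2 ^ k * c \<le> sqrt 2 ^ Suc k * c" using c s by (intro mult_right_mono power_increasing) auto
  show ?thesis using 1 2 by (cases "k = 0") (simp_all add: half_weight_def c_def[symmetric])
qed

text \<open>Only the coefficient of 1/p decides the power of ln y. It is sqrt 2 - 1, from k = 1; the
  factor p / (p - 1) and all higher powers contribute O(1 / p^2), the series converging because sqrt
  2 / p \<le> 3/4.\<close>

lemma half_weight_Euler_factor:
  assumes p: "p \<ge> 2"
  shows "1 + (\<Sum>k\<in>{1..K}. (half_weight p k - half_weight p (k - 1)) / real p ^ k) \<le> 1 + (sqrt 2 - 1) / real p + 20 / real p ^ 2"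
proof -
  define s :: real where "s = sqrt 2"
  define c where "c = 1 / (1 - 1 / real p)"
  have s: "1 \<le> s" "s \<le> 3 / 2"
  proof -
    show "1 \<le> s" by (simp add: s_def)
    show "s \<le> 3 / 2" unfolding s_def by (rule real_le_lsqrt) (auto simp: power2_eq_square)
  qed
  have p': "real p \<ge> 2" using p by simp
  have c_eq: "c = real p / (real p - 1)" using p' by (simp add: c_def field_simps)
  have c: "1 \<le> c" "c \<le> 2" "c \<le> 1 + 2 / real p" unfolding c_eq using p' by (auto simp: field_simps)
  have hw: "half_weight p k = (if k = 0 then 1 else s ^ k * c)" for k
    using c by (simp add: half_weight_def s_def c_def[symmetric])
  show ?thesis
  proof (cases "K = 0")
    case True
    then show ?thesis using s by (simp add: s_def)
  next
    case False
    then have split: "{1..K} = insert 1 {2..K}" by auto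
    have "(\<Sum>k\<in>{1..K}. (half_weight p k - half_weight p (k - 1)) / real p ^ k)
      = (s * c - 1) / real p + (\<Sum>k\<in>{2..K}. (half_weight p k - half_weight p (k - 1)) / real p ^ k)"
      unfolding split by (subst sum.insert) (auto simp: hw)
    also have "(\<Sum>k\<in>{2..K}. (half_weight p k - half_weight p (k - 1)) / real p ^ k) \<le> (\<Sum>k\<in>{2..K}. 2 * (s / real p) ^ k)"
    proof (rule sum_mono)
      fix k assume k: "k \<in> {2..K}"
      have "half_weight p (k - 1) \<ge> 0" using s c by (simp add: hw)
      then have "half_weight p k - half_weight p (k - 1) \<le> s ^ k * 2"
      proof -
        have "half_weight p k = s ^ k * c" using k by (simp add: hw)
        moreover have "s ^ k * c \<le> s ^ k * 2" by (rule mult_left_mono[OF c(2)]) (use s in simp)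
        ultimately show ?thesis using \<open>half_weight p (k - 1) \<ge> 0\<close> by linarith
      qed
      then have "(half_weight p k - half_weight p (k - 1)) / real p ^ k \<le> s ^ k * 2 / real p ^ k"
        by (rule divide_right_mono) simp
      then show "(half_weight p k - half_weight p (k - 1)) / real p ^ k \<le> 2 * (s / real p) ^ k"
        by (simp add: power_divide mult.commute)
    qed
    also have "(\<Sum>k\<in>{2..K}. 2 * (s / real p) ^ k) \<le> 16 / real p ^ 2"
    proof -
      define u where "u = s / real p"
      have u: "0 \<le> u" "u \<le> 3 / 4" using s p' by (auto simp: u_def field_simps)
      have "(\<Sum>k\<in>{2..K}. u ^ k) \<le> u * (\<Sum>k\<in>{1..K}. u ^ k)"
      proof -
        have "(\<Sum>k\<in>{2..K}. u ^ k) = (\<Sum>k\<in>{2..K}. u * u ^ (k - 1))"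
          by (rule sum.cong) (auto simp: power_eq_if)
        also have "\<dots> = u * (\<Sum>k\<in>{2..K}. u ^ (k - 1))" by (simp only: sum_distrib_left)
        also have "\<dots> \<le> u * (\<Sum>k\<in>{1..K}. u ^ k)"
        proof (rule mult_left_mono)
          show "(\<Sum>k\<in>{2..K}. u ^ (k - 1)) \<le> (\<Sum>k\<in>{1..K}. u ^ k)"
            by (rule sum_le_included[where i = Suc]) (use u in \<open>auto intro!: bexI[of _ "_ - 1"]\<close>)
        qed (use u in simp)
        finally show ?thesis .
      qed
      also have "\<dots> \<le> u * (u / (1 - u))"
        by (intro mult_left_mono geometric_partial_le) (use u in auto)
      also have "\<dots> = u ^ 2 * (1 / (1 - u))" by (simp add: power2_eq_square)
      also have "\<dots> \<le> u ^ 2 * 4" using u by (intro mult_left_mono) (auto simp: field_simps)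
      also have "u ^ 2 = 2 / real p ^ 2" by (simp add: u_def power_divide s_def)
      finally have "(\<Sum>k\<in>{2..K}. u ^ k) \<le> 8 / real p ^ 2" by simp
      then have "2 * (\<Sum>k\<in>{2..K}. u ^ k) \<le> 16 / real p ^ 2" by simp
      then show ?thesis by (simp add: sum_distrib_left u_def)
    qed
    also have "(s * c - 1) / real p \<le> (s - 1) / real p + 4 / real p ^ 2"
    proof -
      have "s * c \<le> s * (1 + 2 / real p)" by (rule mult_left_mono[OF c(3)]) (use s in simp)
      also have "\<dots> = s + 2 * s / real p" by (simp add: algebra_simps)
      also have "\<dots> \<le> s + 4 / real p" using s p' by (intro add_left_mono divide_right_mono) auto
      finally have "(s * c - 1) / real p \<le> (s + 4 / real p - 1) / real p" by (intro divide_right_mono) auto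
      also have "\<dots> = (s - 1) / real p + 4 / real p ^ 2" by (simp add: power2_eq_square diff_divide_distrib add_divide_distrib)
      finally show ?thesis .
    qed
    finally show ?thesis by (simp add: s_def)
  qed
qed

lemma sum_half_weight:
  obtains C where "C > 0" "\<And>y N. y \<ge> 2 \<Longrightarrow>
    (\<Sum>n\<in>{1..N}. \<Prod>p\<in>primes_le y. half_weight p (multiplicity p n)) \<le> C * real N * ln (real y) powr (sqrt 2 - 1)"
proof -
  obtain C where C: "C > 0" "\<And>A::nat set. finite A \<Longrightarrow> (\<Sum>k\<in>A. real k powr - 2) \<le> C"
    using sum_powr_bounded[of 2] by auto
  define c where "c = exp ((sqrt 2 - 1) * (3 - ln (ln 2)) + 20 * C)"
  have main: "(\<Sum>n\<in>{1..N}. \<Prod>p\<in>primes_le y. half_weight p (multiplicity p n)) \<le> c * real N * ln (real y) powr (sqrt 2 - 1)"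
    if y: "y \<ge> 2" for y N
  proof -
    define E where "E = (\<lambda>p. 1 + (sqrt 2 - 1) / real p + 20 / real p ^ 2)"
    have "(\<Sum>n\<in>{1..N}. \<Prod>p\<in>primes_le y. half_weight p (multiplicity p n)) \<le> real N * (\<Prod>p\<in>primes_le y. E p)"
    proof (rule multiplicative_mean)
      show "1 + (\<Sum>k\<in>{1..K}. (half_weight p k - half_weight p (k - 1)) / real p ^ k) \<le> E p" if "p \<in> primes_le y" for p K
        unfolding E_def by (rule half_weight_Euler_factor) (use that prime_ge_2_nat in blast)
    qed (auto simp: half_weight_mono, simp add: half_weight_def)
    also have "\<dots> \<le> real N * (c * ln (real y) powr (sqrt 2 - 1))"
    proof (rule mult_left_mono)
      have "(\<Prod>p\<in>primes_le y. E p) \<le> (\<Prod>p\<in>primes_le y. exp ((sqrt 2 - 1) / real p + 20 / real p ^ 2))"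
      proof (rule prod_mono, intro conjI)
        fix p
        show "0 \<le> E p" by (simp add: E_def)
        show "E p \<le> exp ((sqrt 2 - 1) / real p + 20 / real p ^ 2)"
          unfolding E_def add.assoc by (rule exp_ge_add_one_self)
      qed
      also have "\<dots> = exp ((sqrt 2 - 1) * (\<Sum>p\<in>primes_le y. 1 / real p) + 20 * (\<Sum>p\<in>primes_le y. real p powr - 2))"
      proof -
        have "real p powr - 2 = 1 / real p ^ 2" for p
          by (simp add: powr_minus inverse_eq_divide)
        then show ?thesis by (simp add: exp_sum[symmetric] sum.distrib sum_distrib_left)
      qed
      also have "\<dots> \<le> exp ((sqrt 2 - 1) * (ln (ln (real y)) + (3 - ln (ln 2))) + 20 * C)"
        using Mertens_second_upper[OF y] C(2)[of "primes_le y"]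
        by (subst exp_le_cancel_iff, intro add_mono mult_left_mono) auto
      also have "\<dots> = c * ln (real y) powr (sqrt 2 - 1)"
        using y by (simp add: c_def powr_def exp_add[symmetric] algebra_simps)
      finally show "(\<Prod>p\<in>primes_le y. E p) \<le> c * ln (real y) powr (sqrt 2 - 1)" .
    qed simp
    finally show ?thesis by (simp add: mult_ac)
  qed
  have "c > 0" by (simp add: c_def)
  then show ?thesis by (rule that[OF _ main])
qed

text \<open>For n = q m the admissible q number O(2^i / i), and also O(2^i / i^2) times f(m)^2,
  hence O(2^i i^(-3/2) f(m)). Averaging f over m \<le> x / 2^i gives i^(sqrt 2 - 1). The exponent
  sqrt 2 - 5/2 is below -1, so the blocks are summable, whereas counting primes q alone yields just
  1/i per block.\<close>

lemma block_existence:
  obtains C where "C > 0" "\<And>i x. i \<ge> 1 \<Longrightarrow>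
    real (card {n \<in> {1..x}. \<exists>q\<in>{2 ^ i..<2 ^ Suc i}. prime q \<and> cofactors q n \<noteq> {}}) \<le> C * real x * real i powr (sqrt 2 - 5 / 2)"
proof -
  obtain C1 where C1: "C1 > 0" "\<And>i D. i \<ge> 1 \<Longrightarrow> finite D \<Longrightarrow> card D + 1 = 1 \<Longrightarrow> (\<And>d. d \<in> D \<Longrightarrow> d > 0) \<Longrightarrow>
    real (card {q \<in> {2 ^ i..<2 ^ Suc i}. prime q \<and> (\<forall>d\<in>D. prime (q * d + 1))})
    \<le> C1 * 2 ^ i / real i ^ 1 * Euler_prod (exceptional D \<inter> {..2 ^ i}) ^ 1"
    using prime_tuple_sieve[OF order_refl[of 1]] by blast
  have "(1::nat) \<le> 2" by simp
  then obtain C2 where C2: "C2 > 0" "\<And>i D. i \<ge> 1 \<Longrightarrow> finite D \<Longrightarrow> card D + 1 = 2 \<Longrightarrow> (\<And>d. d \<in> D \<Longrightarrow> d > 0) \<Longrightarrow>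
    real (card {q \<in> {2 ^ i..<2 ^ Suc i}. prime q \<and> (\<forall>d\<in>D. prime (q * d + 1))})
    \<le> C2 * 2 ^ i / real i ^ 2 * Euler_prod (exceptional D \<inter> {..2 ^ i}) ^ 2"
    using prime_tuple_sieve[of 2] by blast
  obtain C3 where C3: "C3 > 0" "\<And>y N. y \<ge> 2 \<Longrightarrow>
    (\<Sum>n\<in>{1..N}. \<Prod>p\<in>primes_le y. half_weight p (multiplicity p n)) \<le> C3 * real N * ln (real y) powr (sqrt 2 - 1)"
    using sum_half_weight by blast
  define C where "C = sqrt (C1 * C2) * C3 * 2"
  have Cpos: "C > 0" using C1(1) C2(1) C3(1) by (simp add: C_def)
  have main: "real (card {n \<in> {1..x}. \<exists>q\<in>{2 ^ i..<2 ^ Suc i}. prime q \<and> cofactors q n \<noteq> {}}) \<le> C * real x * real i powr (sqrt 2 - 5 / 2)"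
    if i: "i \<ge> 1" for i x
  proof -
    define y where "y = (2::nat) ^ (i + 1)"
    define X where "X = x div 2 ^ i"
    define DM where "DM = (\<lambda>m. {d. d dvd m \<and> prime_factors d \<subseteq> primes_le y})"
    define B where "B = (\<lambda>d::nat. {q \<in> {2 ^ i..<2 ^ Suc i} :: nat set. prime q \<and> prime (q * d + 1)})"
    define R where "R = (\<lambda>m. \<Union>d\<in>DM m. B d)"
    define f where "f = (\<lambda>m. \<Prod>p\<in>primes_le y. half_weight p (multiplicity p m))"
    define K where "K = sqrt (C1 * C2) * 2 ^ i * real i powr (- (3 / 2))"
    have K0: "K \<ge> 0" using C1(1) C2(1) by (simp add: K_def)
    have i0: "real i > 0" using i by simp
    have finDM: "finite (DM m)" if "m > 0" for m
      by (rule finite_subset[of _ "{d. d dvd m}"]) (use that in \<open>auto simp: DM_def\<close>)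
    have finB: "finite (B d)" for d by (simp add: B_def)
    have f0: "f m \<ge> 0" for m unfolding f_def by (rule prod_nonneg) (simp add: half_weight_def)
    have RK: "real (card (R m)) \<le> K * f m" if m: "m \<in> {1..X}" for m
    proof (rule power2_le_imp_le)
      have m0: "m > 0" using m by simp
      define Pm where "Pm = {p \<in> primes_le y. p dvd m}"
      define S where "S = Euler_prod Pm"
      have finPm: "finite Pm" by (simp add: Pm_def)
      have R1: "real (card (R m)) \<le> C1 * 2 ^ i / real i"
      proof -
        \<comment> \<open>With no d at all, the tuple sieve becomes Chebyshev's bound for the primes
          in one block.\<close>
        have "card (R m) \<le> card {q \<in> {2 ^ i..<2 ^ Suc i}. prime q \<and> (\<forall>d\<in>({}::nat set). prime (q * d + 1))}"
          by (rule card_mono) (auto simp: R_def B_def)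
        then have "real (card (R m)) \<le> real (card {q \<in> {2 ^ i..<2 ^ Suc i}. prime q \<and> (\<forall>d\<in>({}::nat set). prime (q * d + 1))})"
          by (rule of_nat_mono)
        also have "\<dots> \<le> C1 * 2 ^ i / real i ^ 1 * Euler_prod (exceptional {} \<inter> {..2 ^ i}) ^ 1"
          by (rule C1(2)[OF i]) auto
        also have "\<dots> = C1 * 2 ^ i / real i" by (simp add: exceptional_def)
        finally show ?thesis .
      qed
      have Bd: "real (card (B d)) \<le> C2 * 2 ^ i / real i ^ 2 * S ^ 2" if d: "d \<in> DM m" for d
      proof -
        have dm: "d dvd m" using d by (simp add: DM_def)
        have d0: "d > 0" using dm m0 by (auto intro: gr0I)
        have "B d = {q \<in> {2 ^ i..<2 ^ Suc i}. prime q \<and> (\<forall>d'\<in>{d}. prime (q * d' + 1))}" by (simp add: B_def)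
        then have "real (card (B d)) = real (card {q \<in> {2 ^ i..<2 ^ Suc i}. prime q \<and> (\<forall>d'\<in>{d}. prime (q * d' + 1))})" by simp
        also have "\<dots> \<le> C2 * 2 ^ i / real i ^ 2 * Euler_prod (exceptional {d} \<inter> {..2 ^ i}) ^ 2"
          by (rule C2(2)[OF i]) (use d0 in auto)
        also have "\<dots> \<le> C2 * 2 ^ i / real i ^ 2 * S ^ 2"
        proof (intro mult_left_mono power_mono)
          have sub: "exceptional {d} \<inter> {..2 ^ i} \<subseteq> Pm"
            using dm by (auto simp: exceptional_def Pm_def y_def intro: dvd_trans)
          show "Euler_prod (exceptional {d} \<inter> {..2 ^ i}) \<le> S"
            unfolding S_def
          proof (rule prod_mono2[OF finPm sub])
            fix p
            assume "p \<in> Pm - (exceptional {d} \<inter> {..2 ^ i})"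
            then show "1 \<le> 1 / (1 - 1 / real p)" by (intro Euler_factor_ge_1) (simp add: Pm_def)
          next
            fix p
            assume "p \<in> exceptional {d} \<inter> {..2 ^ i}"
            then have "1 \<le> 1 / (1 - 1 / real p)" by (intro Euler_factor_ge_1) (simp add: exceptional_def)
            then show "0 \<le> 1 / (1 - 1 / real p)" by linarith
          qed
          show "0 \<le> Euler_prod (exceptional {d} \<inter> {..2 ^ i})"
          proof (rule prod_nonneg)
            fix p
            assume "p \<in> exceptional {d} \<inter> {..2 ^ i}"
            then have "1 \<le> 1 / (1 - 1 / real p)" by (intro Euler_factor_ge_1) (simp add: exceptional_def)
            then show "0 \<le> 1 / (1 - 1 / real p)" by linarith
          qed
        qed (use C2(1) in simp)
        finally show ?thesis .
      qed
      have R2: "real (card (R m)) \<le> C2 * 2 ^ i / real i ^ 2 * f m ^ 2"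
      proof -
        have "card (R m) \<le> (\<Sum>d\<in>DM m. card (B d))" unfolding R_def by (rule card_UN_le[OF finDM[OF m0]])
        then have "real (card (R m)) \<le> real (\<Sum>d\<in>DM m. card (B d))" by (rule of_nat_mono)
        also have "\<dots> = (\<Sum>d\<in>DM m. real (card (B d)))" by simp
        also have "\<dots> \<le> (\<Sum>d\<in>DM m. C2 * 2 ^ i / real i ^ 2 * S ^ 2)" by (rule sum_mono[OF Bd])
        also have "\<dots> = real (card (DM m)) * (C2 * 2 ^ i / real i ^ 2 * S ^ 2)" by simp
        also have "\<dots> \<le> (\<Prod>p\<in>primes_le y. 2 ^ multiplicity p m) * (C2 * 2 ^ i / real i ^ 2 * S ^ 2)"
        proof (rule mult_right_mono)
          have "card (DM m) \<le> (\<Prod>p\<in>primes_le y. 2 ^ multiplicity p m)"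
            unfolding DM_def by (rule card_smooth_divisors_le) (use m0 in auto)
          then have "real (card (DM m)) \<le> real (\<Prod>p\<in>primes_le y. 2 ^ multiplicity p m)" by (rule of_nat_mono)
          then show "real (card (DM m)) \<le> (\<Prod>p\<in>primes_le y. 2 ^ multiplicity p m)" by simp
        qed (use C2(1) in simp)
        also have "\<dots> = C2 * 2 ^ i / real i ^ 2 * ((\<Prod>p\<in>primes_le y. 2 ^ multiplicity p m) * S ^ 2)" by (simp only: mult_ac)
        also have "(\<Prod>p\<in>primes_le y. 2 ^ multiplicity p m) * S ^ 2 = f m ^ 2"
        proof -
          have S2: "S ^ 2 = (\<Prod>p\<in>primes_le y. if p dvd m then (1 / (1 - 1 / real p)) ^ 2 else 1)"
            unfolding S_def Pm_def prod_power_distrib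
            by (subst prod.inter_filter[symmetric]) auto
          have "f m ^ 2 = (\<Prod>p\<in>primes_le y. half_weight p (multiplicity p m) ^ 2)"
            unfolding f_def by (rule prod_power_distrib)
          also have "\<dots> = (\<Prod>p\<in>primes_le y. 2 ^ multiplicity p m * (if p dvd m then (1 / (1 - 1 / real p)) ^ 2 else 1))"
          proof (rule prod.cong[OF refl])
            fix p assume "p \<in> primes_le y"
            then have p: "prime p" by simp
            show "half_weight p (multiplicity p m) ^ 2 = 2 ^ multiplicity p m * (if p dvd m then (1 / (1 - 1 / real p)) ^ 2 else 1)"
            proof (cases "p dvd m")
              case True
              then have v: "multiplicity p m \<noteq> 0" using p m0 by (simp add: prime_multiplicity_gt_zero_iff)
              have "max 1 (1 / (1 - 1 / real p)) = 1 / (1 - 1 / real p)" using Euler_factor_ge_1[OF p] by linarith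
              then have "half_weight p (multiplicity p m) = sqrt 2 ^ multiplicity p m * (1 / (1 - 1 / real p))"
                using v by (simp only: half_weight_def if_False)
              moreover have "(sqrt 2 ^ multiplicity p m) ^ 2 = (2::real) ^ multiplicity p m"
              proof -
                have "(sqrt 2 ^ multiplicity p m) ^ 2 = (sqrt 2 ^ 2) ^ multiplicity p m"
                  by (simp only: power_mult[symmetric] mult.commute)
                then show ?thesis by simp
              qed
              ultimately show ?thesis using True by (simp only: power_mult_distrib if_True)
            next
              case False
              then have "multiplicity p m = 0" by (rule not_dvd_imp_multiplicity_0)
              then show ?thesis using False by (simp add: half_weight_def)
            qed
          qed
          also have "\<dots> = (\<Prod>p\<in>primes_le y. 2 ^ multiplicity p m) * S ^ 2" unfolding S2 by (rule prod.distrib)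
          finally show ?thesis by (rule sym)
        qed
        finally show ?thesis .
      qed
      have "real (card (R m)) ^ 2 = real (card (R m)) * real (card (R m))" by (rule power2_eq_square)
      also have "\<dots> \<le> (C1 * 2 ^ i / real i) * (C2 * 2 ^ i / real i ^ 2 * f m ^ 2)"
        by (rule mult_mono[OF R1 R2]) (use C1(1) in auto)
      also have "\<dots> = (K * f m) ^ 2"
      proof -
        have e: "(real i powr (- (3 / 2))) ^ 2 = 1 / (real i * real i ^ 2)"
        proof -
          have "(real i powr (- (3 / 2))) ^ 2 = real i powr (- 3)"
            using i0 by (simp add: power2_eq_square powr_add[symmetric])
          also have "\<dots> = 1 / real i powr 3" by (simp add: powr_minus inverse_eq_divide)
          also have "real i powr 3 = real i * real i ^ 2" using i0 by (simp add: power3_eq_cube power2_eq_square)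
          finally show ?thesis .
        qed
        have s: "sqrt (C1 * C2) ^ 2 = C1 * C2" using C1(1) C2(1) by simp
        have "(K * f m) ^ 2 = (C1 * C2) * (2 ^ i * 2 ^ i) * (1 / (real i * real i ^ 2)) * f m ^ 2"
          unfolding K_def power_mult_distrib e s by (simp add: power2_eq_square)
        then show ?thesis by simp
      qed
      finally show "(real (card (R m)))\<^sup>2 \<le> (K * f m)\<^sup>2" .
      show "0 \<le> K * f m" using K0 f0 by simp
    qed
    have finR: "finite (R m)" if "m \<in> {1..X}" for m unfolding R_def using finDM finB that by auto
    \<comment> \<open>Such an n is q m with m \<le> x / 2^i, and the cofactor d divides m and has
      all its primes at most q \<le> y; so n comes from a pair (m, q) with q in
      \<open>R m\<close>.\<close>
    have "{n \<in> {1..x}. \<exists>q\<in>{2 ^ i..<2 ^ Suc i}. prime q \<and> cofactors q n \<noteq> {}} \<subseteq> (\<lambda>(m, q). q * m) ` Sigma {1..X} R"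
    proof
      fix n assume "n \<in> {n \<in> {1..x}. \<exists>q\<in>{2 ^ i..<2 ^ Suc i}. prime q \<and> cofactors q n \<noteq> {}}"
      then obtain q d where n: "n \<in> {1..x}" and q: "q \<in> {2 ^ i..<2 ^ Suc i}" "prime q" and d: "d \<in> cofactors q n" by blast
      have qd: "q * d dvd n" "prime (q * d + 1)" "\<And>p. prime p \<Longrightarrow> p dvd d \<Longrightarrow> p \<le> q"
        using d by (auto simp: cofactors_def)
      have q0: "q > 0" using q(2) by (rule prime_gt_0_nat)
      obtain m where m: "n = q * m" using qd(1) by (metis dvdE dvd_mult_left)
      have m0: "m > 0" using n m by (auto intro: gr0I)
      have dm: "d dvd m" using qd(1) q0 unfolding m by simp
      have "2 ^ i * m \<le> q * m" using q by (intro mult_le_mono1) auto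
      also have "q * m \<le> x" using n m by simp
      finally have "m \<le> X" unfolding X_def by (simp add: less_eq_div_iff_mult_less_eq mult.commute)
      moreover have "d \<in> DM m"
      proof -
        have "p \<le> y" if "prime p" "p dvd d" for p
        proof -
          have "p \<le> q" using qd(3) that .
          also have "q \<le> y" using q(1) by (simp add: y_def)
          finally show ?thesis .
        qed
        then show ?thesis using dm by (auto simp: DM_def in_prime_factors_iff)
      qed
      moreover have "q \<in> B d" using q qd(2) by (simp add: B_def)
      ultimately have "(m, q) \<in> Sigma {1..X} R" using m0 by (auto simp: R_def)
      then have "(\<lambda>(m, q). q * m) (m, q) \<in> (\<lambda>(m, q). q * m) ` Sigma {1..X} R" by (rule imageI)
      then show "n \<in> (\<lambda>(m, q). q * m) ` Sigma {1..X} R" using m by simp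
    qed
    then have "card {n \<in> {1..x}. \<exists>q\<in>{2 ^ i..<2 ^ Suc i}. prime q \<and> cofactors q n \<noteq> {}} \<le> card (Sigma {1..X} R)"
      by (rule surj_card_le[rotated]) (use finR in auto)
    also have "\<dots> = (\<Sum>m\<in>{1..X}. card (R m))" by (rule card_SigmaI) (use finR in auto)
    finally have "real (card {n \<in> {1..x}. \<exists>q\<in>{2 ^ i..<2 ^ Suc i}. prime q \<and> cofactors q n \<noteq> {}}) \<le> real (\<Sum>m\<in>{1..X}. card (R m))"
      by (rule of_nat_mono)
    also have "\<dots> = (\<Sum>m\<in>{1..X}. real (card (R m)))" by simp
    also have "\<dots> \<le> (\<Sum>m\<in>{1..X}. K * f m)" by (rule sum_mono[OF RK])
    also have "\<dots> = K * (\<Sum>m\<in>{1..X}. f m)" by (simp only: sum_distrib_left)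
    also have "\<dots> \<le> K * (C3 * real X * (2 * real i powr (sqrt 2 - 1)))"
    proof (rule mult_left_mono[OF _ K0])
      have y2: "y \<ge> 2" by (simp add: y_def)
      have s: "1 \<le> sqrt 2" "sqrt 2 \<le> 2" by (auto intro!: real_le_lsqrt)
      have "ln (real y) \<le> 2 * real i"
      proof -
        have "ln (real y) = real (i + 1) * ln 2" unfolding y_def by (simp only: of_nat_power of_nat_numeral ln_realpow)
        also have "\<dots> \<le> real (i + 1) * 1" using ln_2_less_1 by (intro mult_left_mono) auto
        also have "\<dots> \<le> 2 * real i" using i by simp
        finally show ?thesis .
      qed
      then have "ln (real y) powr (sqrt 2 - 1) \<le> (2 * real i) powr (sqrt 2 - 1)"
        using y2 s by (intro powr_mono2) auto
      also have "\<dots> = 2 powr (sqrt 2 - 1) * real i powr (sqrt 2 - 1)" by (rule powr_mult)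
      also have "\<dots> \<le> 2 powr 1 * real i powr (sqrt 2 - 1)"
        using s by (intro mult_right_mono powr_mono) auto
      finally have L: "ln (real y) powr (sqrt 2 - 1) \<le> 2 * real i powr (sqrt 2 - 1)" by simp
      have "(\<Sum>m\<in>{1..X}. f m) \<le> C3 * real X * ln (real y) powr (sqrt 2 - 1)" unfolding f_def by (rule C3(2)[OF y2])
      also have "\<dots> \<le> C3 * real X * (2 * real i powr (sqrt 2 - 1))"
        by (rule mult_left_mono[OF L]) (use C3(1) in simp)
      finally show "(\<Sum>m\<in>{1..X}. f m) \<le> C3 * real X * (2 * real i powr (sqrt 2 - 1))" .
    qed
    also have "\<dots> = C * (2 ^ i * real X) * (real i powr (- (3 / 2)) * real i powr (sqrt 2 - 1))"
      unfolding K_def C_def by (simp only: mult_ac)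
    also have "real i powr (- (3 / 2)) * real i powr (sqrt 2 - 1) = real i powr (sqrt 2 - 5 / 2)"
    proof -
      have "real i powr (- (3 / 2)) * real i powr (sqrt 2 - 1) = real i powr (- (3 / 2) + (sqrt 2 - 1))"
        by (rule powr_add[symmetric])
      also have "- (3 / 2) + (sqrt 2 - 1) = sqrt 2 - 5 / 2" by simp
      finally show ?thesis .
    qed
    also have "C * (2 ^ i * real X) * real i powr (sqrt 2 - 5 / 2) \<le> C * real x * real i powr (sqrt 2 - 5 / 2)"
    proof (intro mult_right_mono mult_left_mono)
      have "2 ^ i * X \<le> x" by (simp add: X_def)
      then have "real (2 ^ i * X) \<le> real x" by (rule of_nat_mono)
      then show "2 ^ i * real X \<le> real x" by simp
    qed (use Cpos in auto)
    finally show ?thesis .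
  qed
  show ?thesis by (rule that[OF Cpos main])
qed

text \<open>Integral comparison in telescoping form, with antiderivative -12 t^(-1/12). The first
  term is bounded separately by I^(-1/12), which makes 13 out of 12.\<close>

lemma sum_powr_tail:
  assumes "I \<ge> 1" "I \<le> K"
  shows "(\<Sum>i\<in>{I..K}. real i powr (- (13 / 12))) \<le> 13 * real I powr (- (1 / 12)) - 12 * real K powr (- (1 / 12))"
  using assms(2)
proof (induction K rule: dec_induct)
  case base
  have "real I powr (- (13 / 12)) \<le> real I powr (- (1 / 12))" by (rule powr_mono) (use assms in auto)
  then show ?case by simp
next
  case (step K)
  have K: "real K > 0" using step assms by simp
  define S where "S = real (Suc K)"
  have S: "S > 0" "S = real K + 1" by (simp_all add: S_def)
  have "S powr (- (13 / 12)) \<le> 12 * (real K powr (- (1 / 12)) - S powr (- (1 / 12)))"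
  proof -
    have "ln (real K / S) \<le> real K / S - 1" by (rule ln_le_minus_one) (use K S in simp)
    also have "\<dots> = - (1 / S)" using S by (simp add: field_simps)
    finally have "1 / (12 * S) \<le> - (1 / 12) * ln (real K / S)" by simp
    moreover have "1 + - (1 / 12) * ln (real K / S) \<le> exp (- (1 / 12) * ln (real K / S))" by (rule exp_ge_add_one_self)
    moreover have "exp (- (1 / 12) * ln (real K / S)) = (real K / S) powr (- (1 / 12))" using K S by (simp add: powr_def)
    ultimately have "1 + 1 / (12 * S) \<le> (real K / S) powr (- (1 / 12))" by linarith
    then have "S powr (- (1 / 12)) * (1 + 1 / (12 * S)) \<le> S powr (- (1 / 12)) * (real K / S) powr (- (1 / 12))"
      by (rule mult_left_mono) simp
    also have "S powr (- (1 / 12)) * (real K / S) powr (- (1 / 12)) = (S * (real K / S)) powr (- (1 / 12))"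
      by (rule powr_mult[symmetric])
    also have "S * (real K / S) = real K" using S by simp
    finally have "S powr (- (1 / 12)) + S powr (- (1 / 12)) / S / 12 \<le> real K powr (- (1 / 12))"
      by (simp add: algebra_simps)
    moreover have "S powr (- (1 / 12)) / S = S powr (- (13 / 12))"
    proof -
      have "S powr (- (1 / 12)) / S powr 1 = S powr (- (1 / 12) - 1)" by (rule powr_diff[symmetric])
      then show ?thesis using S by simp
    qed
    ultimately show ?thesis by simp
  qed
  then show ?case using step by (simp add: S_def)
qed

text \<open>With \<open>q\<close> the largest prime factor of \<open>p - 1\<close>: if \<open>q < 2^I\<close> then \<open>p - 1\<close> is a large smooth
  divisor of \<open>n\<close>, otherwise a block \<open>i \<ge> I\<close> is nonempty for \<open>n\<close>.\<close>
lemma large_shifted_prime_divisor: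
  obtains C where "C > 0" "\<And>I x. I \<ge> 1 \<Longrightarrow>
    real (card {n \<in> {1..x}. \<exists>m. m dvd n \<and> prime (m + 1) \<and> exp (real I ^ 2) < real m}) \<le> C * real x * real I powr (- (1 / 12))"
proof -
  obtain C1 where C1: "C1 > 0" "\<And>i x. i \<ge> 1 \<Longrightarrow>
    real (card {n \<in> {1..x}. \<exists>q\<in>{2 ^ i..<2 ^ Suc i}. prime q \<and> cofactors q n \<noteq> {}}) \<le> C1 * real x * real i powr (sqrt 2 - 5 / 2)"
    using block_existence by blast
  obtain C2 where C2: "C2 > 0" "\<And>y S T. y \<ge> (8::nat) \<Longrightarrow> finite S \<Longrightarrow> S \<subseteq> {m. m > 0 \<and> prime_factors m \<subseteq> primes_le y} \<Longrightarrow>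
     (\<And>m. m \<in> S \<Longrightarrow> T \<le> real m) \<Longrightarrow> T > 0 \<Longrightarrow> (\<Sum>m\<in>S. 1 / real m) \<le> C2 * ln (real y) * T powr (- (1 / ln (real y)))"
    using smooth_tail by blast
  define C where "C = 13 * C1 + 256 * C2"
  have Cpos: "C > 0" using C1(1) C2(1) by (simp add: C_def)
  have main: "real (card {n \<in> {1..x}. \<exists>m. m dvd n \<and> prime (m + 1) \<and> exp (real I ^ 2) < real m}) \<le> C * real x * real I powr (- (1 / 12))"
    if I: "I \<ge> 1" for I x
  proof -
    define P where "P = real I powr (- (1 / 12))"
    \<comment> \<open>ln T = I^2 against ln y \<le> 4 I: the tail of y-smooth divisors beyond T
      gains exp (- I / 4), more than any power of I.\<close>
    define T where "T = exp (real I ^ 2)"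
    define y where "y = (2::nat) ^ (I + 3)"
    define U where "U = (\<lambda>i. {n \<in> {1..x}. \<exists>q\<in>{2 ^ i..<2 ^ Suc i}. prime q \<and> cofactors q n \<noteq> {}})"
    define D where "D = {d \<in> {1..x}. prime_factors d \<subseteq> primes_le y \<and> T \<le> real d}"
    define V where "V = (\<lambda>d. {n \<in> {1..x}. d dvd n})"
    have finU: "finite (U i)" for i by (simp add: U_def)
    have finV: "finite (V i)" for i by (simp add: V_def)
    have finD: "finite D" by (simp add: D_def)
    have T1: "T \<ge> 1" by (simp add: T_def)
    have sub: "{n \<in> {1..x}. \<exists>m. m dvd n \<and> prime (m + 1) \<and> exp (real I ^ 2) < real m} \<subseteq> (\<Union>i\<in>{I..x}. U i) \<union> (\<Union>d\<in>D. V d)"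
    proof
      fix n assume "n \<in> {n \<in> {1..x}. \<exists>m. m dvd n \<and> prime (m + 1) \<and> exp (real I ^ 2) < real m}"
      then obtain m where n: "n \<in> {1..x}" and m: "m dvd n" "prime (m + 1)" "T < real m" by (auto simp: T_def)
      have n0: "n > 0" using n by simp
      have m1: "m > 1" using m(3) T1 by linarith
      obtain q d where q: "prime q" "m = q * d" "d \<in> cofactors q n" "\<And>r. prime r \<Longrightarrow> r dvd m \<Longrightarrow> r \<le> q" "q \<le> n"
        using largest_prime_factor_cofactor[OF m(1) n0 m(2) m1] by metis
      have "q \<ge> 2" using q(1) by (rule prime_ge_2_nat)
      then obtain i where i: "i \<ge> 1" "2 ^ i \<le> q" "q < 2 ^ Suc i" by (rule dyadic_index)
      show "n \<in> (\<Union>i\<in>{I..x}. U i) \<union> (\<Union>d\<in>D. V d)"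
      proof (cases "i \<ge> I")
        case True
        have "i < 2 ^ i" by (rule less_exp)
        moreover have "n \<le> x" using n by simp
        ultimately have "i \<le> x" using i(2) q(5) by linarith
        moreover have "n \<in> U i" using n q(1,3) i(2,3) by (auto simp: U_def)
        ultimately show ?thesis using True by auto
      next
        case False
        have "q \<le> y"
        proof -
          have "(2::nat) ^ Suc i \<le> y" unfolding y_def by (rule power_increasing) (use False in auto)
          then show ?thesis using i(3) by linarith
        qed
        then have "r \<le> y" if "prime r" "r dvd m" for r using q(4)[OF that] by linarith
        then have "prime_factors m \<subseteq> primes_le y" by (auto simp: in_prime_factors_iff)
        moreover have "m \<le> x" using dvd_imp_le[OF m(1) n0] n by simp
        ultimately have "m \<in> D" using m(3) m1 by (simp add: D_def)
        moreover have "n \<in> V m" using n m(1) by (simp add: V_def)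
        ultimately show ?thesis by blast
      qed
    qed
    have "card {n \<in> {1..x}. \<exists>m. m dvd n \<and> prime (m + 1) \<and> exp (real I ^ 2) < real m} \<le> card ((\<Union>i\<in>{I..x}. U i) \<union> (\<Union>d\<in>D. V d))"
      by (rule card_mono[OF _ sub]) (use finU finV finD in auto)
    also have "\<dots> \<le> card (\<Union>i\<in>{I..x}. U i) + card (\<Union>d\<in>D. V d)" by (rule card_Un_le)
    also have "\<dots> \<le> (\<Sum>i\<in>{I..x}. card (U i)) + (\<Sum>d\<in>D. card (V d))"
      by (intro add_mono card_UN_le finD) simp
    finally have "real (card {n \<in> {1..x}. \<exists>m. m dvd n \<and> prime (m + 1) \<and> exp (real I ^ 2) < real m}) \<le> real ((\<Sum>i\<in>{I..x}. card (U i)) + (\<Sum>d\<in>D. card (V d)))"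
      by (rule of_nat_mono)
    also have "\<dots> = (\<Sum>i\<in>{I..x}. real (card (U i))) + (\<Sum>d\<in>D. real (card (V d)))" by simp
    also have "(\<Sum>i\<in>{I..x}. real (card (U i))) \<le> 13 * C1 * real x * P"
    proof (cases "I \<le> x")
      case True
      have "(\<Sum>i\<in>{I..x}. real (card (U i))) \<le> (\<Sum>i\<in>{I..x}. C1 * real x * real i powr (- (13 / 12)))"
      proof (rule sum_mono)
        fix i assume i: "i \<in> {I..x}"
        then have i1: "i \<ge> 1" using I by simp
        have "real (card (U i)) \<le> C1 * real x * real i powr (sqrt 2 - 5 / 2)" unfolding U_def by (rule C1(2)[OF i1])
        also have "\<dots> \<le> C1 * real x * real i powr (- (13 / 12))"
        proof (intro mult_left_mono powr_mono)
          \<comment> \<open>17/12 - 5/2 = -13/12; this rational approximation of sqrt 2 is the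
            origin of the exponent 1/12.\<close>
          have "sqrt 2 \<le> 17 / 12" by (rule real_le_lsqrt) (auto simp: power2_eq_square)
          then show "sqrt 2 - 5 / 2 \<le> - (13 / 12)" by simp
        qed (use i1 C1(1) in auto)
        finally show "real (card (U i)) \<le> C1 * real x * real i powr (- (13 / 12))" .
      qed
      also have "\<dots> = C1 * real x * (\<Sum>i\<in>{I..x}. real i powr (- (13 / 12)))" by (simp only: sum_distrib_left)
      also have "\<dots> \<le> C1 * real x * (13 * P)"
      proof (rule mult_left_mono)
        have "0 \<le> 12 * real x powr (- (1 / 12))" by simp
        then show "(\<Sum>i\<in>{I..x}. real i powr (- (13 / 12))) \<le> 13 * P"
          using sum_powr_tail[OF I True] unfolding P_def by linarith
      qed (use C1(1) in simp)
      finally show ?thesis by (simp add: mult_ac)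
    next
      case False
      then show ?thesis using C1(1) by (simp add: P_def)
    qed
    also have "(\<Sum>d\<in>D. real (card (V d))) \<le> 256 * C2 * real x * P"
    proof -
      have "(\<Sum>d\<in>D. real (card (V d))) \<le> (\<Sum>d\<in>D. real x * (1 / real d))"
      proof (rule sum_mono)
        fix d assume d: "d \<in> D"
        then have d0: "d > 0" by (simp add: D_def)
        show "real (card (V d)) \<le> real x * (1 / real d)"
          using card_multiples_le[OF d0, of x] by (simp add: V_def)
      qed
      also have "\<dots> = real x * (\<Sum>d\<in>D. 1 / real d)" by (simp only: sum_distrib_left)
      also have "\<dots> \<le> real x * (C2 * 256 * P)"
      proof (rule mult_left_mono)
        have y8: "y \<ge> 8" unfolding y_def by (simp add: power_add)
        have L0: "ln (real y) > 0" using y8 by simp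
        have I0: "real I > 0" using I by simp
        have L: "ln (real y) \<le> 4 * real I" unfolding y_def by (rule ln_smoothness_le) fact
        have "(\<Sum>d\<in>D. 1 / real d) \<le> C2 * ln (real y) * T powr (- (1 / ln (real y)))"
          by (rule C2(2)[OF y8 finD]) (use T1 in \<open>auto simp: D_def\<close>)
        also have "T powr (- (1 / ln (real y))) = exp (- (real I ^ 2 / ln (real y)))"
          by (simp add: T_def powr_def)
        also have "C2 * ln (real y) * exp (- (real I ^ 2 / ln (real y))) \<le> C2 * (4 * real I) * exp (- (1 / 4 * real I))"
        proof (intro mult_mono mult_left_mono L)
          have "real I ^ 2 / (4 * real I) \<le> real I ^ 2 / ln (real y)"
            by (rule divide_left_mono[OF L]) (use L0 I0 in auto)
          moreover have "real I ^ 2 / (4 * real I) = 1 / 4 * real I" using I0 by (simp add: power2_eq_square)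
          ultimately show "exp (- (real I ^ 2 / ln (real y))) \<le> exp (- (1 / 4 * real I))" by simp
        qed (use C2(1) L0 in auto)
        also have "\<dots> \<le> C2 * 256 * P"
        proof -
          have "real I ^ 2 \<le> (real 2 / (1 / 4)) ^ 2 * exp (1 / 4 * real I)" by (rule power_le_exp) auto
          then have "real I * real I * exp (- (1 / 4 * real I)) \<le> 64"
            by (simp add: power2_eq_square exp_minus field_simps)
          then have "real I * exp (- (1 / 4 * real I)) * real I \<le> 64" by (simp only: mult_ac)
          then have "real I * exp (- (1 / 4 * real I)) \<le> 64 / real I" using I0 by (simp only: pos_le_divide_eq)
          also have "64 / real I = 64 * real I powr (- 1)" using I0 by (simp add: powr_minus inverse_eq_divide)
          also have "\<dots> \<le> 64 * P" unfolding P_def using I by (intro mult_left_mono powr_mono) auto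
          finally have "C2 * 4 * (real I * exp (- (1 / 4 * real I))) \<le> C2 * 4 * (64 * P)"
            by (rule mult_left_mono) (use C2(1) in simp)
          then show ?thesis by (simp add: mult_ac)
        qed
        finally show "(\<Sum>d\<in>D. 1 / real d) \<le> C2 * 256 * P" .
      qed simp
      finally show ?thesis by (simp add: mult_ac)
    qed
    finally have "real (card {n \<in> {1..x}. \<exists>m. m dvd n \<and> prime (m + 1) \<and> exp (real I ^ 2) < real m}) \<le> 13 * C1 * real x * P + 256 * C2 * real x * P"
      by simp
    also have "\<dots> = C * real x * P" unfolding C_def by (simp add: algebra_simps)
    finally show ?thesis unfolding P_def .
  qed
  show ?thesis by (rule that[OF Cpos main])
qed

section \<open>The counting function\<close>

text \<open>Integers with a very large divisor p - 1 are set aside as \<open>B\<close>; for all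
  others \<open>omega_star\<close> equals the truncated count \<open>s\<close>, to which Markov's
  inequality applies. The truncation keeps the first moment at ln y instead of ln ln x.\<close>

lemma count_bound_by_first_moment:
  obtains C where "C > 0" "\<And>x y. y \<ge> 2 \<Longrightarrow> real (card {n \<in> {1..x}. y \<le> real (omega_star n)}) \<le> C * real x * ln y / y"
proof -
  obtain C1 where C1: "C1 > 0" "\<And>I x. I \<ge> 1 \<Longrightarrow>
    real (card {n \<in> {1..x}. \<exists>m. m dvd n \<and> prime (m + 1) \<and> exp (real I ^ 2) < real m}) \<le> C1 * real x * real I powr (- (1 / 12))"
    using large_shifted_prime_divisor by blast
  define C2 :: real where "C2 = 2 * (50 + 2 * (3 - ln (ln 2)))"
  have neg: "ln (ln 2) < (0::real)" using ln_2_less_1 by simp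
  have "0 < 2 * (50 + 2 * (3 - l))" if "l < 0" for l :: real using that by simp
  from this[OF neg] have C2: "C2 > 0" unfolding C2_def .
  define C where "C = C2 + 2 * C1"
  have Cpos: "C > 0" using C1(1) C2 by (simp add: C_def)
  have main: "real (card {n \<in> {1..x}. y \<le> real (omega_star n)}) \<le> C * real x * ln y / y" if y: "y \<ge> 2" for x y
  proof -
    have ly: "ln y \<ge> 1 / 2"
    proof -
      have "ln 2 \<le> ln y" using y by (intro ln_mono) auto
      then show ?thesis using ln_2_ge_half by linarith
    qed
    \<comment> \<open>I \<ge> y^12 turns the saving I^(-1/12) into 1 / y.\<close>
    define I where "I = nat \<lceil>y ^ 12\<rceil>"
    have y12: "y ^ 12 \<ge> 1" using y by (intro one_le_power) auto
    have I: "y ^ 12 \<le> real I" "real I \<le> y ^ 12 + 1" unfolding I_def using y12 by linarith+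
    have I1: "I \<ge> 1" using I(1) y12 by linarith
    define Z where "Z = nat \<lfloor>exp (real I ^ 2)\<rfloor>"
    have ZI: "real Z \<le> exp (real I ^ 2)" by (simp add: Z_def)
    have Z1: "Z \<ge> 1" unfolding Z_def by (simp add: le_nat_iff le_floor_iff)
    define D where "D = {m. 0 < m \<and> m \<le> Z \<and> prime (m + 1)}"
    have finD: "finite D" by (rule finite_subset[of _ "{..Z}"]) (auto simp: D_def)
    define s where "s = (\<lambda>n. card {m \<in> D. m dvd n})"
    define A where "A = {n \<in> {1..x}. y \<le> real (s n)}"
    define B where "B = {n \<in> {1..x}. \<exists>m. m dvd n \<and> prime (m + 1) \<and> exp (real I ^ 2) < real m}"
    have "{n \<in> {1..x}. y \<le> real (omega_star n)} \<subseteq> A \<union> B"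
    proof
      fix n assume n: "n \<in> {n \<in> {1..x}. y \<le> real (omega_star n)}"
      show "n \<in> A \<union> B"
      proof (cases "n \<in> B")
        case False
        have "{d. d dvd n \<and> (\<exists>p. prime p \<and> d = p - 1)} \<subseteq> {m \<in> D. m dvd n}"
        proof
          fix d assume "d \<in> {d. d dvd n \<and> (\<exists>p. prime p \<and> d = p - 1)}"
          then obtain p where d: "d dvd n" "prime p" "d = p - 1" by blast
          have "p > 1" using d(2) by (rule prime_gt_1_nat)
          then have pd: "prime (d + 1)" "d > 0" using d by auto
          have "real d \<le> exp (real I ^ 2)" using False n d(1) pd(1) by (auto simp: B_def not_less)
          then have "d \<le> Z" unfolding Z_def by (simp add: le_nat_iff le_floor_iff)
          then show "d \<in> {m \<in> D. m dvd n}" using d(1) pd by (simp add: D_def)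
        qed
        then have "omega_star n \<le> s n" unfolding omega_star_def s_def by (intro card_mono) (use finD in auto)
        then have "real (omega_star n) \<le> real (s n)" by (rule of_nat_mono)
        then show ?thesis using n by (simp add: A_def)
      qed simp
    qed
    then have "card {n \<in> {1..x}. y \<le> real (omega_star n)} \<le> card (A \<union> B)" by (intro card_mono) (auto simp: A_def B_def)
    also have "\<dots> \<le> card A + card B" by (rule card_Un_le)
    finally have "real (card {n \<in> {1..x}. y \<le> real (omega_star n)}) \<le> real (card A + card B)" by (rule of_nat_mono)
    also have "\<dots> = real (card A) + real (card B)" by simp
    also have "real (card A) \<le> C2 * real x * ln y / y"
    proof -
      have "real (card A) * y = (\<Sum>n\<in>A. y)" by simp
      also have "\<dots> \<le> (\<Sum>n\<in>A. real (s n))" by (rule sum_mono) (simp add: A_def)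
      also have "\<dots> \<le> (\<Sum>n\<in>{1..x}. real (s n))" by (rule sum_mono2) (auto simp: A_def)
      also have "\<dots> = (\<Sum>n\<in>{1..x}. \<Sum>m | m \<in> D \<and> m dvd n. 1)" by (simp add: s_def)
      also have "\<dots> = (\<Sum>m\<in>D. \<Sum>n | n \<in> {1..x} \<and> m dvd n. 1)" by (rule sum.swap_restrict) (use finD in auto)
      \<comment> \<open>Passing from 1 / (p - 1) to 2 / p brings the sum into the form of Mertens'
        second theorem.\<close>
      also have "\<dots> \<le> (\<Sum>m\<in>D. 2 * real x * (1 / real (m + 1)))"
      proof (rule sum_mono)
        fix m assume "m \<in> D"
        then have m0: "m > 0" by (simp add: D_def)
        have "real (card {n. n \<in> {1..x} \<and> m dvd n}) \<le> real x / real m" by (rule card_multiples_le[OF m0])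
        also have "\<dots> \<le> 2 * real x * (1 / real (m + 1))"
        proof -
          have "1 / real m \<le> 2 / real (m + 1)" using m0 by (simp add: field_simps)
          then have "real x * (1 / real m) \<le> real x * (2 / real (m + 1))" by (rule mult_left_mono) simp
          then show ?thesis by (simp add: mult_ac)
        qed
        finally show "(\<Sum>n | n \<in> {1..x} \<and> m dvd n. (1::real)) \<le> 2 * real x * (1 / real (m + 1))" by simp
      qed
      also have "\<dots> = 2 * real x * (\<Sum>m\<in>D. 1 / real (m + 1))" by (simp only: sum_distrib_left)
      also have "\<dots> \<le> 2 * real x * (ln y * (50 + 2 * (3 - ln (ln 2))))"
      proof (rule mult_left_mono)
        have "(\<Sum>m\<in>D. 1 / real (m + 1)) = (\<Sum>p\<in>Suc ` D. 1 / real p)" by (subst sum.reindex) auto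
        also have "\<dots> \<le> (\<Sum>p\<in>primes_le (Z + 1). 1 / real p)" by (rule sum_mono2) (auto simp: D_def)
        also have "\<dots> \<le> ln (ln (real (Z + 1))) + (3 - ln (ln 2))" by (rule Mertens_second_upper) (use Z1 in simp)
        \<comment> \<open>27 = 24 + 3: the main part is I^2 \<le> 4 y^24, and the remaining constant
          8 is at most y^3 because y \<ge> 2.\<close>
        also have "ln (ln (real (Z + 1))) \<le> 27 * ln y"
        proof -
          have "1 \<le> exp (real I ^ 2)" by simp
          moreover have "real (Z + 1) = real Z + 1" by simp
          ultimately have "real (Z + 1) \<le> 2 * exp (real I ^ 2)" using ZI by linarith
          then have "ln (real (Z + 1)) \<le> ln (2 * exp (real I ^ 2))" by (intro ln_mono) auto
          also have "\<dots> = ln 2 + real I ^ 2" by (subst ln_mult) auto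
          also have "\<dots> \<le> 2 * real I ^ 2"
          proof -
            have "1 \<le> real I ^ 2" using I1 by (intro one_le_power) simp
            then show ?thesis using ln_2_less_1 by linarith
          qed
          also have "\<dots> \<le> y ^ 27"
          proof -
            have "real I \<le> 2 * y ^ 12" using I(2) y12 by linarith
            then have "real I ^ 2 \<le> (2 * y ^ 12) ^ 2" by (rule power_mono) simp
            also have "\<dots> = 4 * y ^ 24" by (simp add: power_mult_distrib)
            finally have "2 * real I ^ 2 \<le> 2 ^ 3 * y ^ 24" by simp
            also have "\<dots> \<le> y ^ 3 * y ^ 24" using y by (intro mult_right_mono power_mono) auto
            also have "\<dots> = y ^ 27" by (simp add: power_add[symmetric])
            finally show ?thesis .
          qed
          finally have le: "ln (real (Z + 1)) \<le> y ^ 27" .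
          have "ln (real (Z + 1)) > 0" using Z1 by simp
          then have "ln (ln (real (Z + 1))) \<le> ln (y ^ 27)" using le by (intro ln_mono) auto
          also have "\<dots> = 27 * ln y" using y by (simp add: ln_realpow)
          finally show ?thesis .
        qed
        also have "27 * ln y + (3 - ln (ln 2)) \<le> ln y * (50 + 2 * (3 - ln (ln 2)))"
        proof -
          have "3 - ln (ln 2) \<ge> (0::real)" using neg by linarith
          then have "1 / 2 * (2 * (3 - ln (ln 2))) \<le> ln y * (2 * (3 - ln (ln 2)))" using ly by (intro mult_right_mono) auto
          then show ?thesis using ly by (simp add: algebra_simps)
        qed
        finally show "(\<Sum>m\<in>D. 1 / real (m + 1)) \<le> ln y * (50 + 2 * (3 - ln (ln 2)))" by simp
      qed simp
      also have "\<dots> = C2 * real x * ln y" by (simp only: C2_def mult_ac)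
      finally show ?thesis using y by (simp add: le_divide_eq)
    qed
    also have "real (card B) \<le> 2 * C1 * real x * ln y / y"
    proof -
      have "real (card B) \<le> C1 * real x * real I powr (- (1 / 12))" unfolding B_def by (rule C1(2)[OF I1])
      also have "\<dots> \<le> C1 * real x * (1 / y)"
      proof (rule mult_left_mono)
        have "real I powr (- (1 / 12)) \<le> (y ^ 12) powr (- (1 / 12))"
          by (rule powr_mono2') (use I(1) y12 in auto)
        also have "(y ^ 12) powr (- (1 / 12)) = y powr (- 1)"
        proof -
          have "y ^ 12 = y powr 12" using y by simp
          then show ?thesis by (simp only: powr_powr) simp
        qed
        also have "\<dots> = 1 / y" using y by (simp add: powr_minus inverse_eq_divide)
        finally show "real I powr (- (1 / 12)) \<le> 1 / y" .
      qed (use C1(1) in simp)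
      also have "\<dots> \<le> C1 * real x * (2 * ln y / y)"
        using ly y C1(1) by (intro mult_left_mono divide_right_mono) auto
      finally show ?thesis by (simp add: mult_ac)
    qed
    finally have "real (card {n \<in> {1..x}. y \<le> real (omega_star n)}) \<le> C2 * real x * ln y / y + 2 * C1 * real x * ln y / y" by simp
    also have "\<dots> = C * real x * ln y / y" unfolding C_def by (simp add: algebra_simps add_divide_distrib)
    finally show ?thesis .
  qed
  show ?thesis by (rule that[OF Cpos main])
qed

text \<open>Markov's inequality for the j-th power. The conclusion is an explicit existential so
  that \<open>bchoice\<close> can select the constants for all j at once.\<close>

lemma count_bound_by_moment:
  assumes j: "j \<ge> 2"
  shows "\<exists>C>0. \<forall>x y. x \<ge> 2 \<longrightarrow> y > 0 \<longrightarrow>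
    real (card {n \<in> {1..x}. y \<le> real (omega_star n)}) \<le> C * real x * ln (real x) ^ (2 ^ j - j - 1) / y ^ j"
proof -
  obtain C where C: "C > 0" "\<And>x. x \<ge> 2 \<Longrightarrow> (\<Sum>n\<in>{1..x}. real (omega_star n) ^ j) \<le> C * real x * ln (real x) ^ (2 ^ j - j - 1)"
    using omega_star_moment[OF j] by blast
  have "real (card {n \<in> {1..x}. y \<le> real (omega_star n)}) \<le> C * real x * ln (real x) ^ (2 ^ j - j - 1) / y ^ j"
    if x: "x \<ge> 2" and y: "y > 0" for x y
  proof -
    define A where "A = {n \<in> {1..x}. y \<le> real (omega_star n)}"
    have "real (card A) * y ^ j = (\<Sum>n\<in>A. y ^ j)" by simp
    also have "\<dots> \<le> (\<Sum>n\<in>A. real (omega_star n) ^ j)"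
      by (intro sum_mono power_mono) (use y in \<open>auto simp: A_def\<close>)
    also have "\<dots> \<le> (\<Sum>n\<in>{1..x}. real (omega_star n) ^ j)" by (rule sum_mono2) (auto simp: A_def)
    also have "\<dots> \<le> C * real x * ln (real x) ^ (2 ^ j - j - 1)" by (rule C(2)[OF x])
    finally show ?thesis using y by (simp add: A_def le_divide_eq)
  qed
  then show ?thesis using C(1) by blast
qed

(* The range is 2 \<le> y rather than 1 \<le> y: at y = 1 the bound contains ln 1 = 0 whereas
   N x 1 = \<lfloor>x\<rfloor> > 0, and it also fails with a uniform constant as y tends to 1. *)
theorem proposition5p1:
  fixes k :: nat
  assumes "k \<ge> 2"
  shows "\<exists>C::real. C > 0 \<and> (\<forall>x y :: real. 2 \<le> y \<longrightarrow> y \<le> x \<longrightarrow>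
           real (N x y) \<le> C * min (x * ln y / y)
             (Min ((\<lambda>j::nat. x * ln x ^ (2 ^ j - j - 1) / y ^ j) ` {2..k})))"
proof -
  obtain C0 where C0: "C0 > 0" "\<And>x y. y \<ge> 2 \<Longrightarrow> real (card {n \<in> {1..x}. y \<le> real (omega_star n)}) \<le> C0 * real x * ln y / y"
    using count_bound_by_first_moment by blast
  have "\<forall>j\<in>{2..k}. \<exists>C>0. \<forall>x y. x \<ge> 2 \<longrightarrow> y > 0 \<longrightarrow>
    real (card {n \<in> {1..x}. y \<le> real (omega_star n)}) \<le> C * real x * ln (real x) ^ (2 ^ j - j - 1) / y ^ j"
    using count_bound_by_moment by simp
  from bchoice[OF this] obtain c where c: "\<And>j. j \<in> {2..k} \<Longrightarrow> c j > 0"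
    "\<And>j x y. j \<in> {2..k} \<Longrightarrow> x \<ge> 2 \<Longrightarrow> y > 0 \<Longrightarrow>
      real (card {n \<in> {1..x}. y \<le> real (omega_star n)}) \<le> c j * real x * ln (real x) ^ (2 ^ j - j - 1) / y ^ j"
    by blast
  \<comment> \<open>The sum dominates every single constant and depends on k only, as the claim
    requires.\<close>
  define C where "C = C0 + (\<Sum>j\<in>{2..k}. c j)"
  have sum0: "(\<Sum>j\<in>{2..k}. c j) \<ge> 0" by (rule sum_nonneg) (use c(1) in \<open>auto intro: less_imp_le\<close>)
  have C: "C > 0" "C0 \<le> C" using C0(1) sum0 by (auto simp: C_def)
  have cC: "c j \<le> C" if "j \<in> {2..k}" for j
  proof -
    have "c j \<le> (\<Sum>j\<in>{2..k}. c j)"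
      by (rule member_le_sum[OF that]) (use c(1) in \<open>auto intro: less_imp_le\<close>)
    then show ?thesis using C0(1) by (simp add: C_def)
  qed
  have "real (N x y) \<le> C * min (x * ln y / y) (Min ((\<lambda>j::nat. x * ln x ^ (2 ^ j - j - 1) / y ^ j) ` {2..k}))"
    if y: "2 \<le> y" and yx: "y \<le> x" for x y :: real
  proof -
    \<comment> \<open>The counting lemmas take a natural cutoff; passing from \<open>X\<close> back
      to x is harmless since the bounds increase with the cutoff.\<close>
    define X where "X = nat \<lfloor>x\<rfloor>"
    have x2: "x \<ge> 2" using y yx by simp
    have X2: "X \<ge> 2" unfolding X_def using x2 by (simp add: le_nat_iff le_floor_iff)
    have Xx: "real X \<le> x" unfolding X_def using x2 by simp
    have "n \<le> X \<longleftrightarrow> real n \<le> x" for n unfolding X_def using x2 by (simp add: le_nat_iff le_floor_iff)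
    then have "{n. 0 < n \<and> real n \<le> x \<and> real (omega_star n) \<ge> y} = {n \<in> {1..X}. y \<le> real (omega_star n)}"
      by (intro Collect_cong) (auto simp: Suc_le_eq)
    then have N_eq: "N x y = card {n \<in> {1..X}. y \<le> real (omega_star n)}" by (simp only: N_def)
    have ly: "ln y \<ge> 0" and lX: "ln (real X) \<ge> 0" "ln (real X) \<le> ln x" using y X2 Xx by auto
    have first: "real (N x y) \<le> C * (x * ln y / y)"
    proof -
      have "real (N x y) \<le> C0 * real X * ln y / y" unfolding N_eq by (rule C0(2)[OF y])
      also have "\<dots> \<le> C * x * ln y / y"
        using C0(1) C Xx ly y by (intro divide_right_mono mult_right_mono mult_mono) auto
      finally show ?thesis by simp
    qed
    have moment: "real (N x y) \<le> C * (x * ln x ^ (2 ^ j - j - 1) / y ^ j)" if j: "j \<in> {2..k}" for j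
    proof -
      have "real (N x y) \<le> c j * real X * ln (real X) ^ (2 ^ j - j - 1) / y ^ j"
        unfolding N_eq by (rule c(2)[OF j X2]) (use y in simp)
      also have "\<dots> \<le> C * x * ln x ^ (2 ^ j - j - 1) / y ^ j"
        using c(1)[OF j] cC[OF j] C Xx lX y x2 by (intro divide_right_mono mult_mono power_mono) auto
      finally show ?thesis by simp
    qed
    have "real (N x y) / C \<le> min (x * ln y / y) (Min ((\<lambda>j::nat. x * ln x ^ (2 ^ j - j - 1) / y ^ j) ` {2..k}))"
    proof (rule min.boundedI)
      show "real (N x y) / C \<le> x * ln y / y" using first C(1) by (simp only: pos_divide_le_eq mult.commute)
      show "real (N x y) / C \<le> Min ((\<lambda>j::nat. x * ln x ^ (2 ^ j - j - 1) / y ^ j) ` {2..k})"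
      proof (rule Min.boundedI)
        fix a assume "a \<in> (\<lambda>j::nat. x * ln x ^ (2 ^ j - j - 1) / y ^ j) ` {2..k}"
        then obtain j where j: "a = x * ln x ^ (2 ^ j - j - 1) / y ^ j" "j \<in> {2..k}" by (rule imageE)
        show "real (N x y) / C \<le> a" unfolding j(1) using moment[OF j(2)] C(1) by (simp only: pos_divide_le_eq mult.commute)
      qed (use assms in auto)
    qed
    then show ?thesis using C(1) by (simp only: pos_divide_le_eq mult.commute)
  qed
  then show ?thesis using C(1) by blast
qed

end
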